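(* The subgroup $\mathcal{M}_n:=\{\omega_u\mid u\in\mathbb{M}_n^*\}$ of $G_n$ equals $\{\sigma\in G_n\mid \sigma(x_i)-x_i\in\mathbb{F}_n,\ \sigma(y_i)-y_i\in\mathbb{F}_n\ \text{for all } i=1,\dots,n\}$. Moreover, fixing for each $s=1,\dots,n$ an arbitrary order on the subsets $I\subseteq\{1,\dots,n\}$ with $|I|=s$, every $\sigma\in\mathcal{M}_n$ can be written uniquely as $$\sigma=\prod_{|I_1|=1}\omega_{u(I_1)}\cdot\prod_{|I_2|=2}\omega_{u(I_2)}\cdots\prod_{|I_n|=n}\omega_{u(I_n)}$$ with $u(I_s)\in\mathbb{M}_{I_s}^*$.
   Context: $K$ is a field of characteristic zero. $\mathbb{S}_n$ is the $K$-algebra generated by $x_1,\dots,x_n,y_1,\dots,y_n$ with defining relations $y_ix_i=1$ and $[x_i,y_j]=[x_i,x_j]=[y_i,y_j]=0$ for $i\ne j$; $G_n=\mathrm{Aut}_{K\text{-alg}}(\mathbb{S}_n)$, and $\omega_u(a)=uau^{-1}$. For $k,l\in\mathbb{N}$, $E_{kl}(i):=x_i^ky_i^l-x_i^{k+1}y_i^{l+1}$. For a nonempty $I\subseteq\{1,\dots,n\}$, $F(I):=\bigoplus_{\alpha,\beta\in\mathbb{N}^I}K\prod_{i\in I}E_{\alpha_i\beta_i}(i)$ (an algebra without $1$ isomorphic to $M_\infty(K)$), $\mathbb{M}_I:=1+F(I)$ with group of units $\mathbb{M}_I^*$. $\mathbb{F}_n:=K\oplus\bigoplus_{\emptyset\ne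 I\subseteq\{1,\dots,n\}}F(I)$ (a subalgebra of $\mathbb{S}_n$), $\mathbb{M}_n:=1+\sum_{\emptyset\ne I}F(I)$ (a multiplicative monoid), and $\mathbb{M}_n^*$ its group of units. *)

theory Defs
  imports Main "HOL-Library.FuncSet"
begin

text \<open>Concrete model of the Jacobson algebra S_n: its faithful representation on
  coefficient functions of polynomials.  An element of S_n is a K-linear operator on
  the space of functions (nat => nat) => K (coefficients of monomials x^m);
  x_i multiplies by x_i, y_i is the left shift in the i-th variable
  (so y_i x_i = 1).  Variables are indexed by 0..<n instead of 1..n.
  Multiplication in S_n is composition of operators.\<close>

type_synonym 'a op = "((nat \<Rightarrow> nat) \<Rightarrow> 'a) \<Rightarrow> ((nat \<Rightarrow> nat) \<Rightarrow> 'a)"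

definition X :: "nat \<Rightarrow> ('a::field_char_0) op" where
  "X i = (\<lambda>f m. if m i = 0 then 0 else f (m(i := m i - 1)))"

definition Y :: "nat \<Rightarrow> ('a::field_char_0) op" where
  "Y i = (\<lambda>f m. f (m(i := m i + 1)))"

definition opadd :: "('a::field_char_0) op \<Rightarrow> 'a op \<Rightarrow> 'a op" where
  "opadd A B = (\<lambda>f m. A f m + B f m)"

definition opminus :: "('a::field_char_0) op \<Rightarrow> 'a op \<Rightarrow> 'a op" where
  "opminus A B = (\<lambda>f m. A f m - B f m)"

definition opsmul :: "'a::field_char_0 \<Rightarrow> 'a op \<Rightarrow> 'a op" where
  "opsmul c A = (\<lambda>f m. c * A f m)"

definition opzero :: "('a::field_char_0) op" where
  "opzero = (\<lambda>f m. 0)"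

inductive_set Sn :: "nat \<Rightarrow> ('a::field_char_0) op set" for n where
  one: "id \<in> Sn n"
| genx: "i < n \<Longrightarrow> X i \<in> Sn n"
| geny: "i < n \<Longrightarrow> Y i \<in> Sn n"
| add: "a \<in> Sn n \<Longrightarrow> b \<in> Sn n \<Longrightarrow> opadd a b \<in> Sn n"
| smul: "a \<in> Sn n \<Longrightarrow> opsmul c a \<in> Sn n"
| mult: "a \<in> Sn n \<Longrightarrow> b \<in> Sn n \<Longrightarrow> a \<circ> b \<in> Sn n"

inductive_set opspan :: "('a::field_char_0) op set \<Rightarrow> 'a op set" for S where
  zero: "opzero \<in> opspan S"
| base: "a \<in> S \<Longrightarrow> a \<in> opspan S"
| add: "a \<in> opspan S \<Longrightarrow> b \<in> opspan S \<Longrightarrow> opadd a b \<in> opspan S"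
| smul: "a \<in> opspan S \<Longrightarrow> opsmul c a \<in> opspan S"

definition Gn :: "nat \<Rightarrow> ('a::field_char_0 op \<Rightarrow> 'a op) set" where
  "Gn n = {\<sigma>. bij_betw \<sigma> (Sn n) (Sn n)
      \<and> (\<forall>a\<in>Sn n. \<forall>b\<in>Sn n. \<sigma> (opadd a b) = opadd (\<sigma> a) (\<sigma> b) \<and> \<sigma> (a \<circ> b) = \<sigma> a \<circ> \<sigma> b)
      \<and> (\<forall>c. \<forall>a\<in>Sn n. \<sigma> (opsmul c a) = opsmul c (\<sigma> a))
      \<and> \<sigma> id = id
      \<and> (\<forall>a. a \<notin> Sn n \<longrightarrow> \<sigma> a = undefined)}"

definition gmul :: "nat \<Rightarrow> ('a::field_char_0 op \<Rightarrow> 'a op) \<Rightarrow> ('a op \<Rightarrow> 'a op) \<Rightarrow> ('a op \<Rightarrow> 'a op)" where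
  "gmul n \<sigma> \<tau> = restrict (\<sigma> \<circ> \<tau>) (Sn n)"

definition gone :: "nat \<Rightarrow> ('a::field_char_0 op \<Rightarrow> 'a op)" where
  "gone n = restrict id (Sn n)"

definition omega :: "nat \<Rightarrow> ('a::field_char_0) op \<Rightarrow> ('a op \<Rightarrow> 'a op)" where
  "omega n u = restrict (\<lambda>a. u \<circ> a \<circ> inv u) (Sn n)"

definition E :: "nat \<Rightarrow> nat \<Rightarrow> nat \<Rightarrow> ('a::field_char_0) op" where
  "E k l i = opminus ((X i ^^ k) \<circ> (Y i ^^ l)) ((X i ^^ (k+1)) \<circ> (Y i ^^ (l+1)))"

text \<open>prod_{i in I} E_{alpha_i beta_i}(i) (factors commute; taken in increasing order).\<close>
definition eprod :: "nat set \<Rightarrow> (nat \<Rightarrow> nat) \<Rightarrow> (nat \<Rightarrow> nat) \<Rightarrow> ('a::field_char_0) op" where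
  "eprod I \<alpha> \<beta> = foldr (\<lambda>i acc. E (\<alpha> i) (\<beta> i) i \<circ> acc) (sorted_list_of_set I) id"

definition FI :: "nat set \<Rightarrow> ('a::field_char_0) op set" where
  "FI I = opspan {eprod I \<alpha> \<beta> | \<alpha> \<beta>. True}"

definition MI :: "nat set \<Rightarrow> ('a::field_char_0) op set" where
  "MI I = {opadd id a | a. a \<in> FI I}"

definition MI_units :: "nat set \<Rightarrow> ('a::field_char_0) op set" where
  "MI_units I = {u \<in> MI I. \<exists>v \<in> MI I. u \<circ> v = id \<and> v \<circ> u = id}"

definition Fn :: "nat \<Rightarrow> ('a::field_char_0) op set" where
  "Fn n = opspan ({id} \<union> {eprod I \<alpha> \<beta> | I \<alpha> \<beta>. I \<subseteq> {0..<n} \<and> I \<noteq> {}})"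

definition Mn :: "nat \<Rightarrow> ('a::field_char_0) op set" where
  "Mn n = {opadd id a | a. a \<in> opspan {eprod I \<alpha> \<beta> | I \<alpha> \<beta>. I \<subseteq> {0..<n} \<and> I \<noteq> {}}}"

definition Mn_units :: "nat \<Rightarrow> ('a::field_char_0) op set" where
  "Mn_units n = {u \<in> Mn n. \<exists>v \<in> Mn n. u \<circ> v = id \<and> v \<circ> u = id}"

text \<open>The ordered product: L s lists the subsets of size s in the chosen order;
  product omega_{u(I_1)} ... over |I|=1, then |I|=2, ..., |I|=n.\<close>
definition decomp_prod :: "nat \<Rightarrow> (nat \<Rightarrow> nat set list) \<Rightarrow> (nat set \<Rightarrow> ('a::field_char_0) op) \<Rightarrow> ('a op \<Rightarrow> 'a op)" where
  "decomp_prod n L u = foldr (\<lambda>I acc. gmul n (omega n (u I)) acc) (concat (map L [1..<Suc n])) (gone n)"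

end

theory Submission
  imports Defs "Jordan_Normal_Form.Determinant"
begin

text \<open>
  Elements of the algebra are row- and column-finite matrices indexed by monomials. For every index
  set \<open>I\<close> there is an algebra homomorphism \<open>\<pi>\<^sub>I\<close> onto the subalgebra with variables in \<open>I\<close> that sends
  the generators with index outside \<open>I\<close> to 1; it is the identity on \<open>F(J)\<close> for \<open>J \<subseteq> I\<close> and kills
  \<open>F(J)\<close> otherwise. As \<open>F(I) F(J) \<subseteq> F(I \<union> J)\<close>, applying \<open>\<pi>\<^sub>I\<close> for smaller \<open>I\<close> first yields the
  unique factorisation of units, and conjugation is injective on units because a finite matrix that
  commutes with some \<open>x\<^sub>i\<close> is zero.

  Let \<open>\<sigma>\<close> change the generators by elements of the sum of the \<open>F(J)\<close>, and let \<open>I\<close> be a minimal index set that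
  occurs. A torus action shows that \<open>\<pi>\<^sub>I \<circ> \<sigma>\<close> still sends the generators outside \<open>I\<close> to 1, so it
  induces a surjective endomorphism \<open>\<tau>\<close> of the subalgebra with variables in \<open>I\<close>, congruent to the identity
  modulo finite matrices. The idempotent \<open>p = E\<^sub>0\<^sub>0\<close> is a commutator, so \<open>\<tau> p\<close> has trace 1; it is then
  of rank one, and transporting matrix units gives an invertible matrix \<open>\<phi>\<close> with
  \<open>\<tau> a = \<phi> a \<phi>\<^sup>-\<^sup>1\<close>. The relations make \<open>\<phi>\<close> and its inverse Toeplitz outside a finite box, in rows and
  columns respectively, which forces \<open>\<phi>\<close> to be a scalar outside the box. Dividing by the
  scalar gives a unit in \<open>1 + F(I)\<close>; conjugating with it removes \<open>F(I)\<close> from the perturbation.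
\<close>


section \<open>Row- and column-finite matrices\<close>

text \<open>The intertwining matrix \<open>phi\<close> arises as an infinite sum and a priori lies
  outside the algebra, so the computations take place in a ring large enough to contain it. Finite
  rows let a matrix act on all coefficient functions; finite columns as well make the ring closed
  under transposition, which exchanges x_i and y_i. F_n contains K, so a constant term of
  \<sigma>(x_i) - x_i has to be excluded rather than conjugated away. This is the case I = {}: every
  variable is then outside I and the torus argument covers all of them. In one variable the Toeplitz
  relation by itself would allow a power of a shift far out; only the vanishing index of an
  invertible operator rules it out. With a second variable one can leave the box in that direction
  and argue from the relations alone. Surjectivity of \<sigma> gives rank one of \<tau> p, and also
  the finiteness of the rows of \<open>phi\<close> and the columns of \<open>psi\<close>.
  Characteristic zero turns an equality of traces into one of natural numbers and separates the
  torus parameters 1, -1 and 2.\<close>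

typedef (overloaded) ('i, 'a::zero) rcmat =
  "{M :: 'i \<Rightarrow> 'i \<Rightarrow> 'a. (\<forall>m. finite {k. M m k \<noteq> 0}) \<and> (\<forall>k. finite {m. M m k \<noteq> 0})}"
  morphisms ent Abs_rcmat
  by (rule exI[of _ "\<lambda>_ _. 0"]) simp

setup_lifting type_definition_rcmat

lemma finite_row [simp]: "finite {k. ent a m k \<noteq> 0}"
  using ent[of a] by simp

lemma finite_col [simp]: "finite {m. ent a m k \<noteq> 0}"
  using ent[of a] by simp

lemma rcmat_eqI: "(\<And>m k. ent a m k = ent b m k) \<Longrightarrow> a = b"
  by (meson ent_inject ext)

lemma ent_Abs_rcmat:
  assumes "\<And>m. finite {k. M m k \<noteq> 0}" "\<And>k. finite {m. M m k \<noteq> 0}"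
  shows "ent (Abs_rcmat M) = M"
  using assms by (simp add: Abs_rcmat_inverse)

instantiation rcmat :: (type, comm_ring_1) ring_1
begin

lift_definition zero_rcmat :: "('a, 'b) rcmat" is "\<lambda>_ _. 0" by simp

lift_definition one_rcmat :: "('a, 'b) rcmat" is "\<lambda>m k. if m = k then 1 else 0" by simp

lift_definition plus_rcmat :: "('a, 'b) rcmat \<Rightarrow> ('a, 'b) rcmat \<Rightarrow> ('a, 'b) rcmat"
  is "\<lambda>M N m k. M m k + N m k"
proof (intro conjI allI)
  fix M N :: "'a \<Rightarrow> 'a \<Rightarrow> 'b" and j
  assume h: "(\<forall>m. finite {k. M m k \<noteq> 0}) \<and> (\<forall>k. finite {m. M m k \<noteq> 0})"
    "(\<forall>m. finite {k. N m k \<noteq> 0}) \<and> (\<forall>k. finite {m. N m k \<noteq> 0})"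
  show "finite {k. M j k + N j k \<noteq> 0}"
    by (rule finite_subset[of _ "{k. M j k \<noteq> 0} \<union> {k. N j k \<noteq> 0}"]) (use h in auto)
  show "finite {m. M m j + N m j \<noteq> 0}"
    by (rule finite_subset[of _ "{m. M m j \<noteq> 0} \<union> {m. N m j \<noteq> 0}"]) (use h in auto)
qed

lift_definition uminus_rcmat :: "('a, 'b) rcmat \<Rightarrow> ('a, 'b) rcmat" is "\<lambda>M m k. - M m k" by simp

definition "a - b = a + (- b :: ('a, 'b) rcmat)"

text \<open>Summing over the support of row \<open>m\<close> of the left factor keeps the sum finite
  for every right factor.\<close>

lift_definition times_rcmat :: "('a, 'b) rcmat \<Rightarrow> ('a, 'b) rcmat \<Rightarrow> ('a, 'b) rcmat"
  is "\<lambda>M N m k. \<Sum>j | M m j \<noteq> 0. M m j * N j k"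
proof (intro conjI allI)
  fix M N :: "'a \<Rightarrow> 'a \<Rightarrow> 'b" and l
  assume h: "(\<forall>m. finite {k. M m k \<noteq> 0}) \<and> (\<forall>k. finite {m. M m k \<noteq> 0})"
    "(\<forall>m. finite {k. N m k \<noteq> 0}) \<and> (\<forall>k. finite {m. N m k \<noteq> 0})"
  have nz: "\<exists>j. M m j \<noteq> 0 \<and> N j k \<noteq> 0" if "(\<Sum>j | M m j \<noteq> 0. M m j * N j k) \<noteq> 0" for m k
    using that by (metis (mono_tags, lifting) mem_Collect_eq mult_zero_right sum.neutral)
  show "finite {k. (\<Sum>j | M l j \<noteq> 0. M l j * N j k) \<noteq> 0}"
    by (rule finite_subset[of _ "\<Union>j \<in> {j. M l j \<noteq> 0}. {k. N j k \<noteq> 0}"]) (use h nz in auto)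
  show "finite {m. (\<Sum>j | M m j \<noteq> 0. M m j * N j l) \<noteq> 0}"
    by (rule finite_subset[of _ "\<Union>j \<in> {j. N j l \<noteq> 0}. {m. M m j \<noteq> 0}"]) (use h in \<open>auto dest!: nz\<close>)
qed

lemma ent_times_sum:
  fixes a b :: "('a, 'b) rcmat"
  assumes "finite S" "{j. ent a m j \<noteq> 0} \<subseteq> S"
  shows "ent (a * b) m k = (\<Sum>j\<in>S. ent a m j * ent b j k)"
  unfolding times_rcmat.rep_eq using assms by (intro sum.mono_neutral_left) auto

instance
proof
  fix a b c :: "('a, 'b) rcmat"
  show "a * b * c = a * (b * c)"
  proof (rule rcmat_eqI)
    fix m k
    define S where "S = {j. ent a m j \<noteq> 0}"
    define T where "T = (\<Union>j\<in>S. {l. ent b j l \<noteq> 0})"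
    have fin: "finite S" "finite T"
      unfolding S_def T_def by (auto simp: finite_row)
    have sub: "{l. ent (a * b) m l \<noteq> 0} \<subseteq> T"
    proof
      fix l assume "l \<in> {l. ent (a * b) m l \<noteq> 0}"
      then have "(\<Sum>j\<in>S. ent a m j * ent b j l) \<noteq> 0"
        using ent_times_sum[of S a m b l] fin S_def by auto
      then obtain j where "j \<in> S" "ent a m j * ent b j l \<noteq> 0"
        by (meson sum.not_neutral_contains_not_neutral)
      then show "l \<in> T" unfolding T_def by (metis (mono_tags) UN_iff mem_Collect_eq mult_zero_right)
    qed
    have "ent (a * b * c) m k = (\<Sum>l\<in>T. ent (a * b) m l * ent c l k)"
      by (rule ent_times_sum[OF fin(2) sub])
    also have "\<dots> = (\<Sum>l\<in>T. \<Sum>j\<in>S. ent a m j * ent b j l * ent c l k)"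
      by (simp add: ent_times_sum[of S a m] fin S_def sum_distrib_right)
    also have "\<dots> = (\<Sum>j\<in>S. ent a m j * (\<Sum>l\<in>T. ent b j l * ent c l k))"
      by (subst sum.swap) (simp add: sum_distrib_left mult.assoc)
    also have "\<dots> = (\<Sum>j\<in>S. ent a m j * ent (b * c) j k)"
      by (intro sum.cong refl arg_cong2[of _ _ _ _ "(*)"] ent_times_sum[symmetric])
        (use fin T_def in auto)
    also have "\<dots> = ent (a * (b * c)) m k"
      by (rule ent_times_sum[symmetric]) (use fin S_def in auto)
    finally show "ent (a * b * c) m k = ent (a * (b * c)) m k" .
  qed
  show "1 * a = a"
    by (rule rcmat_eqI) (subst ent_times_sum[of "{m}" for m], auto simp: one_rcmat.rep_eq)
  show "a * 1 = a"
    by (rule rcmat_eqI)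
      (simp add: times_rcmat.rep_eq one_rcmat.rep_eq if_distrib sum.delta finite_row cong: if_cong)
  show "a * (b + c) = a * b + a * c"
    by (rule rcmat_eqI)
      (simp add: times_rcmat.rep_eq plus_rcmat.rep_eq distrib_left sum.distrib)
  show "(a + b) * c = a * c + b * c"
  proof (rule rcmat_eqI)
    fix m k
    define S where "S = {j. ent a m j \<noteq> 0} \<union> {j. ent b m j \<noteq> 0}"
    have "finite S" unfolding S_def by (simp add: finite_row)
    moreover have "{j. ent (a + b) m j \<noteq> 0} \<subseteq> S" "{j. ent a m j \<noteq> 0} \<subseteq> S" "{j. ent b m j \<noteq> 0} \<subseteq> S"
      unfolding S_def by (auto simp: plus_rcmat.rep_eq)
    ultimately show "ent ((a + b) * c) m k = ent (a * c + b * c) m k"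
      by (simp add: plus_rcmat.rep_eq ent_times_sum[of S] distrib_right sum.distrib)
  qed
  show "a + b + c = a + (b + c)" by transfer (simp add: add.assoc)
  show "a + b = b + a" by transfer (simp add: add.commute)
  show "0 + a = a" by transfer simp
  show "- a + a = 0" by transfer simp
  show "a - b = a + - b" by (fact minus_rcmat_def)
  show "(0 :: ('a, 'b) rcmat) \<noteq> 1"
    by transfer (metis zero_neq_one)
qed

end

lift_definition scale :: "'a::comm_ring_1 \<Rightarrow> ('i, 'a) rcmat \<Rightarrow> ('i, 'a) rcmat"
  is "\<lambda>c M m k. c * M m k"
proof (intro conjI allI)
  fix c and M :: "'i \<Rightarrow> 'i \<Rightarrow> 'a" and j
  assume h: "(\<forall>m. finite {k. M m k \<noteq> 0}) \<and> (\<forall>k. finite {m. M m k \<noteq> 0})"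
  show "finite {k. c * M j k \<noteq> 0}"
    by (rule finite_subset[of _ "{k. M j k \<noteq> 0}"]) (use h in auto)
  show "finite {m. c * M m j \<noteq> 0}"
    by (rule finite_subset[of _ "{m. M m j \<noteq> 0}"]) (use h in auto)
qed

text \<open>An anti-automorphism (\<open>transp_times\<close>) exchanging \<open>mx i\<close> and
  \<open>my i\<close>: column statements follow from row statements, and statements on y from those
  on x.\<close>

lift_definition transp_rc :: "('i, 'a::zero) rcmat \<Rightarrow> ('i, 'a) rcmat" is "\<lambda>M m k. M k m"
  by simp

lemma ent_simps [simp]:
  "ent 0 m k = 0" "ent 1 m k = (if m = k then 1 else 0)" "ent (a + b) m k = ent a m k + ent b m k"
  "ent (- a) m k = - ent a m k" "ent (a - b) m k = ent a m k - ent b m k"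
  "ent (scale c a) m k = c * ent a m k" "ent (transp_rc a) m k = ent a k m"
  by (simp_all only: zero_rcmat.rep_eq one_rcmat.rep_eq plus_rcmat.rep_eq uminus_rcmat.rep_eq
      minus_rcmat_def scale.rep_eq transp_rc.rep_eq diff_conv_add_uminus)

lemma ent_times_sum_col:
  fixes a b :: "('i, 'a::comm_ring_1) rcmat"
  assumes "finite S" "{j. ent b j k \<noteq> 0} \<subseteq> S"
  shows "ent (a * b) m k = (\<Sum>j\<in>S. ent a m j * ent b j k)"
proof -
  have "ent (a * b) m k = (\<Sum>j\<in>S \<union> {j. ent a m j \<noteq> 0}. ent a m j * ent b j k)"
    by (rule ent_times_sum) (use assms in auto)
  also have "\<dots> = (\<Sum>j\<in>S. ent a m j * ent b j k)"
  proof (rule sum.mono_neutral_right)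
    show "\<forall>j\<in>S \<union> {j. ent a m j \<noteq> 0} - S. ent a m j * ent b j k = 0"
      using assms(2) by (auto simp: subset_iff) (metis mult_zero_right)
  qed (use assms in auto)
  finally show ?thesis .
qed

text \<open>In \<open>intertwiner\<close> the rows of \<open>phi\<close> and \<open>psi\<close> are
  known only as rows of other matrices; this lemma and its column version carry products across such
  identifications.\<close>

lemma ent_times_cong_row:
  assumes "\<And>j. ent a m j = ent a' m' j"
  shows "ent (a * b) m k = ent (a' * b) m' k"
  by (simp add: times_rcmat.rep_eq assms)

lemma ent_times_single:
  assumes "\<And>j. ent a m j = (if j = j0 then c else 0)"
  shows "ent (a * b) m k = c * ent b j0 k"
  by (subst ent_times_sum[of "{j0}"]) (auto simp: assms)

lemma transp_times: "transp_rc (a * b) = transp_rc b * transp_rc a"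
  for a b :: "('i, 'a::comm_ring_1) rcmat"
proof (rule rcmat_eqI)
  fix m k
  have "ent (transp_rc (a * b)) m k = (\<Sum>j | ent b j m \<noteq> 0. ent a k j * ent b j m)"
    using ent_times_sum_col[of "{j. ent b j m \<noteq> 0}" b m a k] by simp
  also have "\<dots> = ent (transp_rc b * transp_rc a) m k"
    by (simp add: times_rcmat.rep_eq mult.commute)
  finally show "ent (transp_rc (a * b)) m k = ent (transp_rc b * transp_rc a) m k" .
qed

lemma transp_simps [simp]:
  fixes a b :: "('i, 'a::comm_ring_1) rcmat"
  shows "transp_rc (transp_rc a) = a" "transp_rc 1 = (1 :: ('i, 'a) rcmat)"
    "transp_rc 0 = (0 :: ('i, 'a) rcmat)" "transp_rc (a + b) = transp_rc a + transp_rc b"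
    "transp_rc (a - b) = transp_rc a - transp_rc b" "transp_rc (scale c a) = scale c (transp_rc a)"
  by (auto intro!: rcmat_eqI)

lemma ent_times_cong_col:
  fixes a b b' :: "('i, 'a::comm_ring_1) rcmat"
  assumes "\<And>j. ent b j k = ent b' j k'"
  shows "ent (a * b) m k = ent (a * b') m k'"
  using ent_times_cong_row[of "transp_rc b" k "transp_rc b'" k' "transp_rc a" m] assms
  by (simp flip: transp_times)

lemma ent_times_single_col:
  fixes a b :: "('i, 'a::comm_ring_1) rcmat"
  assumes "\<And>j. ent b j k = (if j = j0 then c else 0)"
  shows "ent (a * b) m k = ent a m j0 * c"
  using ent_times_single[of "transp_rc b" k j0 c "transp_rc a" m] assms
  by (simp add: mult.commute flip: transp_times)

global_interpretation rc: vector_space "scale :: 'a::field \<Rightarrow> ('i, 'a) rcmat \<Rightarrow> _"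
  by unfold_locales (auto intro!: rcmat_eqI simp: algebra_simps)

lemma scale_times [simp]:
  fixes a b :: "('i, 'a::comm_ring_1) rcmat"
  shows "scale c a * b = scale c (a * b)" "a * scale c b = scale c (a * b)"
proof -
  have *: "a * scale c b = scale c (a * b)" for a b :: "('i, 'a::comm_ring_1) rcmat"
    by (rule rcmat_eqI) (simp add: times_rcmat.rep_eq sum_distrib_left mult.left_commute)
  show "a * scale c b = scale c (a * b)" by (fact *)
  have "transp_rc (scale c a * b) = transp_rc (scale c (a * b))"
    by (simp add: transp_times *)
  then show "scale c a * b = scale c (a * b)" by (metis transp_simps(1))
qed

text \<open>An enumeration of \<open>S\<close> transports the blocks to matrices over a field, where
  one-sided inverses are two-sided. In \<open>phi_upper\<close> it is applied to the blocks of
  \<open>psi\<close> and \<open>phi\<close> over a box.\<close>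

lemma square_left_inverse_imp_right_inverse:
  fixes A B :: "'i \<Rightarrow> 'i \<Rightarrow> 'a::field"
  assumes fin: "finite S"
    and AB: "\<And>m k. m \<in> S \<Longrightarrow> k \<in> S \<Longrightarrow> (\<Sum>j\<in>S. A m j * B j k) = (if m = k then 1 else 0)"
    and mk: "m \<in> S" "k \<in> S"
  shows "(\<Sum>j\<in>S. B m j * A j k) = (if m = k then 1 else 0)"
proof -
  obtain h where h: "bij_betw h {0..<card S} S"
    using ex_bij_betw_nat_finite[OF fin] by auto
  let ?n = "card S"
  define A' where "A' = mat ?n ?n (\<lambda>(i, j). A (h i) (h j))"
  define B' where "B' = mat ?n ?n (\<lambda>(i, j). B (h i) (h j))"
  have car: "A' \<in> carrier_mat ?n ?n" "B' \<in> carrier_mat ?n ?n"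
    unfolding A'_def B'_def by auto
  have inj: "h i = h j \<longleftrightarrow> i = j" if "i < ?n" "j < ?n" for i j
    using h that by (auto simp: bij_betw_def inj_on_def)
  have hS: "h i \<in> S" if "i < ?n" for i
    using h that by (auto simp: bij_betw_def)
  have prod: "(mat ?n ?n (\<lambda>(i, j). P (h i) (h j)) * mat ?n ?n (\<lambda>(i, j). Q (h i) (h j))) $$ (i, j)
      = (\<Sum>l\<in>S. P (h i) l * Q l (h j))" if "i < ?n" "j < ?n" for P Q :: "'i \<Rightarrow> 'i \<Rightarrow> 'a" and i j
  proof -
    have "(mat ?n ?n (\<lambda>(i, j). P (h i) (h j)) * mat ?n ?n (\<lambda>(i, j). Q (h i) (h j))) $$ (i, j)
        = (\<Sum>l\<in>{0..<?n}. P (h i) (h l) * Q (h l) (h j))"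
      using that by (simp add: scalar_prod_def)
    also have "\<dots> = (\<Sum>l\<in>S. P (h i) l * Q l (h j))"
      by (rule sum.reindex_bij_betw[OF h])
    finally show ?thesis .
  qed
  have "A' * B' = 1\<^sub>m ?n"
  proof (rule eq_matI)
    fix i j assume "i < dim_row (1\<^sub>m ?n :: 'a mat)" "j < dim_col (1\<^sub>m ?n :: 'a mat)"
    then have ij: "i < ?n" "j < ?n" by auto
    have "(A' * B') $$ (i, j) = (\<Sum>l\<in>S. A (h i) l * B l (h j))"
      unfolding A'_def B'_def by (rule prod[OF ij])
    also have "\<dots> = (if h i = h j then 1 else 0)"
      by (rule AB[OF hS[OF ij(1)] hS[OF ij(2)]])
    also have "\<dots> = 1\<^sub>m ?n $$ (i, j)"
      using inj[OF ij] ij by simp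
    finally show "(A' * B') $$ (i, j) = 1\<^sub>m ?n $$ (i, j)" .
  qed (simp_all add: A'_def B'_def)
  then have BA: "B' * A' = 1\<^sub>m ?n"
    by (rule mat_mult_left_right_inverse[OF car])
  have "m \<in> h ` {0..<?n}" "k \<in> h ` {0..<?n}"
    using mk bij_betw_imp_surj_on[OF h] by simp_all
  then obtain i j where ij: "i < ?n" "j < ?n" "m = h i" "k = h j"
    by fastforce
  have "(\<Sum>l\<in>S. B m l * A l k) = (B' * A') $$ (i, j)"
    unfolding A'_def B'_def ij(3,4) by (rule prod[OF ij(1,2), symmetric])
  also have "\<dots> = (if m = k then 1 else 0)"
    using inj[OF ij(1,2)] ij(1,2) unfolding BA ij(3,4) by simp
  finally show ?thesis .
qed

section \<open>Shifts, matrix units and the subalgebras they generate\<close>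

type_synonym 'a nmat = "(nat \<Rightarrow> nat, 'a) rcmat"

lift_definition mx :: "nat \<Rightarrow> 'a::comm_ring_1 nmat"
  is "\<lambda>i m k. if m = k(i := k i + 1) then 1 else 0"
proof (intro conjI allI)
  fix i and j :: "nat \<Rightarrow> nat"
  show "finite {k. (if j = k(i := k i + 1) then 1 else 0 :: 'a) \<noteq> 0}"
    by (rule finite_subset[of _ "{j(i := j i - 1)}"]) auto
  show "finite {m. (if m = j(i := j i + 1) then 1 else 0 :: 'a) \<noteq> 0}"
    by (rule finite_subset[of _ "{j(i := j i + 1)}"]) auto
qed

definition my :: "nat \<Rightarrow> 'a::comm_ring_1 nmat" where
  "my i = transp_rc (mx i)"

text \<open>The matrix of \<^const>\<open>eprod\<close>; an infinite index set is admitted since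
  \<^term>\<open>me (- I)\<close> serves to express independence of the coordinates outside \<^term>\<open>I\<close>.\<close>

lift_definition me :: "nat set \<Rightarrow> (nat \<Rightarrow> nat) \<Rightarrow> (nat \<Rightarrow> nat) \<Rightarrow> 'a::comm_ring_1 nmat"
  is "\<lambda>I \<alpha> \<beta> m k. if (\<forall>i\<in>I. m i = \<alpha> i \<and> k i = \<beta> i) \<and> (\<forall>i. i \<notin> I \<longrightarrow> m i = k i) then 1 else 0"
proof (intro conjI allI)
  fix I and \<alpha> \<beta> j :: "nat \<Rightarrow> nat"
  show "finite {k. (if (\<forall>i\<in>I. j i = \<alpha> i \<and> k i = \<beta> i) \<and> (\<forall>i. i \<notin> I \<longrightarrow> j i = k i)
      then 1 else 0 :: 'a) \<noteq> 0}"
    by (rule finite_subset[of _ "{override_on j \<beta> I}"]) (auto simp: override_on_def fun_eq_iff, metis)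
  show "finite {m. (if (\<forall>i\<in>I. m i = \<alpha> i \<and> j i = \<beta> i) \<and> (\<forall>i. i \<notin> I \<longrightarrow> m i = j i)
      then 1 else 0 :: 'a) \<noteq> 0}"
    by (rule finite_subset[of _ "{override_on j \<alpha> I}"]) (auto simp: override_on_def fun_eq_iff)
qed

lemma transp_gen [simp]:
  "transp_rc (mx i) = my i" "transp_rc (my i) = mx i" "transp_rc (me I \<alpha> \<beta>) = me I \<beta> \<alpha>"
proof -
  show "transp_rc (me I \<alpha> \<beta>) = me I \<beta> \<alpha>"
  proof (rule rcmat_eqI)
    fix m k
    have "(\<forall>i\<in>I. k i = \<alpha> i \<and> m i = \<beta> i) \<and> (\<forall>i. i \<notin> I \<longrightarrow> k i = m i) \<longleftrightarrow>
        (\<forall>i\<in>I. m i = \<beta> i \<and> k i = \<alpha> i) \<and> (\<forall>i. i \<notin> I \<longrightarrow> m i = k i)" by metis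
    then show "ent (transp_rc (me I \<alpha> \<beta>)) m k = ent (me I \<beta> \<alpha>) m k"
      by (simp only: ent_simps me.rep_eq)
  qed
qed (simp_all only: my_def transp_simps)

text \<open>This form displays the only column in which row \<open>m\<close> can be nonzero, as
  \<open>ent_times_single\<close> requires.\<close>

lemma ent_me:
  "ent (me I \<alpha> \<beta>) m k = (if (\<forall>i\<in>I. m i = \<alpha> i) \<and> k = override_on m \<beta> I then 1 else 0)"
proof -
  have "(\<forall>i\<in>I. m i = \<alpha> i \<and> k i = \<beta> i) \<and> (\<forall>i. i \<notin> I \<longrightarrow> m i = k i) \<longleftrightarrow>
      (\<forall>i\<in>I. m i = \<alpha> i) \<and> k = override_on m \<beta> I"
    unfolding fun_eq_iff by (metis override_on_apply_in override_on_apply_notin)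
  then show ?thesis by (simp only: me.rep_eq)
qed

lemma ent_mx: "ent (mx i) m k = (if m = k(i := k i + 1) then 1 else 0)"
  by (simp add: mx.rep_eq)

lemma ent_my: "ent (my i) m k = (if k = m(i := m i + 1) then 1 else 0)"
  by (simp only: my_def ent_simps ent_mx)

lemma ent_times_mx: "ent (a * mx i) m k = ent a m (k(i := k i + 1))"
  by (subst ent_times_single_col[where c = 1 and ?j0.0 = "k(i := k i + 1)"]) (auto simp: ent_mx)

lemma ent_my_times: "ent (my i * a) m k = ent a (m(i := m i + 1)) k"
  by (subst ent_times_single[where c = 1 and ?j0.0 = "m(i := m i + 1)"]) (auto simp: ent_my)

lemma ent_mx_times: "ent (mx i * a) m k = (if m i = 0 then 0 else ent a (m(i := m i - 1)) k)"
proof -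
  have "ent (mx i) m j = (if j = m(i := m i - 1) then (if m i = 0 then 0 else 1) else 0)" for j
    by (auto simp: ent_mx)
  from ent_times_single[OF this, of a k] show ?thesis by simp
qed

lemma ent_times_my: "ent (a * my i) m k = (if k i = 0 then 0 else ent a m (k(i := k i - 1)))"
proof -
  have "ent (my i) j k = (if j = k(i := k i - 1) then (if k i = 0 then 0 else 1) else 0)" for j
    by (auto simp: ent_my)
  from ent_times_single_col[OF this, of a m] show ?thesis by simp
qed

lemma ent_me_times:
  "ent (me I \<alpha> \<beta> * a) m k = (if \<forall>i\<in>I. m i = \<alpha> i then ent a (override_on m \<beta> I) k else 0)"
proof -
  have "ent (me I \<alpha> \<beta>) m j = (if j = override_on m \<beta> I then (if \<forall>i\<in>I. m i = \<alpha> i then 1 else 0) else 0)"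
    for j by (auto simp: ent_me)
  from ent_times_single[OF this, of a k] show ?thesis by simp
qed

lemma ent_times_me:
  "ent (a * me I \<alpha> \<beta>) m k = (if \<forall>i\<in>I. k i = \<beta> i then ent a m (override_on k \<alpha> I) else 0)"
proof -
  have "ent (a * me I \<alpha> \<beta>) m k = ent (transp_rc (transp_rc (a * me I \<alpha> \<beta>))) m k" by simp
  also have "\<dots> = ent (me I \<beta> \<alpha> * transp_rc a) k m"
    by (subst transp_times) (simp only: transp_gen ent_simps)
  finally show ?thesis by (simp add: ent_me_times)
qed

lemma my_mx [simp]: "my i * mx i = 1"
  by (rule rcmat_eqI) (auto simp: ent_my_times ent_mx fun_eq_iff)

lemma me_cong: "(\<And>i. i \<in> I \<Longrightarrow> \<alpha> i = \<alpha>' i) \<Longrightarrow> (\<And>i. i \<in> I \<Longrightarrow> \<beta> i = \<beta>' i) \<Longrightarrow> me I \<alpha> \<beta> = me I \<alpha>' \<beta>'"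
proof (rule rcmat_eqI)
  fix m k
  assume h: "\<And>i. i \<in> I \<Longrightarrow> \<alpha> i = \<alpha>' i" "\<And>i. i \<in> I \<Longrightarrow> \<beta> i = \<beta>' i"
  then have "override_on m \<beta> I = override_on m \<beta>' I" by (auto simp: override_on_def)
  with h(1) show "ent (me I \<alpha> \<beta>) m k = ent (me I \<alpha>' \<beta>') m k" by (simp add: ent_me)
qed

lemma me_empty [simp]: "me {} \<alpha> \<beta> = 1"
  by (rule rcmat_eqI) (auto simp: ent_me)

text \<open>\<open>me I\<close> is a matrix unit in the coordinates of \<open>I\<close> tensored
  with the identity elsewhere. On \<open>I \<inter> J\<close> the inner indices have to match; on
  the rest of the union each factor contributes its own indices.\<close>

lemma me_times_me:
  "me I \<alpha> \<beta> * me J \<gamma> \<delta> = (if \<forall>i\<in>I \<inter> J. \<beta> i = \<gamma> i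
     then me (I \<union> J) (override_on \<gamma> \<alpha> I) (override_on \<beta> \<delta> J) else 0)"
proof (rule rcmat_eqI)
  fix m k
  show "ent (me I \<alpha> \<beta> * me J \<gamma> \<delta>) m k = ent (if \<forall>i\<in>I \<inter> J. \<beta> i = \<gamma> i
     then me (I \<union> J) (override_on \<gamma> \<alpha> I) (override_on \<beta> \<delta> J) else 0) m k"
  proof (cases "\<forall>i\<in>I \<inter> J. \<beta> i = \<gamma> i")
    case True
    have "override_on (override_on m \<beta> I) \<delta> J = override_on m (override_on \<beta> \<delta> J) (I \<union> J)"
      by (auto simp: override_on_def)
    moreover have c: "(\<forall>i\<in>I. m i = \<alpha> i) \<and> (\<forall>j\<in>J. override_on m \<beta> I j = \<gamma> j) \<longleftrightarrow>
        (\<forall>i\<in>I \<union> J. m i = override_on \<gamma> \<alpha> I i)"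
      using True unfolding override_on_def by (metis (full_types) IntI UnCI UnE)
    ultimately show ?thesis
      unfolding if_P[OF True] ent_me_times ent_me c[symmetric] by simp
  next
    case False
    then obtain i where "i \<in> I" "i \<in> J" "\<beta> i \<noteq> \<gamma> i" by auto
    then have "\<not> (\<forall>j\<in>J. override_on m \<beta> I j = \<gamma> j)" by (metis override_on_apply_in)
    with False show ?thesis unfolding ent_me_times ent_me by auto
  qed
qed

lemma me_mult: "me I \<alpha> \<beta> * me I \<beta> \<delta> = me I \<alpha> \<delta>"
  by (auto simp: me_times_me override_on_def intro!: me_cong)

lemma mx_times_me: "i \<in> I \<Longrightarrow> mx i * me I \<alpha> \<beta> = me I (\<alpha>(i := \<alpha> i + 1)) \<beta>"
proof (rule rcmat_eqI)
  fix m k assume i: "i \<in> I"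
  have ov: "override_on (m(i := m i - 1)) \<beta> I = override_on m \<beta> I"
    using i by (auto simp: override_on_def)
  have c: "m i \<noteq> 0 \<and> (\<forall>j\<in>I. (m(i := m i - 1)) j = \<alpha> j) \<longleftrightarrow> (\<forall>j\<in>I. m j = (\<alpha>(i := \<alpha> i + 1)) j)"
    using i by (cases "m i") auto
  show "ent (mx i * me I \<alpha> \<beta>) m k = ent (me I (\<alpha>(i := \<alpha> i + 1)) \<beta>) m k"
    unfolding ent_mx_times ent_me ov c[symmetric] by simp
qed

lemma my_times_me:
  "i \<in> I \<Longrightarrow> my i * me I \<alpha> \<beta> = (if \<alpha> i = 0 then 0 else me I (\<alpha>(i := \<alpha> i - 1)) \<beta>)"
proof (rule rcmat_eqI)
  fix m k assume i: "i \<in> I"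
  have ov: "override_on (m(i := m i + 1)) \<beta> I = override_on m \<beta> I"
    using i by (auto simp: override_on_def)
  have c: "(\<forall>j\<in>I. (m(i := m i + 1)) j = \<alpha> j) \<longleftrightarrow> \<alpha> i \<noteq> 0 \<and> (\<forall>j\<in>I. m j = (\<alpha>(i := \<alpha> i - 1)) j)"
    using i by (cases "\<alpha> i") auto
  show "ent (my i * me I \<alpha> \<beta>) m k = ent (if \<alpha> i = 0 then 0 else me I (\<alpha>(i := \<alpha> i - 1)) \<beta>) m k"
    unfolding ent_my_times ent_me ov c by (cases "\<alpha> i = 0") (simp_all add: ent_me)
qed

lemma me_times_mx:
  "i \<in> I \<Longrightarrow> me I \<alpha> \<beta> * mx i = (if \<beta> i = 0 then 0 else me I \<alpha> (\<beta>(i := \<beta> i - 1)))"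
  using arg_cong[OF my_times_me[of i I \<beta> \<alpha>], of transp_rc] by (simp add: transp_times split: if_splits)

lemma me_mx_commute: "i \<notin> I \<Longrightarrow> me I \<alpha> \<beta> * mx i = mx i * me I \<alpha> \<beta>"
proof (rule rcmat_eqI)
  fix m k assume i: "i \<notin> I"
  have c: "(k(i := k i + 1) = override_on m \<beta> I) \<longleftrightarrow> m i \<noteq> 0 \<and> k = override_on (m(i := m i - 1)) \<beta> I"
  proof
    assume h: "k(i := k i + 1) = override_on m \<beta> I"
    have "m i = k i + 1" using fun_cong[OF h, of i] i by simp
    moreover have "k j = override_on (m(i := m i - 1)) \<beta> I j" for j
      using fun_cong[OF h, of j] i \<open>m i = k i + 1\<close> by (auto simp: override_on_def split: if_splits)
    ultimately show "m i \<noteq> 0 \<and> k = override_on (m(i := m i - 1)) \<beta> I" by auto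
  qed (use i in \<open>auto simp: override_on_def\<close>)
  have c': "(\<forall>j\<in>I. (m(i := m i - 1)) j = \<alpha> j) \<longleftrightarrow> (\<forall>j\<in>I. m j = \<alpha> j)"
    using i by (metis fun_upd_other)
  show "ent (me I \<alpha> \<beta> * mx i) m k = ent (mx i * me I \<alpha> \<beta>) m k"
    unfolding ent_times_mx ent_mx_times ent_me c c' by simp
qed

lemma me_my_commute: "i \<notin> I \<Longrightarrow> me I \<alpha> \<beta> * my i = my i * me I \<alpha> \<beta>"
  using arg_cong[OF me_mx_commute[of i I \<beta> \<alpha>], of transp_rc] by (simp add: transp_times eq_commute)

section \<open>Subalgebras generated by the shifts of an index set\<close>

inductive_set SA :: "nat set \<Rightarrow> 'a::comm_ring_1 nmat set" for I where
  SA_one: "1 \<in> SA I"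
| SA_mx: "i \<in> I \<Longrightarrow> mx i \<in> SA I"
| SA_my: "i \<in> I \<Longrightarrow> my i \<in> SA I"
| SA_add: "a \<in> SA I \<Longrightarrow> b \<in> SA I \<Longrightarrow> a + b \<in> SA I"
| SA_scale: "a \<in> SA I \<Longrightarrow> scale c a \<in> SA I"
| SA_mult: "a \<in> SA I \<Longrightarrow> b \<in> SA I \<Longrightarrow> a * b \<in> SA I"

lemma scale_simps [simp]:
  "scale 0 a = (0 :: ('i, 'a::comm_ring_1) rcmat)" "scale (- 1) a = - a" "scale 1 a = a"
  by (auto intro!: rcmat_eqI)

lemma SA_zero: "0 \<in> SA I"
  using SA_scale[OF SA_one, of 0] by simp

lemma SA_diff: "a \<in> SA I \<Longrightarrow> b \<in> SA I \<Longrightarrow> a - b \<in> SA I"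
  using SA_add[OF _ SA_scale[of b _ "- 1"], of a] by simp

lemma SA_power: "a \<in> SA I \<Longrightarrow> a ^ k \<in> SA I"
  by (induction k) (auto intro: SA_one SA_mult)

lemma SA_mono: "I \<subseteq> J \<Longrightarrow> SA I \<subseteq> SA J"
proof
  fix a :: "'a nmat" assume "I \<subseteq> J" "a \<in> SA I"
  from this(2,1) show "a \<in> SA J"
    by (induction) (auto intro: SA.intros)
qed

lemmas SA_UNIV = subsetD[OF SA_mono[OF subset_UNIV]]

lemma subspace_SA: "rc.subspace (SA I :: 'a::field nmat set)"
  by (rule rc.subspaceI) (auto intro: SA_zero SA_add SA_scale)

lemma transp_SA: "a \<in> SA I \<Longrightarrow> transp_rc a \<in> SA I"
  by (induction rule: SA.induct) (auto simp: transp_times intro: SA.intros)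

lemma ent_my_power_times: "ent (my i ^ r * a) m k = ent a (m(i := m i + r)) k"
proof (induction r arbitrary: m)
  case (Suc r)
  have "(m(i := m i + 1))(i := (m(i := m i + 1)) i + r) = m(i := m i + Suc r)"
    by (auto simp: fun_eq_iff)
  then show ?case
    by (simp only: power_Suc mult.assoc ent_my_times Suc)
qed simp

lemma ent_mx_power_my_power:
  "ent (mx i ^ r * my i ^ s) m k = (if \<exists>t. m i = t + r \<and> k = m(i := t + s) then 1 else 0 :: 'a::comm_ring_1)"
proof (induction r arbitrary: m)
  case 0
  have "(\<exists>t. m i = t + 0 \<and> k = m(i := t + s)) \<longleftrightarrow> m(i := m i + s) = k" by auto
  then show ?case using ent_my_power_times[of i s 1 m k] by (simp only: power_0 mult_1 mult_1_right ent_simps)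
next
  case (Suc r)
  have "ent (mx i ^ Suc r * my i ^ s) m k = (if m i = 0 then 0 else ent (mx i ^ r * my i ^ s) (m(i := m i - 1)) k :: 'a)"
    by (simp only: power_Suc mult.assoc ent_mx_times)
  also have "\<dots> = (if \<exists>t. m i = t + Suc r \<and> k = m(i := t + s) then 1 else 0)"
    unfolding Suc by (cases "m i") auto
  finally show ?case .
qed

text \<open>x^k y^l has the ones at all positions (k + t, l + t), t \<ge> 0; subtracting the
  monomial with both exponents raised by one leaves t = 0. This identifies \<open>me {i}\<close>
  with E_kl(i).\<close>

lemma me_singleton:
  "me {i} \<alpha> \<beta> = mx i ^ \<alpha> i * my i ^ \<beta> i - mx i ^ (\<alpha> i + 1) * my i ^ (\<beta> i + 1)"
proof (rule rcmat_eqI)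
  fix m k
  have "m i = \<alpha> i \<and> k = m(i := \<beta> i) \<longleftrightarrow>
     (\<exists>t. m i = t + \<alpha> i \<and> k = m(i := t + \<beta> i)) \<and> \<not> (\<exists>t. m i = t + (\<alpha> i + 1) \<and> k = m(i := t + (\<beta> i + 1)))"
    (is "?l \<longleftrightarrow> ?r")
  proof
    assume ?l
    then show ?r by (auto dest: fun_upd_eqD)
  next
    assume ?r
    then obtain t where t: "m i = t + \<alpha> i" "k = m(i := t + \<beta> i)" by auto
    with \<open>?r\<close> have "\<not> (\<exists>t'. t = t' + 1)" by auto
    then have "t = 0" by (metis Suc_eq_plus1 not0_implies_Suc)
    with t show ?l by auto
  qed
  moreover have "\<exists>t. m i = t + \<alpha> i \<and> k = m(i := t + \<beta> i)"
    if "\<exists>t. m i = t + (\<alpha> i + 1) \<and> k = m(i := t + (\<beta> i + 1))"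
    using that by (metis add.commute add.left_commute)
  moreover have "override_on m \<beta> {i} = m(i := \<beta> i)" by (auto simp: override_on_def)
  ultimately show "ent (me {i} \<alpha> \<beta>) m k =
      ent (mx i ^ \<alpha> i * my i ^ \<beta> i - mx i ^ (\<alpha> i + 1) * my i ^ (\<beta> i + 1)) m k"
    unfolding ent_simps ent_mx_power_my_power ent_me by auto
qed

lemma me_insert:
  assumes "i \<notin> I"
  shows "me (insert i I) \<alpha> \<beta> = me {i} \<alpha> \<beta> * me I \<alpha> \<beta>"
  using assms by (auto simp: me_times_me override_on_def intro!: me_cong)

lemma me_in_SA:
  assumes "finite I" "I \<subseteq> J"
  shows "me I \<alpha> \<beta> \<in> SA J"
  using assms
proof (induction I rule: finite_induct)
  case (insert i I)
  then show ?case
    by (auto simp: me_insert me_singleton intro!: SA_mult SA_diff SA_power SA_mx SA_my)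
qed (auto intro: SA_one)

text \<open>The matrices that act on the coordinates in \<open>I\<close> only, encoded as a
  commutant so that closure under sums and products is immediate; \<open>loc_iff\<close> gives the
  entrywise form.\<close>

definition loc :: "nat set \<Rightarrow> 'a::comm_ring_1 nmat \<Rightarrow> bool" where
  "loc I a \<longleftrightarrow> (\<forall>\<eta> \<theta>. a * me (- I) \<eta> \<theta> = me (- I) \<eta> \<theta> * a)"

abbreviation res :: "nat set \<Rightarrow> (nat \<Rightarrow> nat) \<Rightarrow> nat \<Rightarrow> nat" where
  "res I m \<equiv> override_on (\<lambda>_. 0) m I"

lemma loc_iff:
  "loc I a \<longleftrightarrow> (\<forall>m k. ent a m k = (if \<forall>j. j \<notin> I \<longrightarrow> m j = k j then ent a (res I m) (res I k) else 0))"
  (is "_ \<longleftrightarrow> ?R")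
proof
  assume "loc I a"
  then have c: "ent (a * me (- I) \<eta> \<theta>) m k = ent (me (- I) \<eta> \<theta> * a) m k" for \<eta> \<theta> m k
    by (simp add: loc_def)
  show ?R
  proof (intro allI)
    fix m k
    show "ent a m k = (if \<forall>j. j \<notin> I \<longrightarrow> m j = k j then ent a (res I m) (res I k) else 0)"
    proof (cases "\<forall>j. j \<notin> I \<longrightarrow> m j = k j")
      case True
      \<comment> \<open>Commuting with \<open>me (- I) m (\<lambda>_. 0)\<close> moves the outer
        coordinates, common to \<open>m\<close> and \<open>k\<close>, to 0.\<close>
      have "override_on (res I k) m (- I) = k" "override_on m (\<lambda>_. 0) (- I) = res I m"
        using True by (auto simp: override_on_def)
      then show ?thesis
        using c[of m "\<lambda>_. 0" m "res I k"] True unfolding ent_times_me ent_me_times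
        by (auto simp: override_on_def)
    next
      case False
      \<comment> \<open>The idempotent \<open>me (- I) m m\<close> fixes row \<open>m\<close> from
        the left and kills column \<open>k\<close> from the right.\<close>
      have "override_on m m (- I) = m" by (auto simp: override_on_def)
      then show ?thesis
        using c[of m m m k] False unfolding ent_times_me ent_me_times
        by (auto split: if_splits)
    qed
  qed
next
  assume R: ?R
  show "loc I a"
    unfolding loc_def
  proof (intro allI rcmat_eqI)
    fix \<eta> \<theta> m k
    have "res I (override_on k \<eta> (- I)) = res I k" "res I (override_on m \<theta> (- I)) = res I m"
      by (auto simp: override_on_def)
    then show "ent (a * me (- I) \<eta> \<theta>) m k = ent (me (- I) \<eta> \<theta> * a) m k"
      unfolding ent_times_me ent_me_times
      using R[rule_format, of m "override_on k \<eta> (- I)"] R[rule_format, of "override_on m \<theta> (- I)" k]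
      by (auto simp: override_on_def)
  qed
qed

lemma loc_simps:
  "loc I 1" "loc I 0" "loc I a \<Longrightarrow> loc I b \<Longrightarrow> loc I (a + b)" "loc I a \<Longrightarrow> loc I (scale c a)"
  "loc I a \<Longrightarrow> loc I b \<Longrightarrow> loc I (a - b)"
  unfolding loc_def by (simp_all add: algebra_simps)

lemma loc_times: "loc I a \<Longrightarrow> loc I b \<Longrightarrow> loc I (a * b)"
  unfolding loc_def by (simp add: mult.assoc) (simp flip: mult.assoc)

lemma loc_me: "loc I (me I \<alpha> \<beta>)"
  unfolding loc_def by (auto simp: me_times_me override_on_def intro!: me_cong)

lemma SA_loc: "a \<in> SA I \<Longrightarrow> loc I a"
proof (induction rule: SA.induct)
  case (SA_mx i)
  then show ?case by (simp add: loc_def me_mx_commute)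
next
  case (SA_my i)
  then show ?case by (simp add: loc_def me_my_commute)
qed (auto intro: loc_simps loc_times)

text \<open>The exponents of monomials in the variables from \<open>I\<close>; a local matrix is
  determined by its block on them (\<open>loc_eqI\<close>).\<close>

definition Js :: "nat set \<Rightarrow> (nat \<Rightarrow> nat) set" where
  "Js I = {m. \<forall>j. j \<notin> I \<longrightarrow> m j = 0}"

lemma zero_in_Js [simp]: "(\<lambda>_. 0) \<in> Js I"
  by (simp add: Js_def)

lemma res_in_Js [simp]: "res I m \<in> Js I"
  by (simp add: Js_def)

lemma res_Js [simp]: "m \<in> Js I \<Longrightarrow> res I m = m"
  by (auto simp: Js_def override_on_def)

lemma Js_upd: "m \<in> Js I \<Longrightarrow> i \<in> I \<Longrightarrow> m(i := t) \<in> Js I"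
  by (auto simp: Js_def)

lemma loc_eqI:
  assumes "loc I a" "loc I b" "\<And>m k. m \<in> Js I \<Longrightarrow> k \<in> Js I \<Longrightarrow> ent a m k = ent b m k"
  shows "a = b"
proof (rule rcmat_eqI)
  fix m k
  show "ent a m k = ent b m k"
    using assms(1,2)[unfolded loc_iff, rule_format, of m k] assms(3)[of "res I m" "res I k"]
    by (auto split: if_splits)
qed

lemma loc_ent_Js:
  assumes "loc I a" "ent a m k \<noteq> 0"
  shows "m \<in> Js I \<longleftrightarrow> k \<in> Js I"
  using assms(1)[unfolded loc_iff, rule_format, of m k] assms(2)
  by (auto simp: Js_def split: if_splits)

text \<open>Makes entries algebraic: a sandwich between matrix units is a scalar multiple of a unit,
  an identity that homomorphisms preserve.\<close>

lemma me_loc_me: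
  assumes "loc I a"
  shows "me I \<alpha> \<beta> * a * me I \<gamma> \<delta> = scale (ent a (res I \<beta>) (res I \<gamma>)) (me I \<alpha> \<delta>)"
proof (rule rcmat_eqI)
  fix m k
  have r: "res I (override_on m \<beta> I) = res I \<beta>" "res I (override_on k \<gamma> I) = res I \<gamma>"
    by (auto simp: override_on_def)
  have c: "(\<forall>i\<in>I. k i = \<delta> i) \<and> (\<forall>j. j \<notin> I \<longrightarrow> override_on m \<beta> I j = override_on k \<gamma> I j) \<longleftrightarrow>
      k = override_on m \<delta> I"
    unfolding fun_eq_iff by (metis override_on_apply_in override_on_apply_notin)
  show "ent (me I \<alpha> \<beta> * a * me I \<gamma> \<delta>) m k = ent (scale (ent a (res I \<beta>) (res I \<gamma>)) (me I \<alpha> \<delta>)) m k"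
    using assms[unfolded loc_iff, rule_format, of "override_on m \<beta> I" "override_on k \<gamma> I"]
    unfolding ent_times_me ent_me_times r ent_simps ent_me c[symmetric] by (auto split: if_splits)
qed

text \<open>\<open>Fs {I}\<close> is F(I). Since \<open>me {} \<alpha> \<beta> = 1\<close>, the
  scalars are \<open>Fs {{}}\<close> and F_n is \<open>Fs (Pow {0..<n})\<close>. Families of index
  sets are needed because sets are removed one at a time.\<close>

definition Fs :: "nat set set \<Rightarrow> 'a::field nmat set" where
  "Fs \<C> = rc.span {me I \<alpha> \<beta> |I \<alpha> \<beta>. I \<in> \<C>}"

lemma subspace_Fs: "rc.subspace (Fs \<C>)"
  by (simp add: Fs_def)

lemmas Fs_zero = rc.subspace_0[OF subspace_Fs]
lemmas Fs_add = rc.subspace_add[OF subspace_Fs]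
lemmas Fs_diff = rc.subspace_diff[OF subspace_Fs]
lemmas Fs_neg = rc.subspace_neg[OF subspace_Fs]
lemmas Fs_scale = rc.subspace_scale[OF subspace_Fs]

lemma me_in_Fs: "I \<in> \<C> \<Longrightarrow> me I \<alpha> \<beta> \<in> Fs \<C>"
  unfolding Fs_def by (rule rc.span_base) auto

lemma Fs_mono: "\<C> \<subseteq> \<D> \<Longrightarrow> Fs \<C> \<subseteq> Fs \<D>"
  unfolding Fs_def by (rule rc.span_mono) auto

lemma Fs_induct [consumes 1, case_names zero unit add scale]:
  assumes "a \<in> Fs \<C>" "P 0" "\<And>I \<alpha> \<beta>. I \<in> \<C> \<Longrightarrow> P (me I \<alpha> \<beta>)"
    "\<And>a b. a \<in> Fs \<C> \<Longrightarrow> b \<in> Fs \<C> \<Longrightarrow> P a \<Longrightarrow> P b \<Longrightarrow> P (a + b)"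
    "\<And>c a. a \<in> Fs \<C> \<Longrightarrow> P a \<Longrightarrow> P (scale c a)"
  shows "P a"
proof -
  have "a \<in> rc.span {me I \<alpha> \<beta> |I \<alpha> \<beta>. I \<in> \<C>}"
    using assms(1) by (simp only: Fs_def)
  then have "a \<in> Fs \<C> \<and> P a"
  proof (induction rule: rc.span_induct_alt)
    case base
    show ?case using assms(2) Fs_zero by blast
  next
    case (step c x y)
    then obtain I \<alpha> \<beta> where x: "x = me I \<alpha> \<beta>" "I \<in> \<C>" by auto
    have "scale c x \<in> Fs \<C>" "P (scale c x)"
      unfolding x(1) using x(2) assms(3,5) me_in_Fs Fs_scale by blast+
    then show ?case using step.IH assms(4) Fs_add by blast
  qed
  then show ?thesis by simp
qed

lemma Fs_insert:
  fixes a :: "'a::field nmat"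
  assumes "a \<in> Fs (insert I \<C>)"
  obtains b c where "b \<in> Fs {I}" "c \<in> Fs \<C>" "a = b + c"
proof -
  have "({me J \<alpha> \<beta> |J \<alpha> \<beta>. J \<in> insert I \<C>} :: 'a nmat set) =
    {me J \<alpha> \<beta> |J \<alpha> \<beta>. J \<in> {I}} \<union> {me J \<alpha> \<beta> |J \<alpha> \<beta>. J \<in> \<C>}"
    by blast
  then show ?thesis
    using assms that unfolding Fs_def by (simp only: rc.span_Un mem_Collect_eq) blast
qed

lemma Fs_times:
  assumes "a \<in> Fs \<C>" "b \<in> Fs \<D>" "\<And>I J. I \<in> \<C> \<Longrightarrow> J \<in> \<D> \<Longrightarrow> I \<union> J \<in> \<E>"
  shows "a * b \<in> Fs \<E>"
  using assms(1)
proof (induction rule: Fs_induct)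
  case (unit I \<alpha> \<beta>)
  from assms(2) show ?case
  proof (induction rule: Fs_induct)
    case (unit J \<gamma> \<delta>)
    then show ?case
      using \<open>I \<in> \<C>\<close> by (auto simp: me_times_me Fs_zero intro: me_in_Fs assms(3))
  qed (auto simp: distrib_left Fs_zero intro: Fs_add Fs_scale)
qed (auto simp: distrib_right Fs_zero intro: Fs_add Fs_scale)

text \<open>\<open>Fs \<C>\<close> need not be closed under multiplication by \<open>mx i\<close>,
  but a unit \<open>me I\<close> either commutes with \<open>mx i\<close>
  (\<open>i \<notin> I\<close>) or keeps its index set in both products
  (\<open>i \<in> I\<close>).\<close>

lemma Fs_commutator_mx: "a \<in> Fs \<C> \<Longrightarrow> mx i * a - a * mx i \<in> Fs \<C>"
proof (induction rule: Fs_induct)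
  case (unit I \<alpha> \<beta>)
  then show ?case
    by (cases "i \<in> I") (auto simp: me_mx_commute mx_times_me me_times_mx Fs_zero intro!: Fs_diff me_in_Fs)
next
  case (add a b)
  have "mx i * (a + b) - (a + b) * mx i = (mx i * a - a * mx i) + (mx i * b - b * mx i)"
    by (simp add: algebra_simps)
  with add show ?case by (auto intro: Fs_add)
next
  case (scale c a)
  have "mx i * scale c a - scale c a * mx i = scale c (mx i * a - a * mx i)"
    by (simp only: scale_times rc.scale_right_diff_distrib)
  with scale show ?case by (auto intro: Fs_scale)
qed (simp add: Fs_zero)

lemma transp_Fs: "a \<in> Fs \<C> \<Longrightarrow> transp_rc a \<in> Fs \<C>"
  by (induction rule: Fs_induct) (auto intro: Fs_zero Fs_add Fs_scale me_in_Fs)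

lemma Fs_commutator_my: 
  assumes "a \<in> Fs \<C>"
  shows "my i * a - a * my i \<in> Fs \<C>"
proof -
  have "transp_rc (mx i * transp_rc a - transp_rc a * mx i) \<in> Fs \<C>"
    by (intro transp_Fs Fs_commutator_mx assms)
  then have "- (my i * a - a * my i) \<in> Fs \<C>"
    by (simp add: transp_times)
  then show ?thesis using Fs_neg by fastforce
qed

lemma Fs_subset_SA:
  assumes "\<And>I. I \<in> \<C> \<Longrightarrow> finite I \<and> I \<subseteq> J"
  shows "Fs \<C> \<subseteq> SA J"
  unfolding Fs_def using assms by (intro rc.span_minimal subspace_SA) (auto intro: me_in_SA)

lemma Fs_ideal:
  assumes "a \<in> SA I" "b \<in> Fs {I}"
  shows "a * b \<in> Fs {I}" "b * a \<in> Fs {I}"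
proof -
  have *: "a * b \<in> Fs {I}" if "a \<in> SA I" "b \<in> Fs {I}" for a b :: "'a nmat"
    using that
  proof (induction arbitrary: b rule: SA.induct)
    case (SA_mx i)
    from SA_mx(2,1) show ?case
      by (induction rule: Fs_induct)
        (auto simp: Fs_zero mx_times_me distrib_left intro: Fs_add Fs_scale me_in_Fs)
  next
    case (SA_my i)
    from SA_my(2,1) show ?case
      by (induction rule: Fs_induct)
        (auto simp: Fs_zero my_times_me distrib_left intro: Fs_add Fs_scale me_in_Fs)
  qed (auto simp: distrib_right mult.assoc intro: Fs_add Fs_scale)
  show "a * b \<in> Fs {I}" using * assms by blast
  have "transp_rc (transp_rc a * transp_rc b) \<in> Fs {I}"
    by (intro transp_Fs * transp_SA assms)
  then show "b * a \<in> Fs {I}" by (simp add: transp_times)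
qed

section \<open>Exponent boxes and F(I) as local matrices of bounded support\<close>

definition box :: "nat set \<Rightarrow> nat \<Rightarrow> (nat \<Rightarrow> nat) set" where
  "box I N = {m. \<forall>i\<in>I. m i < N}"

lemma finite_box: "finite I \<Longrightarrow> finite (Js I \<inter> box I N)"
  by (rule finite_subset[OF _ finite_set_of_finite_funs[of I "{..<N}" 0]])
    (auto simp: Js_def box_def)

text \<open>For finite \<open>I\<close> a local matrix supported in a box has only finitely many
  entries on \<open>Js I\<close>, hence equals the combination of matrix units with these
  coefficients.\<close>

lemma Fs_single_iff:
  assumes "finite I"
  shows "a \<in> Fs {I} \<longleftrightarrow> loc I a \<and>
    (\<exists>N. \<forall>m k. ent a m k \<noteq> 0 \<longrightarrow> m \<in> box I N \<and> k \<in> box I N)" (is "_ \<longleftrightarrow> _ \<and> ?B a")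
proof
  show "loc I a \<and> ?B a" if "a \<in> Fs {I}"
    using that
  proof (induction rule: Fs_induct)
    case (unit J \<alpha> \<beta>)
    \<comment> \<open>One bound for all exponents in \<open>\<alpha>\<close> and
      \<open>\<beta>\<close>; sums avoid a maximum over a possibly empty \<open>I\<close>.\<close>
    have "\<forall>i\<in>I. \<alpha> i < Suc (\<Sum>i\<in>I. \<alpha> i) + (\<Sum>i\<in>I. \<beta> i) \<and> \<beta> i < Suc (\<Sum>i\<in>I. \<alpha> i) + (\<Sum>i\<in>I. \<beta> i)"
      using member_le_sum[of _ I \<alpha>] member_le_sum[of _ I \<beta>] assms
      by (simp add: less_Suc_eq_le trans_le_add1 trans_le_add2)
    with unit show ?case
      by (auto simp: loc_me ent_me box_def split: if_splits intro!: exI[of _ "Suc (\<Sum>i\<in>I. \<alpha> i) + (\<Sum>i\<in>I. \<beta> i)"])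
  next
    case (add a b)
    then obtain N N' where "\<forall>m k. ent a m k \<noteq> 0 \<longrightarrow> m \<in> box I N \<and> k \<in> box I N"
      "\<forall>m k. ent b m k \<noteq> 0 \<longrightarrow> m \<in> box I N' \<and> k \<in> box I N'" by blast
    moreover have "box I N \<subseteq> box I (max N N')" "box I N' \<subseteq> box I (max N N')"
      by (auto simp: box_def)
    ultimately have "\<forall>m k. ent (a + b) m k \<noteq> 0 \<longrightarrow> m \<in> box I (max N N') \<and> k \<in> box I (max N N')"
      by (metis add.right_neutral ent_simps(3) subsetD)
    with add show ?case by (blast intro: loc_simps)
  next
    case (scale c a)
    then show ?case by (auto intro: loc_simps)
  qed (auto intro: loc_simps)
next
  assume "loc I a \<and> ?B a"
  then obtain N where l: "loc I a" and N: "\<And>m k. ent a m k \<noteq> 0 \<Longrightarrow> m \<in> box I N \<and> k \<in> box I N"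
    by blast
  define B where "B = Js I \<inter> box I N"
  define b where "b = (\<Sum>m\<in>B. \<Sum>k\<in>B. scale (ent a m k) (me I m k))"
  have fin: "finite B" unfolding B_def using finite_box[OF assms] .
  have b: "b \<in> Fs {I}"
    unfolding b_def by (intro rc.subspace_sum[OF subspace_Fs] Fs_scale me_in_Fs) auto
  have lb: "loc I b"
    unfolding b_def by (intro rc.subspace_sum[of "Collect (loc I)", simplified])
      (auto intro!: rc.subspaceI loc_simps loc_me)
  have ent_sum: "ent (sum f S) m k = (\<Sum>s\<in>S. ent (f s) m k)" if "finite S"
    for f :: "(nat \<Rightarrow> nat) \<Rightarrow> 'a nmat" and S m k using that by (induction S) auto
  have "a = b"
  proof (rule loc_eqI[OF l lb])
    fix m k assume mk: "m \<in> Js I" "k \<in> Js I"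
    have "ent (me I m' k') m k = (if m' = m then if k' = k then 1 else 0 else 0 :: 'a)"
      if "m' \<in> B" "k' \<in> B" for m' k'
    proof -
      have "(\<forall>i\<in>I. m i = m' i) \<longleftrightarrow> m' = m" "override_on m k' I = k'"
        using that mk unfolding B_def Js_def by (auto simp: fun_eq_iff override_on_def) metis
      then show ?thesis by (auto simp: ent_me)
    qed
    then have "ent b m k = (\<Sum>m'\<in>B. \<Sum>k'\<in>B. if m' = m then if k' = k then ent a m k else 0 else 0)"
      unfolding b_def by (simp add: ent_sum fin) (intro sum.cong refl, auto)
    also have "\<dots> = (\<Sum>m'\<in>B. if m' = m then (\<Sum>k'\<in>B. if k' = k then ent a m k else 0) else 0)"
      by (intro sum.cong refl) auto
    also have "\<dots> = (if m \<in> B \<and> k \<in> B then ent a m k else 0)"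
      using fin by (simp add: sum.delta)
    also have "\<dots> = ent a m k"
      using N[of m k] mk unfolding B_def by auto
    finally show "ent a m k = ent b m k" by simp
  qed
  with b show "a \<in> Fs {I}" by simp
qed

section \<open>Matrices as operators\<close>

definition mop :: "'a::comm_ring_1 nmat \<Rightarrow> ((nat \<Rightarrow> nat) \<Rightarrow> 'a) \<Rightarrow> (nat \<Rightarrow> nat) \<Rightarrow> 'a" where
  "mop a f m = (\<Sum>k | ent a m k \<noteq> 0. ent a m k * f k)"

lemma mop_sum:
  assumes "finite S" "{k. ent a m k \<noteq> 0} \<subseteq> S"
  shows "mop a f m = (\<Sum>k\<in>S. ent a m k * f k)"
  unfolding mop_def using assms by (intro sum.mono_neutral_left) auto

lemma mop_single:
  assumes "\<And>k. ent a m k = (if k = k0 then c else 0)"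
  shows "mop a f m = c * f k0"
  by (subst mop_sum[of "{k0}"]) (auto simp: assms)

text \<open>Delta functions recover the columns of the matrix, so \<open>mop\<close> is
  injective.\<close>

lemma mop_delta: "mop a (\<lambda>j. if j = k then 1 else 0) m = ent a m k"
proof -
  have "mop a (\<lambda>j. if j = k then 1 else 0) m = (\<Sum>j | ent a m j \<noteq> 0. if j = k then ent a m j else 0)"
    unfolding mop_def by (intro sum.cong) auto
  also have "\<dots> = ent a m k" by (simp add: sum.delta)
  finally show ?thesis .
qed

lemma mop_inject [simp]: "mop a = mop b \<longleftrightarrow> a = b"
proof
  assume "mop a = mop b"
  then show "a = b" by (intro rcmat_eqI) (metis mop_delta)
qed simp

lemma mop_add: "mop (a + b) f m = mop a f m + mop b f m"
proof -
  let ?S = "{k. ent a m k \<noteq> 0} \<union> {k. ent b m k \<noteq> 0}"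
  have "{k. ent (a + b) m k \<noteq> 0} \<subseteq> ?S" by auto
  then show ?thesis
    by (simp add: mop_sum[of ?S] distrib_right sum.distrib)
qed

lemma mop_scale: "mop (scale c a) f m = c * mop a f m"
proof -
  have "mop (scale c a) f m = (\<Sum>k | ent a m k \<noteq> 0. c * ent a m k * f k)"
    by (subst mop_sum[of "{k. ent a m k \<noteq> 0}"]) auto
  then show ?thesis by (simp add: mop_def sum_distrib_left mult.assoc)
qed

lemma mop_zero: "mop 0 f m = 0"
  by (simp add: mop_def)

lemma mop_one: "mop 1 f = f"
  by (rule ext) (subst mop_single[where c = 1 and ?k0.0 = m for m], auto)

lemma mop_times: "mop (a * b) f = mop a (mop b f)"
proof
  fix m
  define S where "S = {j. ent a m j \<noteq> 0}"
  define T where "T = (\<Union>j\<in>S. {k. ent b j k \<noteq> 0})"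
  have fin: "finite S" "finite T" unfolding S_def T_def by auto
  have ab: "ent (a * b) m k = (\<Sum>j\<in>S. ent a m j * ent b j k)" for k
    by (rule ent_times_sum[OF fin(1)]) (simp add: S_def)
  have "{k. ent (a * b) m k \<noteq> 0} \<subseteq> T"
  proof
    fix k assume "k \<in> {k. ent (a * b) m k \<noteq> 0}"
    then obtain j where "j \<in> S" "ent a m j * ent b j k \<noteq> 0"
      unfolding ab by (auto elim: sum.not_neutral_contains_not_neutral)
    then show "k \<in> T" unfolding T_def by (metis (mono_tags) UN_iff mem_Collect_eq mult_zero_right)
  qed
  then have "mop (a * b) f m = (\<Sum>k\<in>T. \<Sum>j\<in>S. ent a m j * ent b j k * f k)"
    by (simp add: mop_sum[OF fin(2)] ab sum_distrib_right)
  also have "\<dots> = (\<Sum>j\<in>S. ent a m j * (\<Sum>k\<in>T. ent b j k * f k))"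
    by (subst sum.swap) (simp add: sum_distrib_left mult.assoc)
  also have "\<dots> = (\<Sum>j\<in>S. ent a m j * mop b f j)"
    by (intro sum.cong refl arg_cong2[of _ _ _ _ "(*)"] mop_sum[symmetric] fin) (auto simp: T_def)
  also have "\<dots> = mop a (mop b f) m" by (simp add: mop_def S_def)
  finally show "mop (a * b) f m = mop a (mop b f) m" .
qed

lemma mop_mx: "mop (mx i) f m = (if m i = 0 then 0 else f (m(i := m i - 1)))"
proof -
  have "ent (mx i) m j = (if j = m(i := m i - 1) then (if m i = 0 then 0 else 1) else 0)" for j
    by (auto simp: ent_mx)
  from mop_single[OF this, of f] show ?thesis by simp
qed

lemma mop_my: "mop (my i) f m = f (m(i := m i + 1))"
  by (subst mop_single[where c = 1 and ?k0.0 = "m(i := m i + 1)"]) (auto simp: ent_my)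

section \<open>The limit homomorphisms\<close>

text \<open>\<open>lim_rel I a b\<close> says that far out in all directions outside \<^term>\<open>I\<close>, and on functions not
  depending on these directions, \<^term>\<open>a\<close> acts like \<^term>\<open>b\<close>. In the limit, the shifts in these
  directions become the identity, so \<^term>\<open>b\<close> is the image of \<^term>\<open>a\<close> under the algebra homomorphism
  sending both generators of every index outside \<^term>\<open>I\<close> to 1. The second conjunct is a locality
  condition making the relation stable under products.\<close>

definition lim_rel :: "nat set \<Rightarrow> 'a::comm_ring_1 nmat \<Rightarrow> 'a nmat \<Rightarrow> bool" where
  "lim_rel I a b \<longleftrightarrow> (\<exists>N.
     (\<forall>f m k. (\<forall>j. j \<notin> I \<longrightarrow> N \<le> k j) \<longrightarrow>
        mop a (\<lambda>m'. f (override_on m m' I)) (override_on k m I) = mop b f m) \<and>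
     (\<forall>f g m. (\<forall>m'. (\<forall>j. m j \<le> m' j + N) \<longrightarrow> f m' = g m') \<longrightarrow> mop a f m = mop a g m))"

lemma lim_relI:
  assumes "\<And>f m k. (\<And>j. j \<notin> I \<Longrightarrow> N \<le> k j) \<Longrightarrow>
        mop a (\<lambda>m'. f (override_on m m' I)) (override_on k m I) = mop b f m"
    and "\<And>f g m. (\<And>m'. (\<And>j. m j \<le> m' j + N) \<Longrightarrow> f m' = g m') \<Longrightarrow> mop a f m = mop a g m"
  shows "lim_rel I a b"
  unfolding lim_rel_def using assms by (intro exI[of _ N]) blast

text \<open>Both conditions persist when the bound grows; in this form the bounds of two matrices
  can be raised to a common one.\<close>

lemma lim_relE:
  assumes "lim_rel I a b"
  obtains N where "\<And>N' f m k. N \<le> N' \<Longrightarrow> (\<And>j. j \<notin> I \<Longrightarrow> N' \<le> k j) \<Longrightarrow>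
        mop a (\<lambda>m'. f (override_on m m' I)) (override_on k m I) = mop b f m"
    "\<And>N' f g m. N \<le> N' \<Longrightarrow> (\<And>m'. (\<And>j. m j \<le> m' j + N') \<Longrightarrow> f m' = g m') \<Longrightarrow> mop a f m = mop a g m"
proof -
  from assms obtain N where
    1: "\<forall>f m k. (\<forall>j. j \<notin> I \<longrightarrow> N \<le> k j) \<longrightarrow>
        mop a (\<lambda>m'. f (override_on m m' I)) (override_on k m I) = mop b f m" and
    2: "\<forall>f g m. (\<forall>m'. (\<forall>j. m j \<le> m' j + N) \<longrightarrow> f m' = g m') \<longrightarrow> mop a f m = mop a g m"
    unfolding lim_rel_def by blast
  show ?thesis
  proof
    show "mop a (\<lambda>m'. f (override_on m m' I)) (override_on k m I) = mop b f m"
      if "N \<le> N'" "\<And>j. j \<notin> I \<Longrightarrow> N' \<le> k j" for N' f m k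
      using 1 that by (meson order_trans)
    show "mop a f m = mop a g m"
      if "N \<le> N'" "\<And>m'. (\<And>j. m j \<le> m' j + N') \<Longrightarrow> f m' = g m'" for N' f g m
    proof -
      have "f m' = g m'" if "\<forall>j. m j \<le> m' j + N" for m'
        using \<open>N \<le> N'\<close> that \<open>\<And>m'. (\<And>j. m j \<le> m' j + N') \<Longrightarrow> f m' = g m'\<close>
        by (meson add_left_mono order_trans)
      then show ?thesis using 2 by blast
    qed
  qed
qed

lemma lim_rel_unique:
  assumes "lim_rel I a b" "lim_rel I a b'"
  shows "b = b'"
proof -
  obtain N where N: "\<And>N' f m k. N \<le> N' \<Longrightarrow> (\<And>j. j \<notin> I \<Longrightarrow> N' \<le> k j) \<Longrightarrow>
        mop a (\<lambda>m'. f (override_on m m' I)) (override_on k m I) = mop b f m"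
    using lim_relE[OF assms(1)] by metis
  obtain M where M: "\<And>N' f m k. M \<le> N' \<Longrightarrow> (\<And>j. j \<notin> I \<Longrightarrow> N' \<le> k j) \<Longrightarrow>
        mop a (\<lambda>m'. f (override_on m m' I)) (override_on k m I) = mop b' f m"
    using lim_relE[OF assms(2)] by metis
  have "mop b f m = mop b' f m" for f m
    using N[of "max N M" "\<lambda>_. max N M" f m] M[of "max N M" "\<lambda>_. max N M" f m] by simp
  then have "mop b = mop b'" by blast
  then show ?thesis by simp
qed

lemma lim_rel_one: "lim_rel I 1 1"
proof (rule lim_relI[of _ 0], goal_cases)
  case (1 f m k)
  have "override_on m (override_on k m I) I = m" by (auto simp: override_on_def)
  then show ?case by (simp add: mop_one)
qed (simp add: mop_one)

lemma lim_rel_mx: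
  "i \<in> I \<Longrightarrow> lim_rel I (mx i) (mx i :: 'a::comm_ring_1 nmat)"
  "i \<notin> I \<Longrightarrow> lim_rel I (mx i) (1 :: 'a nmat)"
proof -
  have loc: "mop (mx i) f m = mop (mx i) g m"
    if "\<And>m'. (\<And>j. m j \<le> m' j + 1) \<Longrightarrow> f m' = g m'" for f g :: "(nat \<Rightarrow> nat) \<Rightarrow> 'a" and m
    unfolding mop_mx by (auto intro!: that)
  show "lim_rel I (mx i) (mx i :: 'a nmat)" if i: "i \<in> I"
  proof (rule lim_relI[of _ 1])
    fix f :: "(nat \<Rightarrow> nat) \<Rightarrow> 'a" and m k :: "nat \<Rightarrow> nat"
    have "override_on m ((override_on k m I)(i := m i - 1)) I = m(i := m i - 1)"
      using i by (auto simp: override_on_def)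
    then show "mop (mx i) (\<lambda>m'. f (override_on m m' I)) (override_on k m I) = mop (mx i) f m"
      using i by (simp add: mop_mx)
  qed (use loc in blast)
  show "lim_rel I (mx i) (1 :: 'a nmat)" if i: "i \<notin> I"
  proof (rule lim_relI[of _ 1])
    fix f :: "(nat \<Rightarrow> nat) \<Rightarrow> 'a" and m k :: "nat \<Rightarrow> nat"
    assume k: "\<And>j. j \<notin> I \<Longrightarrow> 1 \<le> k j"
    have "override_on m ((override_on k m I)(i := k i - 1)) I = m"
      using i by (auto simp: override_on_def)
    then show "mop (mx i) (\<lambda>m'. f (override_on m m' I)) (override_on k m I) = mop 1 f m"
      using i k[OF i] by (simp add: mop_mx mop_one)
  qed (use loc in blast)
qed

lemma lim_rel_my:
  "i \<in> I \<Longrightarrow> lim_rel I (my i) (my i :: 'a::comm_ring_1 nmat)"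
  "i \<notin> I \<Longrightarrow> lim_rel I (my i) (1 :: 'a nmat)"
proof -
  have loc: "mop (my i) f m = mop (my i) g m"
    if "\<And>m'. (\<And>j. m j \<le> m' j + 1) \<Longrightarrow> f m' = g m'" for f g :: "(nat \<Rightarrow> nat) \<Rightarrow> 'a" and m
    unfolding mop_my by (auto intro!: that)
  show "lim_rel I (my i) (my i :: 'a nmat)" if i: "i \<in> I"
  proof (rule lim_relI[of _ 1])
    fix f :: "(nat \<Rightarrow> nat) \<Rightarrow> 'a" and m k :: "nat \<Rightarrow> nat"
    have "override_on m ((override_on k m I)(i := m i + 1)) I = m(i := m i + 1)"
      using i by (auto simp: override_on_def)
    then show "mop (my i) (\<lambda>m'. f (override_on m m' I)) (override_on k m I) = mop (my i) f m"
      using i by (simp add: mop_my)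
  qed (use loc in blast)
  show "lim_rel I (my i) (1 :: 'a nmat)" if i: "i \<notin> I"
  proof (rule lim_relI[of _ 1])
    fix f :: "(nat \<Rightarrow> nat) \<Rightarrow> 'a" and m k :: "nat \<Rightarrow> nat"
    have "override_on m ((override_on k m I)(i := k i + 1)) I = m"
      using i by (auto simp: override_on_def)
    then show "mop (my i) (\<lambda>m'. f (override_on m m' I)) (override_on k m I) = mop 1 f m"
      using i by (simp add: mop_my mop_one)
  qed (use loc in blast)
qed

lemma lim_rel_add:
  assumes "lim_rel I a b" "lim_rel I a' b'"
  shows "lim_rel I (a + a') (b + b')"
proof -
  from assms(1) obtain N where N: "\<And>N' f m k. N \<le> N' \<Longrightarrow> (\<And>j. j \<notin> I \<Longrightarrow> N' \<le> k j) \<Longrightarrow>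
        mop a (\<lambda>m'. f (override_on m m' I)) (override_on k m I) = mop b f m"
    "\<And>N' f g m. N \<le> N' \<Longrightarrow> (\<And>m'. (\<And>j. m j \<le> m' j + N') \<Longrightarrow> f m' = g m') \<Longrightarrow> mop a f m = mop a g m"
    by (rule lim_relE) blast
  from assms(2) obtain M where M: "\<And>N' f m k. M \<le> N' \<Longrightarrow> (\<And>j. j \<notin> I \<Longrightarrow> N' \<le> k j) \<Longrightarrow>
        mop a' (\<lambda>m'. f (override_on m m' I)) (override_on k m I) = mop b' f m"
    "\<And>N' f g m. M \<le> N' \<Longrightarrow> (\<And>m'. (\<And>j. m j \<le> m' j + N') \<Longrightarrow> f m' = g m') \<Longrightarrow> mop a' f m = mop a' g m"
    by (rule lim_relE) blast
  have L: "N \<le> max N M" "M \<le> max N M" by auto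
  show ?thesis
  proof (rule lim_relI[of _ "max N M"], goal_cases)
    case (1 f m k)
    show ?case
      unfolding mop_add using N(1)[OF L(1), of k f m] M(1)[OF L(2), of k f m] 1 by simp
  next
    case (2 f g m)
    show ?case
      unfolding mop_add using N(2)[OF L(1), of m f g] M(2)[OF L(2), of m f g] 2 by simp
  qed
qed

lemma lim_rel_scale:
  assumes "lim_rel I a b"
  shows "lim_rel I (scale c a) (scale c b)"
proof -
  from assms(1) obtain N where N: "\<And>N' f m k. N \<le> N' \<Longrightarrow> (\<And>j. j \<notin> I \<Longrightarrow> N' \<le> k j) \<Longrightarrow>
        mop a (\<lambda>m'. f (override_on m m' I)) (override_on k m I) = mop b f m"
    "\<And>N' f g m. N \<le> N' \<Longrightarrow> (\<And>m'. (\<And>j. m j \<le> m' j + N') \<Longrightarrow> f m' = g m') \<Longrightarrow> mop a f m = mop a g m"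
    by (rule lim_relE) blast
  show ?thesis
  proof (rule lim_relI[of _ N], goal_cases)
    case (1 f m k)
    show ?case
      unfolding mop_scale using N(1)[OF order_refl, of k f m] 1 by simp
  next
    case (2 f g m)
    show ?case
      unfolding mop_scale using N(2)[OF order_refl, of m f g] 2 by simp
  qed
qed

lemma lim_rel_times:
  assumes "lim_rel I a b" "lim_rel I a' b'"
  shows "lim_rel I (a * a') (b * b')"
proof -
  from assms(1) obtain N where N: "\<And>N' f m k. N \<le> N' \<Longrightarrow> (\<And>j. j \<notin> I \<Longrightarrow> N' \<le> k j) \<Longrightarrow>
        mop a (\<lambda>m'. f (override_on m m' I)) (override_on k m I) = mop b f m"
    "\<And>N' f g m. N \<le> N' \<Longrightarrow> (\<And>m'. (\<And>j. m j \<le> m' j + N') \<Longrightarrow> f m' = g m') \<Longrightarrow> mop a f m = mop a g m"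
    by (rule lim_relE) blast
  from assms(2) obtain M where M: "\<And>N' f m k. M \<le> N' \<Longrightarrow> (\<And>j. j \<notin> I \<Longrightarrow> N' \<le> k j) \<Longrightarrow>
        mop a' (\<lambda>m'. f (override_on m m' I)) (override_on k m I) = mop b' f m"
    "\<And>N' f g m. M \<le> N' \<Longrightarrow> (\<And>m'. (\<And>j. m j \<le> m' j + N') \<Longrightarrow> f m' = g m') \<Longrightarrow> mop a' f m = mop a' g m"
    by (rule lim_relE) blast
  show ?thesis
  \<comment> \<open>\<open>a\<close> reads its argument at points at most \<open>N\<close> lower in
    each coordinate. From outer coordinates at least \<open>N + M\<close> these points still have
    outer coordinates at least \<open>M\<close>, where \<open>a'\<close> already acts like its
    limit.\<close>
  proof (rule lim_relI[of _ "N + M"], goal_cases)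
    case (1 f m k)
    have in_range: "mop a' (\<lambda>m''. f (override_on m m'' I)) m' = mop b' f (override_on m m' I)"
      if "\<And>j. override_on k m I j \<le> m' j + N" for m'
    proof -
      have "M \<le> m' j" if "j \<notin> I" for j
        using 1[OF that] \<open>\<And>j. override_on k m I j \<le> m' j + N\<close>[of j] that by simp
      then have "mop a' (\<lambda>m''. f (override_on (override_on m m' I) m'' I)) (override_on m' (override_on m m' I) I)
          = mop b' f (override_on m m' I)"
        by (rule M(1)[OF order_refl])
      moreover have "override_on (override_on m m' I) m'' I = override_on m m'' I"
        "override_on m' (override_on m m' I) I = m'" for m''
        by (auto simp: override_on_def)
      ultimately show ?thesis by simp
    qed
    have "mop a (mop a' (\<lambda>m''. f (override_on m m'' I))) (override_on k m I)
        = mop a (\<lambda>m'. mop b' f (override_on m m' I)) (override_on k m I)"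
      by (rule N(2)[OF order_refl in_range])
    also have "\<dots> = mop b (mop b' f) m"
      by (rule N(1)[of "N + M"]) (use 1 in auto)
    finally show ?case by (simp add: mop_times)
  next
    case (2 f g m)
    have "mop a' f m' = mop a' g m'" if "\<And>j. m j \<le> m' j + N" for m'
    proof (rule M(2)[OF order_refl])
      fix m'' assume "\<And>j. m' j \<le> m'' j + M"
      then have "m j \<le> m'' j + (N + M)" for j
        using that[of j] by (metis add.commute add.left_commute add_left_mono order_trans)
      then show "f m'' = g m''" by (rule 2)
    qed
    then show ?case
      unfolding mop_times by (rule N(2)[OF order_refl])
  qed
qed

lemma lim_rel_exists: "a \<in> SA J \<Longrightarrow> \<exists>b\<in>SA (J \<inter> I). lim_rel I a b"
proof (induction rule: SA.induct)
  case (SA_mx i)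
  then show ?case by (cases "i \<in> I") (auto intro: SA_one SA.SA_mx lim_rel_mx)
next
  case (SA_my i)
  then show ?case by (cases "i \<in> I") (auto intro: SA_one SA.SA_my lim_rel_my)
qed (blast intro: SA_one SA.SA_add SA.SA_mult SA.SA_scale lim_rel_one lim_rel_add lim_rel_scale lim_rel_times)+

lemma lim_rel_self: "a \<in> SA I \<Longrightarrow> lim_rel I a a"
  by (induction rule: SA.induct)
    (auto intro: lim_rel_one lim_rel_add lim_rel_scale lim_rel_times lim_rel_mx lim_rel_my)

text \<open>Going through a relation, the map is well defined by uniqueness of limits, and no
  relations among the generators have to be checked. Existence is known on
  \<open>SA UNIV\<close>.\<close>

definition plim :: "nat set \<Rightarrow> 'a::comm_ring_1 nmat \<Rightarrow> 'a nmat" where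
  "plim I a = (THE b. lim_rel I a b)"

lemma plim_eqI: "lim_rel I a b \<Longrightarrow> plim I a = b"
  unfolding plim_def using lim_rel_unique by blast

lemma plim_rel: "a \<in> SA UNIV \<Longrightarrow> lim_rel I a (plim I a)"
  using lim_rel_exists plim_eqI by metis

lemma plim_in_SA: "a \<in> SA J \<Longrightarrow> plim I a \<in> SA (J \<inter> I)"
  using lim_rel_exists plim_eqI by metis

lemma plim_self: "a \<in> SA I \<Longrightarrow> plim I a = a"
  by (intro plim_eqI lim_rel_self)

lemma plim_gen: "i \<notin> I \<Longrightarrow> plim I (mx i) = 1" "i \<notin> I \<Longrightarrow> plim I (my i) = 1"
  by (auto intro: plim_eqI lim_rel_mx lim_rel_my)

lemma plim_scale: "a \<in> SA UNIV \<Longrightarrow> plim I (scale c a) = scale c (plim I a)"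
  by (intro plim_eqI lim_rel_scale plim_rel)

lemma plim_hom:
  assumes "a \<in> SA UNIV" "b \<in> SA UNIV"
  shows "plim I (a + b) = plim I a + plim I b" "plim I (a * b) = plim I a * plim I b"
    "plim I (a - b) = plim I a - plim I b"
proof -
  have add: "plim I (a + b) = plim I a + plim I b" if "a \<in> SA UNIV" "b \<in> SA UNIV"
    for a b :: "'a nmat"
    using that by (intro plim_eqI lim_rel_add plim_rel)
  then show "plim I (a + b) = plim I a + plim I b" using assms by blast
  show "plim I (a * b) = plim I a * plim I b"
    using assms by (intro plim_eqI lim_rel_times plim_rel)
  have "plim I (a + scale (- 1) b) = plim I a + scale (- 1) (plim I b)"
    using assms by (simp only: add plim_scale SA_scale)
  then show "plim I (a - b) = plim I a - plim I b" by simp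
qed

lemma plim_power: "a \<in> SA UNIV \<Longrightarrow> plim I (a ^ k) = plim I a ^ k"
  by (induction k) (simp_all add: plim_hom SA_power plim_self SA_one)

text \<open>For \<open>j\<close> in \<open>J\<close> but not in \<open>I\<close>, the factor
  \<open>me {j}\<close> is a difference of two monomials in \<open>mx j\<close> and
  \<open>my j\<close>, both with limit 1.\<close>

lemma plim_me:
  assumes "finite J"
  shows "plim I (me J \<alpha> \<beta>) = (if J \<subseteq> I then me J \<alpha> \<beta> else 0 :: 'a::comm_ring_1 nmat)"
proof (cases "J \<subseteq> I")
  case True
  then show ?thesis using assms by (simp add: plim_self me_in_SA)
next
  case False
  then obtain j where j: "j \<in> J" "j \<notin> I" by auto
  have gen: "mx j \<in> (SA UNIV :: 'a nmat set)" "my j \<in> (SA UNIV :: 'a nmat set)" by (auto intro: SA_mx SA_my)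
  have "plim I (me {j} \<alpha> \<beta>) = (0 :: 'a nmat)"
  proof -
    have pw: "mx j ^ r \<in> (SA UNIV :: 'a nmat set)" "my j ^ r \<in> (SA UNIV :: 'a nmat set)" for r
      using gen SA_power by blast+
    then have "plim I (mx j ^ r * my j ^ s) = (1 :: 'a nmat)" for r s
      using gen j by (simp only: plim_hom(2) plim_power plim_gen[OF j(2)] power_one mult_1)
    then show ?thesis unfolding me_singleton by (subst plim_hom(3)) (simp_all only: SA_mult pw diff_self)
  qed
  moreover have "me J \<alpha> \<beta> = me {j} \<alpha> \<beta> * (me (J - {j}) \<alpha> \<beta> :: 'a nmat)"
    using me_insert[of j "J - {j}"] j by (simp add: insert_absorb)
  ultimately show ?thesis
    using False assms by (simp add: plim_hom me_in_SA)
qed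

lemma plim_Fs:
  fixes a :: "'a::field nmat"
  assumes "a \<in> Fs \<C>" "\<And>J. J \<in> \<C> \<Longrightarrow> finite J"
  shows "plim I a \<in> Fs {J \<in> \<C>. J \<subseteq> I}"
proof -
  have sub: "Fs \<C> \<subseteq> SA UNIV" by (rule Fs_subset_SA) (use assms(2) in auto)
  from assms(1) show ?thesis
  proof (induction rule: Fs_induct)
    case zero
    have "plim I 0 = (0 :: 'a nmat)" by (rule plim_self[OF SA_zero])
    then show ?case by (simp only: Fs_zero)
  next
    case (unit J \<alpha> \<beta>)
    then show ?case using assms(2) by (auto simp: plim_me Fs_zero intro: me_in_Fs)
  next
    case (add a b)
    then have "a \<in> SA UNIV" "b \<in> SA UNIV" using sub by auto
    with add show ?case by (auto simp: plim_hom intro: Fs_add)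
  next
    case (scale c a)
    then have "a \<in> SA UNIV" using sub by auto
    with scale show ?case by (auto simp: plim_scale intro: Fs_scale)
  qed
qed

lemma Fs_empty: "Fs {} = {0}"
  by (simp add: Fs_def)

text \<open>On such sums \<open>plim I\<close> is the projection onto the F(I) component: it fixes
  F(I) and kills the other summands.\<close>

lemma Fs_peel:
  assumes "a \<in> Fs (insert I \<C>)" "plim I a = 0" "finite I" "\<And>J. J \<in> \<C> \<Longrightarrow> finite J \<and> \<not> J \<subseteq> I"
  shows "a \<in> Fs \<C>"
proof -
  obtain b c where bc: "b \<in> Fs {I}" "c \<in> Fs \<C>" "a = b + c"
    by (rule Fs_insert[OF assms(1)])
  have "{J \<in> \<C>. J \<subseteq> I} = {}" using assms(4) by auto
  moreover have "plim I c \<in> Fs {J \<in> \<C>. J \<subseteq> I}"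
    using plim_Fs[OF bc(2), of I] assms(4) by blast
  ultimately have c0: "plim I c = 0" by (simp only: Fs_empty singleton_iff)
  have sub: "Fs {I} \<subseteq> SA I" "Fs \<C> \<subseteq> SA UNIV"
    by (rule Fs_subset_SA; use assms in auto)+
  then have "b \<in> SA I" "c \<in> SA UNIV" using bc by auto
  then have "plim I a = b + 0"
    using c0 unfolding bc(3) by (simp add: plim_hom plim_self SA_UNIV)
  with assms(2) have "b = 0" by simp
  with bc show ?thesis by simp
qed

section \<open>Invertible matrices that are Toeplitz outside a box\<close>

lemma loc_transp: "loc I a \<Longrightarrow> loc I (transp_rc a)"
  unfolding loc_def
proof (intro allI)
  fix \<eta> \<theta>
  assume "\<forall>\<eta> \<theta>. a * me (- I) \<eta> \<theta> = me (- I) \<eta> \<theta> * a"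
  then have "transp_rc (a * me (- I) \<theta> \<eta>) = transp_rc (me (- I) \<theta> \<eta> * a)" by simp
  then show "transp_rc a * me (- I) \<eta> \<theta> = me (- I) \<eta> \<theta> * transp_rc a"
    by (simp add: transp_times)
qed

text \<open>The index of an invertible operator vanishes; for one variable this excludes that far out the
  operator is a nontrivial shift. The index is computed by evaluating the trace of a product of two
  finite blocks in both orders.\<close>

lemma toeplitz_no_shift:
  fixes f g :: "nat \<Rightarrow> nat \<Rightarrow> 'a::field_char_0"
  assumes f: "\<And>a b. N \<le> a \<Longrightarrow> f (Suc a) b = (if b = 0 then 0 else f a (b - 1))"
    and fin: "\<And>c. finite {b. g b c \<noteq> 0}"
    and fg: "\<And>a c S. finite S \<Longrightarrow> {b. g b c \<noteq> 0} \<subseteq> S \<Longrightarrow> (\<Sum>b\<in>S. f a b * g b c) = (if a = c then 1 else 0)"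
    and gf: "\<And>b c S. finite S \<Longrightarrow> {a. f a c \<noteq> 0} \<subseteq> S \<Longrightarrow> (\<Sum>a\<in>S. g b a * f a c) = (if b = c then 1 else 0)"
    and ab: "N \<le> a" "f a b \<noteq> 0"
  shows "a \<le> b"
proof -
  have shift: "f (N + j) b = (if j \<le> b then f N (b - j) else 0)" for j b
  proof (induction j arbitrary: b)
    case (Suc j)
    then show ?case using f[of "N + j" b] by (cases b) auto
  qed simp
  have "(\<Sum>b | g b N \<noteq> 0. f N b * g b N) \<noteq> 0"
    using fg[of "{b. g b N \<noteq> 0}" N N] fin by simp
  then have ex: "\<exists>b. f N b \<noteq> 0"
    by (metis (mono_tags, lifting) mult_zero_left sum.neutral)
  \<comment> \<open>\<open>b0\<close> is the leading position of row \<open>N\<close>. Row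
    \<open>N + j\<close> is a translate of row \<open>N\<close> and starts at \<open>b0 + j\<close>
    with the same leading coefficient.\<close>
  define b0 where "b0 = (LEAST b. f N b \<noteq> 0)"
  have b0: "f N b0 \<noteq> 0" "\<And>b. f N b \<noteq> 0 \<Longrightarrow> b0 \<le> b"
    unfolding b0_def using LeastI_ex[OF ex] by (simp_all add: Least_le)
  have lead: "j + b0 \<le> b" if "f (N + j) b \<noteq> 0" for j b
    using that b0(2)[of "b - j"] by (auto simp: shift split: if_splits)
  have g0: "g b a = 0" if "a < N" "b0 \<le> b" for a b
  proof (rule ccontr)
    assume "g b a \<noteq> 0"
    define T where "T = {b. g b a \<noteq> 0 \<and> b0 \<le> b}"
    have T: "finite T" "T \<noteq> {}"
      using fin[of a] \<open>g b a \<noteq> 0\<close> that by (auto simp: T_def)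
    \<comment> \<open>The last nonzero position of column \<open>a\<close> of \<open>g\<close> is
      \<open>b0 + j\<close>, exactly where row \<open>N + j\<close> of \<open>f\<close> starts, so a
      single nonzero term survives in a product that should vanish.\<close>
    define j where "j = Max T - b0"
    have j: "b0 + j \<in> T" "\<And>c. c \<in> T \<Longrightarrow> c \<le> b0 + j"
      using Max_in[OF T] Max_ge[OF T(1)] unfolding j_def T_def by auto
    have "0 = (\<Sum>c | g c a \<noteq> 0. f (N + j) c * g c a)"
      using fg[of "{c. g c a \<noteq> 0}" a "N + j"] fin that by simp
    also have "\<dots> = (\<Sum>c\<in>{b0 + j}. f (N + j) c * g c a)"
    proof (rule sum.mono_neutral_right)
      show "\<forall>c\<in>{c. g c a \<noteq> 0} - {b0 + j}. f (N + j) c * g c a = 0"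
      proof
        fix c assume c: "c \<in> {c. g c a \<noteq> 0} - {b0 + j}"
        have "f (N + j) c = 0"
        proof (rule ccontr)
          assume "f (N + j) c \<noteq> 0"
          then have "j + b0 \<le> c" by (rule lead)
          with c j(2)[of c] show False by (auto simp: T_def)
        qed
        then show "f (N + j) c * g c a = 0" by simp
      qed
    qed (use fin j T_def in auto)
    also have "\<dots> \<noteq> 0" using b0(1) j(1) by (simp add: shift T_def)
    finally show False by simp
  qed
  \<comment> \<open>Columns \<open>a < N\<close> of \<open>g\<close> live below \<open>b0\<close>,
    and columns \<open>b < b0\<close> of \<open>f\<close> live below \<open>N\<close>: both products
    can be computed inside the finite blocks.\<close>
  have "of_nat N = (\<Sum>a<N. (1::'a))" by simp
  also have "\<dots> = (\<Sum>a<N. \<Sum>b<b0. f a b * g b a)"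
  proof (intro sum.cong refl)
    fix a assume "a \<in> {..<N}"
    then have "{b. g b a \<noteq> 0} \<subseteq> {..<b0}" using g0 by (auto simp: not_le[symmetric])
    then show "1 = (\<Sum>b<b0. f a b * g b a)" using fg[of "{..<b0}" a a] by simp
  qed
  also have "\<dots> = (\<Sum>b<b0. \<Sum>a<N. g b a * f a b)"
    by (subst sum.swap) (simp add: mult.commute)
  also have "\<dots> = (\<Sum>b<b0. (1::'a))"
  proof (intro sum.cong refl)
    fix b assume "b \<in> {..<b0}"
    have "{a. f a b \<noteq> 0} \<subseteq> {..<N}"
    proof (intro subsetI, rule ccontr)
      fix a assume "a \<in> {a. f a b \<noteq> 0}" "a \<notin> {..<N}"
      then have "f (N + (a - N)) b \<noteq> 0" by simp
      from lead[OF this] \<open>b \<in> {..<b0}\<close> show False by simp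
    qed
    then show "(\<Sum>a<N. g b a * f a b) = 1" using gf[of "{..<N}" b b] by simp
  qed
  finally have "N = b0" by simp
  with lead[of "a - N" b] ab show ?thesis by simp
qed

text \<open>Each matrix satisfies its relation on one side only: the one from \<open>my i\<close> on
  rows of \<open>phi\<close> outside the box, the one from \<open>mx i\<close> on columns of
  \<open>psi\<close>. Transposition exchanges the two halves (\<open>dual\<close>).\<close>

locale toeplitz_pair =
  fixes I :: "nat set" and N :: nat and phi psi :: "'a::field_char_0 nmat"
  assumes fin: "finite I" and ne: "I \<noteq> {}"
    and inv: "phi * psi = 1" "psi * phi = 1"
    and loc: "loc I phi" "loc I psi"
    and rowT: "\<And>i m k. i \<in> I \<Longrightarrow> m \<in> Js I \<Longrightarrow> k \<in> Js I \<Longrightarrow> m \<notin> box I N \<Longrightarrow>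
      ent phi (m(i := m i + 1)) k = (if k i = 0 then 0 else ent phi m (k(i := k i - 1)))"
    and colT: "\<And>i m k. i \<in> I \<Longrightarrow> m \<in> Js I \<Longrightarrow> k \<in> Js I \<Longrightarrow> k \<notin> box I N \<Longrightarrow>
      ent psi m (k(i := k i + 1)) = (if m i = 0 then 0 else ent psi (m(i := m i - 1)) k)"
begin

lemma dual: "toeplitz_pair I N (transp_rc psi) (transp_rc phi)"
proof
  show "transp_rc psi * transp_rc phi = 1" "transp_rc phi * transp_rc psi = 1"
    by (simp_all add: inv flip: transp_times)
qed (simp_all add: fin ne loc loc_transp rowT colT del: One_nat_def)

lemma not_box_mono: "m \<notin> box I N \<Longrightarrow> (\<And>i. i \<in> I \<Longrightarrow> m i \<le> m' i) \<Longrightarrow> m' \<notin> box I N"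
  by (auto simp: box_def) (metis le_trans not_le)

lemma shift_up:
  assumes "i \<in> I" "m \<in> Js I" "k \<in> Js I" "m \<notin> box I N"
  shows "ent phi (m(i := m i + t)) (k(i := k i + t)) = ent phi m k"
proof (induction t)
  case (Suc t)
  let ?m = "m(i := m i + t)" and ?k = "k(i := k i + Suc t)"
  have "?m \<notin> box I N" by (rule not_box_mono[OF assms(4)]) auto
  then have r: "ent phi (?m(i := ?m i + 1)) ?k = (if ?k i = 0 then 0 else ent phi ?m (?k(i := ?k i - 1)))"
    by (intro rowT assms Js_upd)
  have e: "?m(i := ?m i + 1) = m(i := m i + Suc t)" "?k(i := ?k i - 1) = k(i := k i + t)"
    and nz: "?k i \<noteq> 0" by (auto simp: fun_eq_iff)
  from r have "ent phi (m(i := m i + Suc t)) ?k = ent phi ?m (k(i := k i + t))"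
    unfolding e if_not_P[OF nz] .
  also have "\<dots> = ent phi m k" by (rule Suc)
  finally show ?case .
qed simp

text \<open>Slide both indices down in direction \<open>i\<close> until the column exponent is 0
  while the row exponent is still positive; there the Toeplitz relation gives 0. The hypothesis on
  \<open>m(i := 0)\<close> keeps all rows on the way outside the box.\<close>

lemma vanish:
  assumes "i \<in> I" "m \<in> Js I" "k \<in> Js I" "m(i := 0) \<notin> box I N" "k i < m i"
  shows "ent phi m k = 0"
proof -
  let ?m = "m(i := m i - k i)" and ?k = "k(i := 0)"
  let ?m' = "m(i := m i - k i - 1)"
  have nb: "?m \<notin> box I N" "?m' \<notin> box I N"
    by (rule not_box_mono[OF assms(4)]; simp)+
  have s: "ent phi (?m(i := ?m i + k i)) (?k(i := ?k i + k i)) = ent phi ?m ?k"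
    using nb assms by (intro shift_up Js_upd)
  have t: "ent phi (?m'(i := ?m' i + 1)) ?k = (if ?k i = 0 then 0 else ent phi ?m' (?k(i := ?k i - 1)))"
    using nb assms by (intro rowT Js_upd)
  have e: "?m'(i := ?m' i + 1) = ?m" "?m(i := ?m i + k i) = m" "?k(i := ?k i + k i) = k"
    using assms(5) by (auto simp: fun_eq_iff)
  have "?k i = 0" by simp
  from t have "ent phi ?m ?k = 0"
    unfolding e(1) if_P[OF \<open>?k i = 0\<close>] .
  moreover from s have "ent phi m k = ent phi ?m ?k"
    unfolding e(2,3) .
  ultimately show ?thesis by (rule trans[rotated])
qed

text \<open>If \<open>I\<close> has another element \<open>j\<close>, raising the exponents at
  \<open>j\<close> by \<open>N\<close> keeps the entry and puts the row outside the box whatever its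
  exponent at \<open>i\<close>, so \<open>vanish\<close> applies. For \<open>I = {i}\<close> there
  is no such direction, and the index argument takes over.\<close>

lemma triangular:
  assumes "m \<in> Js I" "k \<in> Js I" "m \<notin> box I N" "ent phi m k \<noteq> 0" "i \<in> I"
  shows "m i \<le> k i"
proof (cases "\<exists>j\<in>I. j \<noteq> i")
  case True
  then obtain j where j: "j \<in> I" "j \<noteq> i" by blast
  let ?m = "m(j := m j + N)" and ?k = "k(j := k j + N)"
  have "ent phi ?m ?k \<noteq> 0"
    using shift_up[OF j(1) assms(1-3), of N] assms(4) by simp
  moreover have "?m(i := 0) \<notin> box I N"
    using j by (auto simp: box_def)
  ultimately have "\<not> ?k i < ?m i"
    using vanish[OF assms(5), of ?m ?k] Js_upd[OF assms(1) j(1)] Js_upd[OF assms(2) j(1)] by blast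
  then show ?thesis using j by simp
next
  case False
  then have I: "I = {i}" using assms(5) by blast
  define z where "z = (\<lambda>a. (\<lambda>_. 0 :: nat)(i := a))"
  have z: "z a \<in> Js I" "z a i = a" "z a = z b \<longleftrightarrow> a = b" for a b
    unfolding z_def I Js_def by (auto simp: fun_eq_iff)
  have zJ: "m' = z (m' i)" if "m' \<in> Js I" for m'
    using that unfolding z_def I Js_def by auto
  have inj: "inj z" using z by (auto simp: inj_def)
  have zu: "(z a)(i := b) = z b" for a b unfolding z_def by simp
  define f g where "f = (\<lambda>a b. ent phi (z a) (z b))" and "g = (\<lambda>a b. ent psi (z a) (z b))"
  have col: "(\<Sum>b\<in>S. ent p (z a) (z b) * ent q (z b) (z c)) = ent (p * q) (z a) (z c)"
    if "finite S" "{b. ent q (z b) (z c) \<noteq> 0} \<subseteq> S" "loc I q" for p q :: "'a nmat" and a c S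
  proof -
    have "{k. ent q k (z c) \<noteq> 0} \<subseteq> z ` S"
    proof
      fix k assume k: "k \<in> {k. ent q k (z c) \<noteq> 0}"
      then have "k \<in> Js I" using loc_ent_Js[OF that(3)] z(1) by blast
      then have "k = z (k i)" by (rule zJ)
      moreover have "k i \<in> S" using k that(2) \<open>k = z (k i)\<close> by (metis (mono_tags) mem_Collect_eq subsetD)
      ultimately show "k \<in> z ` S" by (rule image_eqI)
    qed
    then have "ent (p * q) (z a) (z c) = (\<Sum>k\<in>z ` S. ent p (z a) k * ent q k (z c))"
      using that by (intro ent_times_sum_col) auto
    then show ?thesis by (simp add: sum.reindex inj_on_subset[OF inj])
  qed
  have "m i \<le> k i"
  proof (rule toeplitz_no_shift[of N f g])
    show "f (Suc a) b = (if b = 0 then 0 else f a (b - 1))" if "N \<le> a" for a b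
    proof -
      have "z a \<notin> box I N" using that z(2) unfolding box_def I by auto
      from rowT[OF assms(5) z(1) z(1) this, of b] show ?thesis
        unfolding f_def zu z(2) by simp
    qed
    show "finite {b. g b c \<noteq> 0}" for c
      using finite_vimageI[OF finite_col[of psi "z c"] inj] by (simp add: g_def vimage_def)
    show "(\<Sum>b\<in>S. f a b * g b c) = (if a = c then 1 else 0)"
      if "finite S" "{b. g b c \<noteq> 0} \<subseteq> S" for a c S
      using col[of S psi c phi a] that loc inv z(3) by (simp add: f_def g_def)
    show "(\<Sum>b\<in>S. g a b * f b c) = (if a = c then 1 else 0)"
      if "finite S" "{b. f b c \<noteq> 0} \<subseteq> S" for a c S
      using col[of S phi c psi a] that loc inv z(3) by (simp add: f_def g_def)
    show "N \<le> m i" using assms(3) unfolding box_def I by auto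
    show "f (m i) (k i) \<noteq> 0"
      using assms(4) zJ[OF assms(1)] zJ[OF assms(2)] by (simp add: f_def)
  qed
  then show ?thesis .
qed

lemma psi_triangular:
  assumes "m \<in> Js I" "k \<in> Js I" "k \<notin> box I N" "ent psi m k \<noteq> 0" "i \<in> I"
  shows "k i \<le> m i"
  using toeplitz_pair.triangular[OF dual, of k m i] assms by simp

lemma phi_lower: "m \<in> Js I \<Longrightarrow> k \<in> Js I \<Longrightarrow> m \<notin> box I N \<Longrightarrow> k \<in> box I N \<Longrightarrow> ent phi m k = 0"
  using triangular[of m k] not_box_mono[of m k] by blast

lemma psi_upper: "m \<in> Js I \<Longrightarrow> k \<in> Js I \<Longrightarrow> m \<in> box I N \<Longrightarrow> k \<notin> box I N \<Longrightarrow> ent psi m k = 0"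
  using psi_triangular[of m k] not_box_mono[of k m] by blast

text \<open>By \<open>phi_lower\<close> the box block of \<open>psi\<close> is a left inverse of the
  box block of \<open>phi\<close>, hence a two-sided one because the blocks are finite and square.
  By \<open>psi_upper\<close>, row \<gamma> of \<open>psi * phi = 1\<close> with \<gamma> in the box
  only involves the box, and inverting the block of \<open>psi\<close> annihilates the part of
  column \<beta> inside the box.\<close>

lemma phi_upper:
  assumes "\<alpha> \<in> Js I" "\<beta> \<in> Js I" "\<alpha> \<in> box I N" "\<beta> \<notin> box I N"
  shows "ent phi \<alpha> \<beta> = 0"
proof -
  define B where "B = Js I \<inter> box I N"
  have finB: "finite B" unfolding B_def by (rule finite_box[OF fin])
  have 1: "(\<Sum>j\<in>B. ent psi m j * ent phi j k) = (if m = k then 1 else 0)" if "m \<in> B" "k \<in> B" for m k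
  proof -
    have "{j. ent phi j k \<noteq> 0} \<subseteq> B"
      using phi_lower[of _ k] loc_ent_Js[OF loc(1), of _ k] that unfolding B_def by blast
    from ent_times_sum_col[OF finB this, of psi m] show ?thesis using inv by simp
  qed
  have 2: "(\<Sum>j\<in>B. ent phi m j * ent psi j k) = (if m = k then 1 else 0)" if "m \<in> B" "k \<in> B" for m k
    by (rule square_left_inverse_imp_right_inverse[OF finB 1 that])
  have 3: "(\<Sum>\<delta>\<in>B. ent psi \<gamma> \<delta> * ent phi \<delta> \<beta>) = 0" if "\<gamma> \<in> B" for \<gamma>
  proof -
    have "\<gamma> \<noteq> \<beta>" using that assms(4) by (auto simp: B_def)
    have "{j. ent psi \<gamma> j \<noteq> 0} \<subseteq> B"
      using psi_upper[of \<gamma>] loc_ent_Js[OF loc(2), of \<gamma>] that unfolding B_def by blast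
    from ent_times_sum[OF finB this, of phi \<beta>] show ?thesis
      using inv \<open>\<gamma> \<noteq> \<beta>\<close> by simp
  qed
  have \<alpha>: "\<alpha> \<in> B" using assms by (simp add: B_def)
  have "ent phi \<alpha> \<beta> = (\<Sum>\<delta>\<in>B. (if \<alpha> = \<delta> then 1 else 0) * ent phi \<delta> \<beta>)"
    using finB \<alpha> by (simp add: if_distrib[of "\<lambda>x. x * _"] sum.delta cong: if_cong)
  also have "\<dots> = (\<Sum>\<delta>\<in>B. (\<Sum>\<gamma>\<in>B. ent phi \<alpha> \<gamma> * ent psi \<gamma> \<delta>) * ent phi \<delta> \<beta>)"
    by (intro sum.cong refl) (simp add: 2[OF \<alpha>])
  also have "\<dots> = (\<Sum>\<gamma>\<in>B. ent phi \<alpha> \<gamma> * (\<Sum>\<delta>\<in>B. ent psi \<gamma> \<delta> * ent phi \<delta> \<beta>))"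
    by (simp add: sum_distrib_right sum_distrib_left mult.assoc) (rule sum.swap)
  also have "\<dots> = 0" by (simp add: 3)
  finally show ?thesis .
qed

lemma sum_less:
  assumes "\<alpha> \<in> Js I" "\<beta> \<in> Js I" "\<alpha> \<noteq> \<beta>" "\<And>i. i \<in> I \<Longrightarrow> \<alpha> i \<le> \<beta> i"
  shows "sum \<alpha> I < sum \<beta> I"
proof -
  have "\<exists>i\<in>I. \<alpha> i \<noteq> \<beta> i"
  proof (rule ccontr)
    assume h: "\<not> (\<exists>i\<in>I. \<alpha> i \<noteq> \<beta> i)"
    have "\<alpha> i = \<beta> i" for i using h assms(1,2) by (cases "i \<in> I") (auto simp: Js_def)
    then show False using assms(3) by blast
  qed
  then show ?thesis
    using assms(4) fin by (intro sum_strict_mono_ex1) (auto simp: nat_less_le)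
qed

text \<open>Induction on the total degree of the column. A nonzero off-diagonal entry has a row
  \<alpha> of smaller degree. In the expansion of entry (\<alpha>, \<beta>) of
  \<open>psi * phi = 1\<close>, triangularity leaves only \<gamma> outside the box with \<gamma>
  \<le> \<alpha>; their columns in \<open>phi\<close> are diagonal by induction, so those columns of
  \<open>psi\<close> are too. Only the term with the nonzero factor
  \<open>ent psi \<alpha> \<alpha>\<close> remains.\<close>

lemma diagonal:
  assumes "\<beta> \<in> Js I" "\<beta> \<notin> box I N" "\<alpha> \<in> Js I" "\<alpha> \<noteq> \<beta>"
  shows "ent phi \<alpha> \<beta> = 0"
  using assms
proof (induction "sum \<beta> I" arbitrary: \<alpha> \<beta> rule: less_induct)
  case less
  show ?case
  proof (rule ccontr)
    assume nz: "ent phi \<alpha> \<beta> \<noteq> 0"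
    then have ab: "\<alpha> \<notin> box I N" using phi_upper less.prems by blast
    have "sum \<alpha> I < sum \<beta> I"
      using sum_less less.prems triangular[OF less.prems(3,1) ab nz] by blast
    then have IH: "ent phi \<delta> \<gamma> = (if \<delta> = \<gamma> then ent phi \<gamma> \<gamma> else 0)"
      if "\<gamma> \<in> Js I" "\<gamma> \<notin> box I N" "sum \<gamma> I \<le> sum \<alpha> I" for \<delta> \<gamma>
    proof (cases "\<delta> \<noteq> \<gamma> \<and> ent phi \<delta> \<gamma> \<noteq> 0")
      case True
      then show ?thesis
        using less.hyps[of \<gamma> \<delta>] that loc_ent_Js[OF loc(1), of \<delta> \<gamma>] \<open>sum \<alpha> I < sum \<beta> I\<close>
        by (metis le_less_trans)
    qed auto
    have col: "ent psi \<delta> \<gamma> * ent phi \<gamma> \<gamma> = (if \<delta> = \<gamma> then 1 else 0)"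
      if "\<gamma> \<in> Js I" "\<gamma> \<notin> box I N" "sum \<gamma> I \<le> sum \<alpha> I" for \<delta> \<gamma>
      using ent_times_single_col[of phi \<gamma> \<gamma>, OF IH[OF that], of psi \<delta>] inv by simp
    have "0 = ent (psi * phi) \<alpha> \<beta>" using inv less.prems by simp
    also have "\<dots> = (\<Sum>\<gamma>\<in>{\<gamma>. ent psi \<alpha> \<gamma> \<noteq> 0} \<union> {\<alpha>}. ent psi \<alpha> \<gamma> * ent phi \<gamma> \<beta>)"
      by (rule ent_times_sum) auto
    also have "\<dots> = (\<Sum>\<gamma>\<in>{\<alpha>}. ent psi \<alpha> \<gamma> * ent phi \<gamma> \<beta>)"
    proof (rule sum.mono_neutral_right)
      show "\<forall>\<gamma>\<in>{\<gamma>. ent psi \<alpha> \<gamma> \<noteq> 0} \<union> {\<alpha>} - {\<alpha>}. ent psi \<alpha> \<gamma> * ent phi \<gamma> \<beta> = 0"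
      proof (rule ballI, rule ccontr)
        fix \<gamma> assume g: "\<gamma> \<in> {\<gamma>. ent psi \<alpha> \<gamma> \<noteq> 0} \<union> {\<alpha>} - {\<alpha>}"
          and "ent psi \<alpha> \<gamma> * ent phi \<gamma> \<beta> \<noteq> 0"
        then have n: "ent psi \<alpha> \<gamma> \<noteq> 0" "ent phi \<gamma> \<beta> \<noteq> 0" by auto
        have gJ: "\<gamma> \<in> Js I" using loc_ent_Js[OF loc(1) n(2)] less.prems by blast
        have gb: "\<gamma> \<notin> box I N" using phi_upper[of \<gamma> \<beta>] less.prems n gJ by blast
        have "sum \<gamma> I < sum \<alpha> I"
          using sum_less[OF gJ less.prems(3)] psi_triangular[OF less.prems(3) gJ gb n(1)] g by blast
        then show False using col[OF gJ gb, of \<gamma>] col[OF gJ gb, of \<alpha>] g n by auto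
      qed
    qed auto
    also have "\<dots> = ent psi \<alpha> \<alpha> * ent phi \<alpha> \<beta>" by simp
    finally show False
      using nz col[OF less.prems(3) ab, of \<alpha>] by auto
  qed
qed

text \<open>Two exponents outside the box have their pointwise maximum as a common upper bound,
  reached from either one by \<open>shift_up\<close> in one coordinate after another.\<close>

lemma diagonal_constant:
  assumes "\<alpha> \<in> Js I" "\<beta> \<in> Js I" "\<alpha> \<notin> box I N" "\<beta> \<notin> box I N"
  shows "ent phi \<alpha> \<alpha> = ent phi \<beta> \<beta>"
proof -
  have up: "ent phi m' m' = ent phi m m"
    if m: "m \<in> Js I" "m' \<in> Js I" "m \<notin> box I N" "\<And>i. m i \<le> m' i" for m m'
  proof -
    have "ent phi (override_on m m' A) (override_on m m' A) = ent phi m m" if "A \<subseteq> I" for A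
      using finite_subset[OF that fin] that
    proof (induction A rule: finite_induct)
      case (insert i A)
      let ?m = "override_on m m' A"
      have J: "?m \<in> Js I" using m by (auto simp: Js_def override_on_def)
      have b: "?m \<notin> box I N" by (rule not_box_mono[OF m(3)]) (use m in \<open>auto simp: override_on_def\<close>)
      have "override_on m m' (insert i A) = ?m(i := ?m i + (m' i - m i))"
        using insert m(4)[of i] by (auto simp: override_on_def)
      moreover have "i \<in> I" "A \<subseteq> I" using insert.prems by auto
      ultimately show ?case
        using trans[OF shift_up[OF _ J J b] insert.IH, of i "m' i - m i"] by (simp only:)
    qed simp
    moreover have "override_on m m' I = m'"
      using m by (auto simp: Js_def override_on_def)
    ultimately show ?thesis by (metis order_refl)
  qed
  let ?m = "\<lambda>i. max (\<alpha> i) (\<beta> i)"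
  have "?m \<in> Js I" using assms by (auto simp: Js_def)
  then show ?thesis using up[of \<alpha> ?m] up[of \<beta> ?m] assms by simp
qed

lemma phi_scalar_mod_Fs: "\<exists>c. phi - scale c 1 \<in> Fs {I}"
proof -
  \<comment> \<open>A reference point outside the box, which exists as \<open>I\<close> is nonempty;
    its diagonal entry is the scalar.\<close>
  define m0 where "m0 = res I (\<lambda>_. N)"
  have m0: "m0 \<in> Js I" "m0 \<notin> box I N"
    using ne by (auto simp: m0_def box_def)
  let ?c = "ent phi m0 m0"
  have outside: "ent phi m k = (if m = k then ?c else 0)"
    if "m \<in> Js I" "k \<in> Js I" "m \<notin> box I N \<or> k \<notin> box I N" for m k
    using that phi_lower[of m k] phi_upper[of m k] diagonal[of k m] diagonal_constant[of m m0] m0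
    by (cases "m \<in> box I N"; cases "k \<in> box I N") auto
  have l: "loc I (phi - scale ?c 1)" by (intro loc_simps loc)
  have "\<forall>m k. ent (phi - scale ?c 1) m k \<noteq> 0 \<longrightarrow> m \<in> box I N \<and> k \<in> box I N"
  proof (intro allI impI)
    fix m k assume nz: "ent (phi - scale ?c 1) m k \<noteq> 0"
    have "ent (phi - scale ?c 1) m k = ent (phi - scale ?c 1) (res I m) (res I k)"
      using l[unfolded loc_iff, rule_format, of m k] nz by (auto split: if_splits)
    with nz have "res I m \<in> box I N \<and> res I k \<in> box I N"
      using outside[of "res I m" "res I k"] by (auto split: if_splits)
    then show "m \<in> box I N \<and> k \<in> box I N" by (simp add: box_def)
  qed
  with l show ?thesis unfolding Fs_single_iff[OF fin] by blast
qed

lemma scalar_in_Fs: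
  assumes "scale c 1 \<in> (Fs {I} :: 'a nmat set)"
  shows "c = 0"
proof (rule ccontr)
  assume "c \<noteq> 0"
  obtain M where M: "\<forall>m k. ent (scale c 1 :: 'a nmat) m k \<noteq> 0 \<longrightarrow> m \<in> box I M \<and> k \<in> box I M"
    using assms unfolding Fs_single_iff[OF fin] by blast
  have "(\<lambda>_. M) \<in> box I M" using M[rule_format, of "\<lambda>_. M" "\<lambda>_. M"] \<open>c \<noteq> 0\<close> by simp
  then show False using ne by (auto simp: box_def)
qed

lemma scalar_mod_Fs:
  obtains c where "c \<noteq> 0" "phi - scale c 1 \<in> Fs {I}" "psi - scale (inverse c) 1 \<in> Fs {I}"
proof -
  obtain c where c: "phi - scale c 1 \<in> Fs {I}" using phi_scalar_mod_Fs by blast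
  obtain d where "transp_rc psi - scale d 1 \<in> Fs {I}"
    using toeplitz_pair.phi_scalar_mod_Fs[OF dual] by blast
  from transp_Fs[OF this] have d: "psi - scale d 1 \<in> Fs {I}" by simp
  \<comment> \<open>Expanding \<open>psi * phi = 1\<close> around the two scalars puts
    \<open>1 - d * c\<close> times the identity into F(I), which contains no nonzero scalar.\<close>
  have "(psi - scale d 1) * (phi - scale c 1) + scale c (psi - scale d 1) + scale d (phi - scale c 1) \<in> Fs {I}"
    by (intro Fs_add Fs_scale c d Fs_times[OF d c]) auto
  also have "(psi - scale d 1) * (phi - scale c 1) + scale c (psi - scale d 1) + scale d (phi - scale c 1)
      = scale (1 - d * c) 1"
    by (simp add: inv algebra_simps rc.scale_right_diff_distrib rc.scale_left_diff_distrib)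
  finally have "1 - d * c = 0" by (rule scalar_in_Fs)
  then have "c * d = 1" by (simp add: mult.commute)
  then have "c \<noteq> 0" "d = inverse c" by (auto dest: inverse_unique)
  with c d that show ?thesis by blast
qed

end

section \<open>Endomorphisms congruent to the identity modulo finite matrices\<close>

definition alg_hom :: "'a::comm_ring_1 nmat set \<Rightarrow> ('a nmat \<Rightarrow> 'a nmat) \<Rightarrow> bool" where
  "alg_hom S \<tau> \<longleftrightarrow> \<tau> 1 = 1 \<and> (\<forall>a\<in>S. \<forall>b\<in>S. \<tau> (a + b) = \<tau> a + \<tau> b \<and> \<tau> (a * b) = \<tau> a * \<tau> b) \<and>
     (\<forall>c. \<forall>a\<in>S. \<tau> (scale c a) = scale c (\<tau> a))"

lemma alg_homD:
  assumes "alg_hom S \<tau>"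
  shows "\<tau> 1 = 1" "a \<in> S \<Longrightarrow> b \<in> S \<Longrightarrow> \<tau> (a + b) = \<tau> a + \<tau> b"
    "a \<in> S \<Longrightarrow> b \<in> S \<Longrightarrow> \<tau> (a * b) = \<tau> a * \<tau> b" "a \<in> S \<Longrightarrow> \<tau> (scale c a) = scale c (\<tau> a)"
  using assms unfolding alg_hom_def by blast+

lemma alg_hom_zero: "alg_hom (SA I) \<tau> \<Longrightarrow> \<tau> 0 = 0"
  using alg_homD(4)[of "SA I" \<tau> 1 0] by (simp add: SA_one)

lemma alg_hom_diff:
  assumes "alg_hom (SA I) \<tau>" "a \<in> SA I" "b \<in> SA I"
  shows "\<tau> (a - b) = \<tau> a - \<tau> b"
proof -
  have "\<tau> (a + scale (- 1) b) = \<tau> a + scale (- 1) (\<tau> b)"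
    using assms by (simp only: alg_homD SA_scale)
  then show ?thesis by simp
qed

lemma alg_hom_eqI:
  assumes "alg_hom (SA I) \<sigma>" "alg_hom (SA I) \<tau>"
    "\<And>i. i \<in> I \<Longrightarrow> \<sigma> (mx i) = \<tau> (mx i)" "\<And>i. i \<in> I \<Longrightarrow> \<sigma> (my i) = \<tau> (my i)" "a \<in> SA I"
  shows "\<sigma> a = \<tau> a"
  using assms(5)
  by (induction rule: SA.induct) (simp_all add: assms(3,4) alg_homD[OF assms(1)] alg_homD[OF assms(2)])

text \<open>The block \<open>G\<close> tensored with the identity in the variables outside
  \<open>I\<close>; used to define matrices by their entries on \<open>Js I\<close>.\<close>

lemma loc_extension:
  assumes "\<And>m. m \<in> Js I \<Longrightarrow> finite {k \<in> Js I. G m k \<noteq> 0}" "\<And>k. k \<in> Js I \<Longrightarrow> finite {m \<in> Js I. G m k \<noteq> 0}"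
  obtains a :: "'a::comm_ring_1 nmat" where "loc I a" "\<And>m k. m \<in> Js I \<Longrightarrow> k \<in> Js I \<Longrightarrow> ent a m k = G m k"
proof -
  define M where "M = (\<lambda>m k. if \<forall>j. j \<notin> I \<longrightarrow> m j = k j then G (res I m) (res I k) else 0)"
  have fib: "k = override_on m (res I k) I" if "\<forall>j. j \<notin> I \<longrightarrow> m j = k j" for m k :: "nat \<Rightarrow> nat"
    using that by (auto simp: override_on_def)
  have "finite {k. M m k \<noteq> 0}" for m
  proof (rule finite_subset)
    show "{k. M m k \<noteq> 0} \<subseteq> (\<lambda>k. override_on m k I) ` {k \<in> Js I. G (res I m) k \<noteq> 0}"
    proof
      fix k assume "k \<in> {k. M m k \<noteq> 0}"
      then have k: "\<forall>j. j \<notin> I \<longrightarrow> m j = k j" "G (res I m) (res I k) \<noteq> 0"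
        unfolding M_def by (auto split: if_splits)
      show "k \<in> (\<lambda>k. override_on m k I) ` {k \<in> Js I. G (res I m) k \<noteq> 0}"
        by (rule image_eqI[where x = "res I k"], rule fib[OF k(1)]) (use k(2) in simp)
    qed
  qed (intro finite_imageI assms res_in_Js)
  moreover have "finite {m. M m k \<noteq> 0}" for k
  proof (rule finite_subset)
    show "{m. M m k \<noteq> 0} \<subseteq> (\<lambda>m. override_on k m I) ` {m \<in> Js I. G m (res I k) \<noteq> 0}"
    proof
      fix m assume "m \<in> {m. M m k \<noteq> 0}"
      then have m: "\<forall>j. j \<notin> I \<longrightarrow> k j = m j" "G (res I m) (res I k) \<noteq> 0"
        unfolding M_def by (auto split: if_splits)
      show "m \<in> (\<lambda>m. override_on k m I) ` {m \<in> Js I. G m (res I k) \<noteq> 0}"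
        by (rule image_eqI[where x = "res I m"], rule fib[OF m(1)]) (use m(2) in simp)
    qed
  qed (intro finite_imageI assms res_in_Js)
  ultimately have ent: "ent (Abs_rcmat M) = M" by (rule ent_Abs_rcmat)
  show ?thesis
  proof
    show "loc I (Abs_rcmat M)"
      unfolding loc_iff ent by (auto simp: M_def)
    show "ent (Abs_rcmat M) m k = G m k" if "m \<in> Js I" "k \<in> Js I" for m k
    proof -
      have "\<forall>j. j \<notin> I \<longrightarrow> m j = k j" using that by (simp add: Js_def)
      then show ?thesis unfolding ent using that by (simp add: M_def)
    qed
  qed
qed

section \<open>Truncated traces\<close>

definition box_trace :: "nat set \<Rightarrow> nat \<Rightarrow> 'a::comm_ring_1 nmat \<Rightarrow> 'a" where
  "box_trace I N a = (\<Sum>m\<in>Js I \<inter> box I N. ent a m m)"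

lemma box_trace_simps:
  "box_trace I N (a + b) = box_trace I N a + box_trace I N b"
  "box_trace I N (a - b) = box_trace I N a - box_trace I N b"
  by (simp_all add: box_trace_def sum.distrib sum_subtractf)

text \<open>Only the factor \<open>a\<close> has to live in the box: then all inner indices in both
  products do, although the full trace of \<open>b\<close> may be meaningless.\<close>

lemma box_trace_commute:
  assumes "finite I" "loc I a" "\<And>m k. ent a m k \<noteq> 0 \<Longrightarrow> m \<in> box I N \<and> k \<in> box I N"
  shows "box_trace I N (a * b) = box_trace I N (b * a)"
proof -
  define B where "B = Js I \<inter> box I N"
  have finB: "finite B" unfolding B_def by (rule finite_box[OF assms(1)])
  have "ent (a * b) m m = (\<Sum>k\<in>B. ent a m k * ent b k m)" if "m \<in> B" for m
    by (rule ent_times_sum[OF finB]) (use assms loc_ent_Js[OF assms(2), of m] that B_def in blast)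
  moreover have "ent (b * a) m m = (\<Sum>k\<in>B. ent b m k * ent a k m)" if "m \<in> B" for m
    by (rule ent_times_sum_col[OF finB]) (use assms loc_ent_Js[OF assms(2), of _ m] that B_def in blast)
  ultimately have "box_trace I N (a * b) = (\<Sum>m\<in>B. \<Sum>k\<in>B. ent a m k * ent b k m)"
    "box_trace I N (b * a) = (\<Sum>m\<in>B. \<Sum>k\<in>B. ent b m k * ent a k m)"
    unfolding box_trace_def B_def[symmetric] by (auto intro: sum.cong)
  moreover have "(\<Sum>m\<in>B. \<Sum>k\<in>B. ent b m k * ent a k m) = (\<Sum>m\<in>B. \<Sum>k\<in>B. ent a m k * ent b k m)"
    by (subst sum.swap) (simp only: mult.commute)
  ultimately show ?thesis by simp
qed

lemma Js_eq_iff: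
  assumes "m \<in> Js I" "k \<in> Js I"
  shows "(\<forall>i\<in>I. m i = k i) \<longleftrightarrow> m = k"
proof
  assume h: "\<forall>i\<in>I. m i = k i"
  show "m = k"
  proof
    fix i
    show "m i = k i" using h assms by (cases "i \<in> I") (auto simp: Js_def)
  qed
qed simp

locale near_identity =
  fixes I :: "nat set" and \<tau> :: "'a::field_char_0 nmat \<Rightarrow> 'a nmat"
  assumes fin: "finite I" and ne: "I \<noteq> {}"
    and hom: "alg_hom (SA I) \<tau>" and surj: "\<tau> ` SA I = SA I"
    and near: "\<And>i. i \<in> I \<Longrightarrow> \<tau> (mx i) - mx i \<in> Fs {I}" "\<And>i. i \<in> I \<Longrightarrow> \<tau> (my i) - my i \<in> Fs {I}"
begin

lemmas tau = alg_homD[OF hom] alg_hom_zero[OF hom] alg_hom_diff[OF hom]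

lemma tau_SA: "a \<in> SA I \<Longrightarrow> \<tau> a \<in> SA I"
  using surj by blast

lemma near_all: "a \<in> SA I \<Longrightarrow> \<tau> a - a \<in> Fs {I}"
proof (induction rule: SA.induct)
  case (SA_add a b)
  have "\<tau> (a + b) - (a + b) = (\<tau> a - a) + (\<tau> b - b)" using SA_add by (simp add: tau)
  then show ?case using SA_add Fs_add by metis
next
  case (SA_scale a c)
  have "\<tau> (scale c a) - scale c a = scale c (\<tau> a - a)"
    using SA_scale by (simp only: tau rc.scale_right_diff_distrib)
  then show ?case using SA_scale Fs_scale by metis
next
  case (SA_mult a b)
  have "\<tau> (a * b) - a * b = (\<tau> a - a) * \<tau> b + a * (\<tau> b - b)"
    using SA_mult by (simp add: tau algebra_simps)
  also have "\<dots> \<in> Fs {I}" using SA_mult by (intro Fs_add Fs_ideal tau_SA)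
  finally show ?case .
qed (simp_all add: near tau Fs_zero)

definition unit00 :: "'a nmat" where
  "unit00 = me I (\<lambda>_. 0) (\<lambda>_. 0)"

abbreviation "p0 \<equiv> unit00"
abbreviation "P \<equiv> \<tau> unit00"
abbreviation col0 :: "(nat \<Rightarrow> nat) \<Rightarrow> 'a nmat" where "col0 m \<equiv> me I m (\<lambda>_. 0)"
abbreviation row0 :: "(nat \<Rightarrow> nat) \<Rightarrow> 'a nmat" where "row0 m \<equiv> me I (\<lambda>_. 0) m"

lemma me_SA [simp]: "me I \<alpha> \<beta> \<in> SA I"
  by (rule me_in_SA[OF fin order_refl])

lemma p0_SA [simp]: "p0 \<in> SA I"
  by (simp add: unit00_def)

lemma p0_sandwich: "loc I a \<Longrightarrow> p0 * a * p0 = scale (ent a (\<lambda>_. 0) (\<lambda>_. 0)) p0"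
  using me_loc_me[of I a "\<lambda>_. 0" "\<lambda>_. 0" "\<lambda>_. 0" "\<lambda>_. 0"] by (simp add: unit00_def)

lemma p0_idem: "p0 * p0 = p0" "p0 * row0 m = row0 m" "col0 m * p0 = col0 m"
  by (simp_all add: unit00_def me_mult)

lemma P_idem: "P * P = P"
  using tau(3)[of p0 p0] by (simp add: p0_idem)

lemma p0_nonzero: "p0 \<noteq> 0" "ent p0 (\<lambda>_. 0) (\<lambda>_. 0) = 1"
proof -
  show 1: "ent p0 (\<lambda>_. 0) (\<lambda>_. 0) = 1" by (simp add: unit00_def ent_me override_on_def)
  show "p0 \<noteq> 0" using 1 by auto
qed

text \<open>\<open>p0\<close> is a commutator \<open>y z - z y\<close>, and \<open>\<tau>\<close> changes it by commutators with finite matrices, so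
  \<open>\<tau> p0\<close> has the same trace as \<open>p0\<close>, namely 1.\<close>

lemma P_nonzero: "P \<noteq> 0"
proof
  assume P0: "P = 0"
  obtain i where i: "i \<in> I" using ne by auto
  let ?z0 = "\<lambda>_. 0 :: nat"
  \<comment> \<open>\<open>c\<close> is the idempotent of the remaining variables and commutes with
    \<open>my i\<close>: with \<open>z = mx i * c\<close>, \<open>my i * z\<close> is
    \<open>c\<close> and \<open>z * my i\<close> is \<open>mx i * my i * c\<close>, and the
    difference is \<open>p0\<close>.\<close>
  define c where "c = (me (I - {i}) ?z0 ?z0 :: 'a nmat)"
  define z where "z = mx i * c"
  have gSA: "mx i \<in> (SA I :: 'a nmat set)" "my i \<in> (SA I :: 'a nmat set)" using i by (auto intro: SA_mx SA_my)
  have zSA: "z \<in> SA I"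
    unfolding z_def c_def by (intro SA_mult gSA me_in_SA) (use fin in auto)
  have "p0 = me {i} ?z0 ?z0 * c"
    using me_insert[of i "I - {i}" ?z0 ?z0] i by (simp add: unit00_def c_def insert_absorb)
  also have "\<dots> = c - mx i * my i * c" by (simp add: me_singleton left_diff_distrib)
  also have "\<dots> = my i * z - z * my i"
    by (simp add: z_def mult.assoc[symmetric]) (simp add: c_def mult.assoc me_my_commute)
  finally have p0: "p0 = my i * z - z * my i" .
  define g h where "g = \<tau> (my i) - my i" and "h = \<tau> z - z"
  have gh: "g \<in> Fs {I}" "h \<in> Fs {I}"
    unfolding g_def h_def using near_all gSA zSA by blast+
  have P: "P = (my i + g) * (z + h) - (z + h) * (my i + g)"
    unfolding p0 g_def h_def using gSA zSA by (simp add: tau SA_mult)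
  \<comment> \<open>Grouped so that each of the two commutators contains one of the finite matrices
    \<open>g\<close>, \<open>h\<close>.\<close>
  have diff: "P - p0 = (h * - my i - - my i * h) + (g * (z + h) - (z + h) * g)"
    unfolding P by (subst p0) (simp add: algebra_simps)
  obtain N where N: "\<And>m k. ent g m k \<noteq> 0 \<Longrightarrow> m \<in> box I N \<and> k \<in> box I N"
    using gh(1) unfolding Fs_single_iff[OF fin] by blast
  obtain N' where N': "\<And>m k. ent h m k \<noteq> 0 \<Longrightarrow> m \<in> box I N' \<and> k \<in> box I N'"
    using gh(2) unfolding Fs_single_iff[OF fin] by blast
  \<comment> \<open>The successor guarantees that the exponent 0, which carries the trace of
    \<open>p0\<close>, lies in the box.\<close>
  define M where "M = Suc (max N N')"
  have sub: "box I N \<subseteq> box I M" "box I N' \<subseteq> box I M" by (auto simp: box_def M_def)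
  have "box_trace I M (g * b) = box_trace I M (b * g)" for b
    by (rule box_trace_commute[OF fin]) (use N sub gh Fs_single_iff[OF fin] in blast)+
  moreover have "box_trace I M (h * b) = box_trace I M (b * h)" for b
    by (rule box_trace_commute[OF fin]) (use N' sub gh Fs_single_iff[OF fin] in blast)+
  ultimately have "box_trace I M (P - p0) = 0"
    unfolding diff by (simp only: box_trace_simps diff_self add_0)
  then have "box_trace I M p0 = 0" by (simp add: P0 box_trace_def sum_negf)
  moreover have "box_trace I M p0 = (\<Sum>m\<in>Js I \<inter> box I M. if m = ?z0 then 1 else 0)"
    unfolding box_trace_def
  proof (intro sum.cong refl)
    fix m assume "m \<in> Js I \<inter> box I M"
    then have "(\<forall>i\<in>I. m i = 0) \<longleftrightarrow> m = ?z0" unfolding Js_def fun_eq_iff by blast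
    then show "ent p0 m m = (if m = ?z0 then 1 else 0)"
      by (auto simp: unit00_def ent_me override_on_def)
  qed
  moreover have "?z0 \<in> Js I \<inter> box I M" by (auto simp: box_def M_def)
  ultimately show False using finite_box[OF fin, of M] by (simp add: sum.delta)
qed

text \<open>A nonzero entry of \<open>P\<close> at (m, k) provides a column
  \<open>P * col0 k\<close> and a row \<open>row0 m * P\<close> whose product in one order is a
  nonzero multiple of \<open>p0\<close>; normalising gives \<open>r * q = p0\<close>. In the other
  order one gets a multiple of \<open>P\<close>, and idempotency makes the factor 1.\<close>

lemma rank_one:
  obtains q r where "q \<in> SA I" "r \<in> SA I" "r * q = p0" "q * r = P" "P * q = q" "q * p0 = q"
    "p0 * r = r" "r * P = r"
proof -
  have locP: "loc I P" by (intro SA_loc tau_SA) simp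
  obtain m k where mk: "m \<in> Js I" "k \<in> Js I" "ent P m k \<noteq> 0"
    using loc_eqI[OF locP, of 0] P_nonzero loc_simps by (metis ent_simps(1))
  define \<theta> where "\<theta> = ent P m k"
  define q where "q = P * col0 k"
  define r where "r = scale (inverse \<theta>) (row0 m * P)"
  have SA: "q \<in> SA I" "r \<in> SA I"
    unfolding q_def r_def by (auto intro!: SA_mult SA_scale tau_SA)
  have Pq: "P * q = q" and rP: "r * P = r"
    by (simp_all add: q_def r_def mult.assoc P_idem) (simp add: mult.assoc[symmetric] P_idem)
  have qp: "q * p0 = q" and pr: "p0 * r = r"
    by (simp_all add: q_def r_def mult.assoc p0_idem) (simp add: mult.assoc[symmetric] p0_idem)
  have "r * q = scale (inverse \<theta>) (row0 m * (P * P) * col0 k)"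
    by (simp add: q_def r_def mult.assoc)
  also have "row0 m * P * col0 k = scale \<theta> p0"
    using me_loc_me[OF locP, of "\<lambda>_. 0" m k "\<lambda>_. 0"] mk by (simp add: \<theta>_def unit00_def)
  then have "scale (inverse \<theta>) (row0 m * (P * P) * col0 k) = scale (inverse \<theta>) (scale \<theta> p0)"
    by (simp only: P_idem)
  also have "\<dots> = p0" using mk by (simp add: \<theta>_def)
  finally have rq: "r * q = p0" .
  have "q * r = scale (inverse \<theta>) (P * me I k m * P)"
    by (simp add: q_def r_def mult.assoc) (simp add: mult.assoc[symmetric] me_mult)
  \<comment> \<open>By surjectivity the matrix unit in the middle is some \<open>\<tau> b\<close>,
    so the sandwich is the image of \<open>p0 * b * p0\<close>, a multiple of
    \<open>p0\<close>.\<close>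
  moreover obtain b where b: "b \<in> SA I" "\<tau> b = me I k m"
    using surj me_SA by (metis imageE)
  have "P * me I k m * P = \<tau> (p0 * b * p0)"
    using b by (simp add: tau SA_mult)
  also have "\<dots> = scale (ent b (\<lambda>_. 0) (\<lambda>_. 0)) P"
    by (simp add: p0_sandwich[OF SA_loc[OF b(1)]] tau)
  ultimately obtain d where d: "q * r = scale d P" by auto
  have "p0 = r * (q * r) * q" using rq by (simp add: mult.assoc) (simp add: mult.assoc[symmetric] rq p0_idem)
  then have "d \<noteq> 0" using d p0_nonzero by auto
  have "q * r * (q * r) = q * (r * q) * r" by (simp add: mult.assoc)
  also have "\<dots> = q * r" by (simp add: rq qp)
  finally have "scale (d * d) P = scale d P" by (simp add: d P_idem)
  then have "d * d = d" using P_nonzero rc.scale_right_imp_eq by blast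
  with \<open>d \<noteq> 0\<close> have "q * r = P" by (simp add: d)
  with SA rq Pq qp pr rP that show ?thesis by blast
qed

text \<open>In terms of matrix units, phi = \<Sum>k. \<tau>(E_k0) q E_0k and psi = \<Sum>k. E_k0 r
  \<tau>(E_0k). The sums are infinite, so both matrices are given entrywise, and finiteness of the
  rows of \<open>phi\<close> and the columns of \<open>psi\<close> is a separate matter.\<close>

lemma intertwiner:
  obtains phi psi where "phi * psi = 1" "psi * phi = 1" "loc I phi" "loc I psi"
    "\<And>i. i \<in> I \<Longrightarrow> phi * mx i = \<tau> (mx i) * phi" "\<And>i. i \<in> I \<Longrightarrow> phi * my i = \<tau> (my i) * phi"
proof -
  let ?z = "\<lambda>_. 0 :: nat"
  obtain q r where SA: "q \<in> SA I" "r \<in> SA I" and rq: "r * q = p0" and qr: "q * r = P"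
    and Pq: "P * q = q" and qp: "q * p0 = q" and pr: "p0 * r = r" and rP: "r * P = r"
    by (rule rank_one)
  have "\<exists>a\<in>SA I. \<tau> a = b" if "b \<in> SA I" for b
    using surj that by (metis imageE)
  then have "\<forall>m. \<exists>a. a \<in> SA I \<and> \<tau> a = q * row0 m" "\<forall>k. \<exists>b. b \<in> SA I \<and> \<tau> b = col0 k * r"
    using SA SA_mult me_SA by metis+
  then obtain A B where A: "\<And>m. A m \<in> SA I" "\<And>m. \<tau> (A m) = q * row0 m"
    and B: "\<And>k. B k \<in> SA I" "\<And>k. \<tau> (B k) = col0 k * r"
    by metis
  have rPq: "r * \<tau> (scale c p0) * q = scale c p0" for c
    by (simp add: tau rP rq mult.assoc Pq)
  \<comment> \<open>Between units both entries become scalars in front of \<open>p0\<close>, and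
    \<open>\<tau>\<close> carries one expression into the other.\<close>
  have phi_ent: "ent (\<tau> (col0 k) * q) m ?z = ent (A m) ?z k" if mk: "m \<in> Js I" "k \<in> Js I" for m k
  proof -
    have "scale (ent (\<tau> (col0 k) * q) m ?z) p0 = row0 m * (\<tau> (col0 k) * q) * p0"
      using me_loc_me[of I "\<tau> (col0 k) * q" ?z m ?z ?z] mk SA
      by (simp add: unit00_def SA_loc tau_SA SA_mult)
    also have "\<dots> = r * (q * row0 m) * \<tau> (col0 k) * q"
      by (simp add: mult.assoc qp) (simp add: mult.assoc[symmetric] rq p0_idem)
    also have "\<dots> = r * P * \<tau> (A m) * \<tau> (col0 k) * q" by (simp add: A rP)
    also have "\<dots> = r * \<tau> (p0 * A m * col0 k) * q"
      using A by (simp add: tau SA_mult mult.assoc)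
    also have "p0 * A m * col0 k = scale (ent (A m) ?z k) p0"
      using me_loc_me[OF SA_loc[OF A(1)[of m]], of ?z ?z k ?z] mk by (simp add: unit00_def)
    finally show ?thesis using p0_nonzero rc.scale_right_imp_eq by (metis rPq)
  qed
  have psi_ent: "ent (r * \<tau> (row0 m)) ?z k = ent (B k) m ?z" if mk: "m \<in> Js I" "k \<in> Js I" for m k
  proof -
    have "scale (ent (r * \<tau> (row0 m)) ?z k) p0 = p0 * (r * \<tau> (row0 m)) * col0 k"
      using me_loc_me[of I "r * \<tau> (row0 m)" ?z ?z k ?z] mk SA
      by (simp add: unit00_def SA_loc tau_SA SA_mult)
    also have "\<dots> = r * \<tau> (row0 m) * (col0 k * r) * q"
      by (simp add: mult.assoc[symmetric] pr) (simp add: mult.assoc rq p0_idem)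
    also have "\<dots> = r * \<tau> (row0 m) * \<tau> (B k) * (P * q)" by (simp add: B Pq)
    also have "\<dots> = r * \<tau> (row0 m * B k * p0) * q"
      using B by (simp add: tau SA_mult mult.assoc)
    also have "row0 m * B k * p0 = scale (ent (B k) m ?z) p0"
      using me_loc_me[OF SA_loc[OF B(1)[of k]], of ?z m ?z ?z] mk by (simp add: unit00_def)
    finally show ?thesis using p0_nonzero rc.scale_right_imp_eq by (metis rPq)
  qed
  obtain phi where phi: "loc I phi" "\<And>m k. m \<in> Js I \<Longrightarrow> k \<in> Js I \<Longrightarrow> ent phi m k = ent (\<tau> (col0 k) * q) m ?z"
  proof (rule loc_extension[of I "\<lambda>m k. ent (\<tau> (col0 k) * q) m ?z"])
    show "finite {k \<in> Js I. ent (\<tau> (col0 k) * q) m ?z \<noteq> 0}" if "m \<in> Js I" for m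
      by (rule finite_subset[OF _ finite_row[of "A m" ?z]]) (use phi_ent[OF that] in auto)
    show "finite {m \<in> Js I. ent (\<tau> (col0 k) * q) m ?z \<noteq> 0}" for k
      by (rule finite_subset[OF _ finite_col[of "\<tau> (col0 k) * q" ?z]]) auto
  qed (use that in blast)
  obtain psi where psi: "loc I psi" "\<And>m k. m \<in> Js I \<Longrightarrow> k \<in> Js I \<Longrightarrow> ent psi m k = ent (r * \<tau> (row0 m)) ?z k"
  proof (rule loc_extension[of I "\<lambda>m k. ent (r * \<tau> (row0 m)) ?z k"])
    show "finite {m \<in> Js I. ent (r * \<tau> (row0 m)) ?z k \<noteq> 0}" if "k \<in> Js I" for k
      by (rule finite_subset[OF _ finite_col[of "B k" ?z]]) (use psi_ent[OF _ that] in auto)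
    show "finite {k \<in> Js I. ent (r * \<tau> (row0 m)) ?z k \<noteq> 0}" for m
      by (rule finite_subset[OF _ finite_row[of "r * \<tau> (row0 m)" ?z]]) auto
  qed (use that in blast)
  have lSA: "loc I (\<tau> (col0 k) * q)" "loc I (r * \<tau> (row0 m))" "loc I (A m)" "loc I (B k)" for m k
    by (intro SA_loc SA_mult tau_SA SA me_SA A B)+
  have phi_col: "ent phi j k = ent (\<tau> (col0 k) * q) j ?z" if "k \<in> Js I" for j k
    using phi(2)[OF _ that, of j] loc_ent_Js[OF phi(1), of j k] loc_ent_Js[OF lSA(1)[of k], of j ?z] that by force
  have phi_row: "ent phi m j = ent (A m) ?z j" if "m \<in> Js I" for j m
    using phi(2)[OF that, of j] phi_ent[OF that, of j] loc_ent_Js[OF phi(1), of m j]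
      loc_ent_Js[OF lSA(3)[of m], of ?z j] that by force
  have psi_row: "ent psi m j = ent (r * \<tau> (row0 m)) ?z j" if "m \<in> Js I" for j m
    using psi(2)[OF that, of j] loc_ent_Js[OF psi(1), of m j] loc_ent_Js[OF lSA(2)[of m], of ?z j] that by force
  have psi_col: "ent psi j k = ent (B k) j ?z" if "k \<in> Js I" for j k
    using psi(2)[OF _ that, of j] psi_ent[OF _ that, of j] loc_ent_Js[OF psi(1), of j k]
      loc_ent_Js[OF lSA(4)[of k], of j ?z] that by force
  have units: "row0 m * col0 l = (if m = l then p0 else 0)" if "m \<in> Js I" "l \<in> Js I" for m l
  proof -
    have "me (I \<union> I) (override_on l ?z I) (override_on m ?z I) = p0"
      unfolding unit00_def Un_absorb by (rule me_cong) simp_all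
    then show ?thesis by (simp only: me_times_me Int_absorb Js_eq_iff[OF that])
  qed
  have "psi * phi = 1"
  proof (rule loc_eqI[of I])
    fix m l assume ml: "m \<in> Js I" "l \<in> Js I"
    have "ent (psi * phi) m l = ent ((r * \<tau> (row0 m)) * phi) ?z l"
      by (rule ent_times_cong_row[OF psi_row[OF ml(1)]])
    also have "\<dots> = ent ((r * \<tau> (row0 m)) * (\<tau> (col0 l) * q)) ?z ?z"
      by (rule ent_times_cong_col[OF phi_col[OF ml(2)]])
    also have "(r * \<tau> (row0 m)) * (\<tau> (col0 l) * q) = r * \<tau> (row0 m * col0 l) * q"
      by (simp add: tau mult.assoc)
    also have "\<dots> = (if m = l then p0 else 0)"
      by (simp add: units[OF ml] tau rP rq)
    finally show "ent (psi * phi) m l = ent 1 m l" using p0_nonzero by simp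
  qed (intro loc_times loc_simps phi psi)+
  moreover have "phi * psi = 1"
  proof (rule loc_eqI[of I])
    fix m l assume ml: "m \<in> Js I" "l \<in> Js I"
    have AB: "A m * B l \<in> SA I" by (intro SA_mult A B)
    have "ent (phi * psi) m l = ent (A m * psi) ?z l"
      by (rule ent_times_cong_row[OF phi_row[OF ml(1)]])
    also have "\<dots> = ent (A m * B l) ?z ?z"
      by (rule ent_times_cong_col[OF psi_col[OF ml(2)]])
    finally have e: "ent (phi * psi) m l = ent (A m * B l) ?z ?z" .
    \<comment> \<open>The entry is a scalar of the source algebra; it is compared after applying
      \<open>\<tau>\<close>, where \<open>P\<close> is nonzero and can be cancelled.\<close>
    have "scale (ent (A m * B l) ?z ?z) P = \<tau> (p0 * (A m * B l) * p0)"
      by (simp add: p0_sandwich[OF SA_loc[OF AB]] tau)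
    also have "\<dots> = P * q * (row0 m * col0 l) * r * P"
      using A B AB by (simp add: tau SA_mult mult.assoc)
    also have "\<dots> = scale (if m = l then 1 else 0) P"
      by (simp add: units[OF ml] Pq qp qr P_idem)
    finally have "ent (A m * B l) ?z ?z = (if m = l then 1 else 0)"
      using P_nonzero rc.scale_right_imp_eq by blast
    then show "ent (phi * psi) m l = ent 1 m l" by (simp add: e)
  qed (intro loc_times loc_simps phi psi)+
  moreover have "phi * mx i = \<tau> (mx i) * phi" if i: "i \<in> I" for i
  proof (rule loc_eqI[of I])
    have xSA: "mx i \<in> (SA I :: 'a nmat set)" using i by (rule SA_mx)
    show "loc I (phi * mx i)" "loc I (\<tau> (mx i) * phi)"
      by (intro loc_times phi SA_loc tau_SA xSA)+
    fix m k assume mk: "m \<in> Js I" "k \<in> Js I"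
    have "ent (\<tau> (mx i) * phi) m k = ent (\<tau> (mx i) * (\<tau> (col0 k) * q)) m ?z"
      by (rule ent_times_cong_col[OF phi_col[OF mk(2)]])
    also have "\<tau> (mx i) * (\<tau> (col0 k) * q) = \<tau> (mx i * col0 k) * q"
      using xSA by (simp add: tau mult.assoc)
    also have "\<dots> = \<tau> (col0 (k(i := k i + 1))) * q" by (simp only: mx_times_me[OF i])
    also have "ent \<dots> m ?z = ent phi m (k(i := k i + 1))"
      using phi_col Js_upd[OF mk(2) i] by simp
    also have "\<dots> = ent (phi * mx i) m k" by (simp only: ent_times_mx)
    finally show "ent (phi * mx i) m k = ent (\<tau> (mx i) * phi) m k" by simp
  qed
  moreover have "phi * my i = \<tau> (my i) * phi" if i: "i \<in> I" for i
  proof (rule loc_eqI[of I])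
    have ySA: "my i \<in> (SA I :: 'a nmat set)" using i by (rule SA_my)
    show "loc I (phi * my i)" "loc I (\<tau> (my i) * phi)"
      by (intro loc_times phi SA_loc tau_SA ySA)+
    fix m k assume mk: "m \<in> Js I" "k \<in> Js I"
    have "ent (\<tau> (my i) * phi) m k = ent (\<tau> (my i) * (\<tau> (col0 k) * q)) m ?z"
      by (rule ent_times_cong_col[OF phi_col[OF mk(2)]])
    also have "\<tau> (my i) * (\<tau> (col0 k) * q) = \<tau> (my i * col0 k) * q"
      using ySA by (simp add: tau mult.assoc)
    also have "\<dots> = (if k i = 0 then 0 else \<tau> (col0 (k(i := k i - 1))) * q)"
      by (simp only: my_times_me[OF i]) (simp add: tau)
    also have "ent \<dots> m ?z = (if k i = 0 then 0 else ent phi m (k(i := k i - 1)))"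
      using phi_col Js_upd[OF mk(2) i] by simp
    also have "\<dots> = ent (phi * my i) m k" by (simp only: ent_times_my)
    finally show "ent (phi * my i) m k = ent (\<tau> (my i) * phi) m k" by simp
  qed
  ultimately show ?thesis using that phi(1) psi(1) by blast
qed

lemma inner:
  obtains u v where "u - 1 \<in> Fs {I}" "v - 1 \<in> Fs {I}" "u * v = 1" "v * u = 1"
    "\<And>i. i \<in> I \<Longrightarrow> u * mx i = \<tau> (mx i) * u" "\<And>i. i \<in> I \<Longrightarrow> u * my i = \<tau> (my i) * u"
proof -
  obtain phi psi where inv: "phi * psi = 1" "psi * phi = 1" and loc: "loc I phi" "loc I psi"
    and x: "\<And>i. i \<in> I \<Longrightarrow> phi * mx i = \<tau> (mx i) * phi"
    and y: "\<And>i. i \<in> I \<Longrightarrow> phi * my i = \<tau> (my i) * phi"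
    by (rule intertwiner) blast
  have psi_x: "mx i * psi = psi * \<tau> (mx i)" if "i \<in> I" for i
  proof -
    have "mx i * psi = psi * (phi * mx i) * psi" by (simp add: inv mult.assoc[symmetric])
    also have "\<dots> = psi * \<tau> (mx i)" by (simp add: x[OF that] inv mult.assoc)
    finally show ?thesis .
  qed
  have "\<exists>N. \<forall>m k. ent a m k \<noteq> 0 \<longrightarrow> m \<in> box I N \<and> k \<in> box I N" if "a \<in> Fs {I}" for a :: "'a nmat"
    using that unfolding Fs_single_iff[OF fin] by blast
  then have "\<forall>i\<in>I. \<exists>N. \<forall>m k. ent (\<tau> (mx i) - mx i) m k \<noteq> 0 \<longrightarrow> m \<in> box I N \<and> k \<in> box I N"
    "\<forall>i\<in>I. \<exists>N. \<forall>m k. ent (\<tau> (my i) - my i) m k \<noteq> 0 \<longrightarrow> m \<in> box I N \<and> k \<in> box I N"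
    using near by blast+
  then obtain Nx Ny where
    Nx: "\<forall>i\<in>I. \<forall>m k. ent (\<tau> (mx i) - mx i) m k \<noteq> 0 \<longrightarrow> m \<in> box I (Nx i) \<and> k \<in> box I (Nx i)" and
    Ny: "\<forall>i\<in>I. \<forall>m k. ent (\<tau> (my i) - my i) m k \<noteq> 0 \<longrightarrow> m \<in> box I (Ny i) \<and> k \<in> box I (Ny i)"
    by metis
  \<comment> \<open>One box containing the perturbations of all generators.\<close>
  define N where "N = sum Nx I + sum Ny I"
  have "Nx i \<le> N" "Ny i \<le> N" if "i \<in> I" for i
    unfolding N_def using member_le_sum[OF that, of Nx] member_le_sum[OF that, of Ny] fin
    by (auto intro: trans_le_add1 trans_le_add2)
  then have sub: "box I (Nx i) \<subseteq> box I N" "box I (Ny i) \<subseteq> box I N" if "i \<in> I" for i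
    using that unfolding box_def by (auto intro: less_le_trans)
  interpret toeplitz_pair I N phi psi
  proof
    fix i m k assume i: "i \<in> I" and "m \<in> Js I" "k \<in> Js I"
    {
      assume m: "m \<notin> box I N"
      \<comment> \<open>The rows of \<open>g\<close> outside the box vanish, so there
        \<open>phi\<close> commutes with the unperturbed \<open>my i\<close>; this is the Toeplitz
        relation. For \<open>psi\<close> the columns of the perturbation of \<open>mx i\<close> play
        the same role.\<close>
      define g where "g = \<tau> (my i) - my i"
      have "ent g m j = 0" for j using Ny i m sub(2)[OF i] unfolding g_def by blast
      then have "ent (g * phi) m k = 0"
        using ent_times_single[of g m k 0 phi k] by simp
      moreover have "phi * my i = my i * phi + g * phi"
        using y[OF i] by (simp add: g_def algebra_simps)
      ultimately have "ent (my i * phi) m k = ent (phi * my i) m k" by simp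
      then show "ent phi (m(i := m i + 1)) k = (if k i = 0 then 0 else ent phi m (k(i := k i - 1)))"
        by (simp only: ent_my_times ent_times_my)
    next
      assume k: "k \<notin> box I N"
      define f where "f = \<tau> (mx i) - mx i"
      have "ent f j k = 0" for j using Nx i k sub(1)[OF i] unfolding f_def by blast
      then have "ent (psi * f) m k = 0"
        using ent_times_single_col[of f k k 0 psi m] by simp
      moreover have "mx i * psi = psi * mx i + psi * f"
        using psi_x[OF i] by (simp add: f_def algebra_simps)
      ultimately have "ent (psi * mx i) m k = ent (mx i * psi) m k" by simp
      then show "ent psi m (k(i := k i + 1)) = (if m i = 0 then 0 else ent psi (m(i := m i - 1)) k)"
        by (simp only: ent_mx_times ent_times_mx)
    }
  qed (use fin ne inv loc in auto)
  obtain c where c: "c \<noteq> 0" "phi - scale c 1 \<in> Fs {I}" "psi - scale (inverse c) 1 \<in> Fs {I}"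
    by (rule scalar_mod_Fs)
  show ?thesis
  proof
    have "scale (inverse c) phi - 1 = scale (inverse c) (phi - scale c 1)"
      using c(1) by (simp add: rc.scale_right_diff_distrib)
    then show "scale (inverse c) phi - 1 \<in> Fs {I}" using Fs_scale[OF c(2)] by simp
    have "scale c psi - 1 = scale c (psi - scale (inverse c) 1)"
      using c(1) by (simp add: rc.scale_right_diff_distrib)
    then show "scale c psi - 1 \<in> Fs {I}" using Fs_scale[OF c(3)] by simp
  qed (use c(1) inv x y in simp_all)
qed

end

section \<open>Peeling off index sets\<close>

lift_definition diag_power :: "nat \<Rightarrow> 'a::field \<Rightarrow> 'a nmat" is "\<lambda>i c m k. if m = k then c ^ m i else 0"
proof (intro conjI allI)
  fix i and c :: 'a and j :: "nat \<Rightarrow> nat"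
  show "finite {k. (if j = k then c ^ j i else 0) \<noteq> 0}"
    by (rule finite_subset[of _ "{j}"]) auto
  show "finite {m. (if m = j then c ^ m i else 0) \<noteq> 0}"
    by (rule finite_subset[of _ "{j}"]) auto
qed

lemma ent_diag_power_times: "ent (diag_power i c * a) m k = c ^ m i * ent a m k"
  by (rule ent_times_single) (auto simp: diag_power.rep_eq)

lemma ent_times_diag_power: "ent (a * diag_power i c) m k = ent a m k * c ^ k i"
  by (rule ent_times_single_col) (auto simp: diag_power.rep_eq)

definition torus :: "nat \<Rightarrow> 'a::field \<Rightarrow> 'a nmat \<Rightarrow> 'a nmat" where
  "torus i c a = diag_power i c * a * diag_power i (inverse c)"

lemma ent_torus: "ent (torus i c a) m k = c ^ m i * ent a m k * inverse c ^ k i"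
  by (simp add: torus_def ent_times_diag_power ent_diag_power_times)

lemma torus_simps:
  assumes "c \<noteq> 0"
  shows "torus i c (a + b) = torus i c a + torus i c b" "torus i c (scale d a) = scale d (torus i c a)"
    "torus i c 1 = 1" "torus i c (a * b) = torus i c a * torus i c b"
    "torus i c (mx i) = scale c (mx i)" "torus i c (my i) = scale (inverse c) (my i)"
proof -
  have [simp]: "c ^ t * inverse c ^ t = 1" for t
    using assms by (simp flip: power_mult_distrib)
  have inv: "diag_power i (inverse c) * diag_power i c = 1"
    by (rule rcmat_eqI) (use assms in \<open>auto simp: ent_diag_power_times diag_power.rep_eq simp flip: power_mult_distrib\<close>)
  have "torus i c a * torus i c b = diag_power i c * a * (diag_power i (inverse c) * diag_power i c) * b * diag_power i (inverse c)"
    unfolding torus_def by (simp only: mult.assoc)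
  then show "torus i c (a * b) = torus i c a * torus i c b"
    by (simp add: inv torus_def mult.assoc)
  show "torus i c (mx i) = scale c (mx i)"
    by (rule rcmat_eqI) (auto simp: ent_torus ent_mx)
  show "torus i c (my i) = scale (inverse c) (my i)"
    by (rule rcmat_eqI) (auto simp: ent_torus ent_my)
qed (auto intro!: rcmat_eqI simp: ent_torus algebra_simps simp flip: power_mult_distrib, use assms in simp)

lemma torus_me:
  assumes "c \<noteq> 0"
  shows "torus i c (me J \<alpha> \<beta>) = (if i \<in> J then scale (c ^ \<alpha> i * inverse c ^ \<beta> i) (me J \<alpha> \<beta>) else me J \<alpha> \<beta>)"
proof (rule rcmat_eqI)
  fix m k
  have "c ^ t * inverse c ^ t = 1" for t
    using assms by (simp flip: power_mult_distrib)
  then show "ent (torus i c (me J \<alpha> \<beta>)) m k =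
      ent (if i \<in> J then scale (c ^ \<alpha> i * inverse c ^ \<beta> i) (me J \<alpha> \<beta>) else me J \<alpha> \<beta>) m k"
    by (auto simp: ent_torus ent_me)
qed

text \<open>A unit \<open>me J\<close> is fixed if \<open>i \<notin> J\<close> and scaled if
  \<open>i \<in> J\<close>; in the second case its limit is 0 because \<open>i \<notin> I\<close>.
  Limits of perturbations are therefore independent of \<open>c\<close>.\<close>

lemma torus_Fs:
  fixes f :: "'a::field nmat"
  assumes "c \<noteq> 0" "f \<in> Fs \<C>" "\<And>J. J \<in> \<C> \<Longrightarrow> finite J" "i \<notin> I"
  shows "torus i c f \<in> Fs \<C> \<and> plim I (torus i c f) = plim I f"
  using assms(2)
proof (induction rule: Fs_induct)
  case zero
  have "torus i c (0 :: 'a nmat) = 0" by (simp add: torus_def)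
  then show ?case by (simp only: Fs_zero)
next
  case (unit J \<alpha> \<beta>)
  have J: "finite J" using unit assms by blast
  have me: "me J \<alpha> \<beta> \<in> (SA UNIV :: 'a nmat set)" by (rule me_in_SA[OF J]) simp
  show ?case
  proof (cases "i \<in> J")
    case True
    then have "plim I (me J \<alpha> \<beta>) = (0 :: 'a nmat)" using assms(4) J by (auto simp: plim_me)
    then show ?thesis
      using True unit by (auto simp: torus_me[OF assms(1)] plim_scale[OF me] Fs_scale me_in_Fs)
  next
    case False
    then show ?thesis using unit by (simp add: torus_me[OF assms(1)] me_in_Fs)
  qed
next
  case (add a b)
  have "Fs \<C> \<subseteq> (SA UNIV :: 'a nmat set)" by (rule Fs_subset_SA) (use assms in auto)
  then have SA: "a \<in> SA UNIV" "b \<in> SA UNIV" "torus i c a \<in> SA UNIV" "torus i c b \<in> SA UNIV"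
    using add by blast+
  with add show ?case by (simp add: torus_simps[OF assms(1)] plim_hom Fs_add)
next
  case (scale d a)
  have "Fs \<C> \<subseteq> (SA UNIV :: 'a nmat set)" by (rule Fs_subset_SA) (use assms in auto)
  then have SA: "a \<in> SA UNIV" "torus i c a \<in> SA UNIV" using scale by blast+
  with scale show ?case by (simp add: torus_simps[OF assms(1)] plim_scale[OF SA(1)] plim_scale[OF SA(2)] Fs_scale)
qed

text \<open>Conjugating by the torus element with parameter \<open>c\<close> and taking limits turns the relation into
  \<open>(1/c + b) (c + a) = 1\<close>, with \<open>a\<close> and \<open>b\<close> independent of \<open>c\<close>.\<close>

lemma plim_perturbation_zero:
  fixes f g :: "'a::field_char_0 nmat"
  assumes "f \<in> Fs \<C>" "g \<in> Fs \<C>" "\<And>J. J \<in> \<C> \<Longrightarrow> finite J" "i \<notin> I"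
    and yx: "(my i + g) * (mx i + f) = 1"
  shows "plim I f = 0" "plim I g = 0"
proof -
  define a b where "a = plim I f" and "b = plim I g"
  have SA: "Fs \<C> \<subseteq> (SA UNIV :: 'a nmat set)" by (rule Fs_subset_SA) (use assms in auto)
  have gen: "mx i \<in> (SA UNIV :: 'a nmat set)" "my i \<in> (SA UNIV :: 'a nmat set)"
    by (auto intro: SA_mx SA_my)
  have rel: "scale (inverse c) a + scale c b + b * a = 0" if "c \<noteq> 0" for c
  proof -
    have tf: "torus i c f \<in> SA UNIV" "plim I (torus i c f) = a"
      and tg: "torus i c g \<in> SA UNIV" "plim I (torus i c g) = b"
      using torus_Fs[OF that assms(1,3,4)] torus_Fs[OF that assms(2,3,4)] SA by (auto simp: a_def b_def)
    have "torus i c ((my i + g) * (mx i + f)) = 1"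
      unfolding yx by (rule torus_simps[OF that])
    then have "(scale (inverse c) (my i) + torus i c g) * (scale c (mx i) + torus i c f) = 1"
      by (simp only: torus_simps[OF that])
    then have "plim I ((scale (inverse c) (my i) + torus i c g) * (scale c (mx i) + torus i c f)) = 1"
      using plim_self[OF SA_one, of I] by simp
    also have "plim I ((scale (inverse c) (my i) + torus i c g) * (scale c (mx i) + torus i c f))
        = (scale (inverse c) 1 + b) * (scale c 1 + a)"
      using tf tg gen by (simp add: plim_hom plim_scale plim_gen[OF assms(4)] SA_add SA_scale)
    also have "\<dots> = 1 + (scale (inverse c) a + scale c b + b * a)"
      using that by (simp add: algebra_simps)
    finally show ?thesis by simp
  qed
  have z: "ent a m k = 0 \<and> ent b m k = 0" for m k
  proof -
    let ?a = "ent a m k" and ?b = "ent b m k" and ?c = "ent (b * a) m k"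
    \<comment> \<open>The parameters 1 and -1 add up to \<open>2 * ?c = 0\<close>, whence
      \<open>?b = - ?a\<close>; the parameter 2 then gives \<open>3 * ?a = 0\<close>.\<close>
    have 1: "?a + ?b + ?c = 0" using arg_cong[OF rel[of 1], of "\<lambda>x. ent x m k"] by simp
    have 2: "- ?a + - ?b + ?c = 0" using arg_cong[OF rel[of "- 1"], of "\<lambda>x. ent x m k"] by simp
    have 3: "inverse 2 * ?a + 2 * ?b + ?c = 0" using arg_cong[OF rel[of 2], of "\<lambda>x. ent x m k"] by simp
    have "2 * ?c = (?a + ?b + ?c) + (- ?a + - ?b + ?c)" by simp
    then have c: "?c = 0" unfolding 1 2 by simp
    then have b: "?b = - ?a" using 1 by (metis add.commute add.right_neutral minus_unique)
    have "inverse 2 * ?a = 2 * ?a" using 3 unfolding b c by simp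
    then have "2 * (inverse 2 * ?a) = 2 * (2 * ?a)" by (rule arg_cong)
    then have "?a = 4 * ?a" by (simp only: mult.assoc[symmetric]) simp
    then have "(4 - 1) * ?a = 0" by (simp only: left_diff_distrib) simp
    then show ?thesis using b by simp
  qed
  have "a = 0" "b = 0" by (rule rcmat_eqI; simp add: z)+
  then show "plim I f = 0" "plim I g = 0" by (simp_all add: a_def b_def)
qed

text \<open>No set contains a later one, so \<open>plim\<close> for the head kills the spans of all
  later sets. Upward closure inside \<open>V\<close> gives closure under unions, hence closure of
  the span under products. Both properties pass to the tail.\<close>

definition peelable :: "nat set \<Rightarrow> nat set list \<Rightarrow> bool" where
  "peelable V Is \<longleftrightarrow> sorted_wrt (\<lambda>I J. \<not> J \<subseteq> I) Is \<and> set Is \<subseteq> Pow V \<and>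
     (\<forall>I\<in>set Is. \<forall>J. I \<subseteq> J \<and> J \<subseteq> V \<longrightarrow> J \<in> set Is)"

lemma peelable_Cons:
  assumes "peelable V (I # Is)"
  shows "peelable V Is" "I \<subseteq> V" "\<And>J. J \<in> set Is \<Longrightarrow> J \<subseteq> V \<and> \<not> J \<subseteq> I" "I \<notin> set Is"
proof -
  have *: "\<forall>J\<in>set Is. \<not> J \<subseteq> I" "sorted_wrt (\<lambda>I J. \<not> J \<subseteq> I) Is" "I \<subseteq> V" "set Is \<subseteq> Pow V"
    "\<And>K J. K \<in> set Is \<Longrightarrow> K \<subseteq> J \<Longrightarrow> J \<subseteq> V \<Longrightarrow> J = I \<or> J \<in> set Is"
    using assms unfolding peelable_def by simp_all
  show "I \<subseteq> V" "\<And>J. J \<in> set Is \<Longrightarrow> J \<subseteq> V \<and> \<not> J \<subseteq> I" "I \<notin> set Is" using * by blast+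
  have "J \<in> set Is" if "K \<in> set Is" "K \<subseteq> J" "J \<subseteq> V" for K J
    using *(5)[OF that] *(1) that by blast
  then show "peelable V Is" unfolding peelable_def using *(2,4) by blast
qed

lemma peelable_Un: "peelable V Is \<Longrightarrow> I \<in> set Is \<Longrightarrow> J \<in> set Is \<Longrightarrow> I \<union> J \<in> set Is"
  unfolding peelable_def by (metis Pow_iff Un_least Un_upper1 subsetD)

section \<open>Units congruent to 1 and the removal of one index set\<close>

definition munits :: "nat set set \<Rightarrow> 'a::field nmat set" where
  "munits \<C> = {u. u - 1 \<in> Fs \<C> \<and> (\<exists>v. v - 1 \<in> Fs \<C> \<and> u * v = 1 \<and> v * u = 1)}"

lemma munits_cases:
  assumes "u \<in> munits \<C>"
  obtains v where "v \<in> munits \<C>" "u - 1 \<in> Fs \<C>" "v - 1 \<in> Fs \<C>" "u * v = 1" "v * u = 1"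
  using assms unfolding munits_def by blast

lemma munits_one: "1 \<in> munits \<C>"
  unfolding munits_def by (auto simp: Fs_zero intro!: exI[of _ 1])

lemma one_plus_Fs_times:
  assumes "a - 1 \<in> Fs \<C>" "b - 1 \<in> Fs \<C>" "\<And>I J. I \<in> \<C> \<Longrightarrow> J \<in> \<C> \<Longrightarrow> I \<union> J \<in> \<C>"
  shows "a * b - 1 \<in> Fs \<C>"
proof -
  have "a * b - 1 = (a - 1) * (b - 1) + (a - 1) + (b - 1)" by (simp add: algebra_simps)
  also have "\<dots> \<in> Fs \<C>" by (intro Fs_add Fs_times[OF assms(1,2)] assms)
  finally show ?thesis .
qed

lemma times_inverse:
  fixes a b :: "'b::monoid_mult"
  assumes "a * a' = 1" "b * b' = 1"
  shows "(a * b) * (b' * a') = 1"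
proof -
  have "(a * b) * (b' * a') = a * (b * b') * a'" by (simp only: mult.assoc)
  then show ?thesis using assms by simp
qed

lemma munits_times:
  assumes "u \<in> munits \<C>" "w \<in> munits \<C>" "\<And>I J. I \<in> \<C> \<Longrightarrow> J \<in> \<C> \<Longrightarrow> I \<union> J \<in> \<C>"
  shows "u * w \<in> munits \<C>"
proof -
  obtain u' where u': "u - 1 \<in> Fs \<C>" "u' - 1 \<in> Fs \<C>" "u * u' = 1" "u' * u = 1"
    using munits_cases[OF assms(1)] by blast
  obtain w' where w': "w - 1 \<in> Fs \<C>" "w' - 1 \<in> Fs \<C>" "w * w' = 1" "w' * w = 1"
    using munits_cases[OF assms(2)] by blast
  have "(u * w) * (w' * u') = 1" "(w' * u') * (u * w) = 1"
    by (intro times_inverse u' w')+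
  then show ?thesis
    unfolding munits_def using one_plus_Fs_times[OF u'(1) w'(1) assms(3)]
      one_plus_Fs_times[OF w'(2) u'(2) assms(3)] by blast
qed

lemma munits_mono: "\<C> \<subseteq> \<D> \<Longrightarrow> munits \<C> \<subseteq> munits \<D>"
  unfolding munits_def using Fs_mono[of \<C> \<D>] by blast

lemma one_plus_Fs_SA:
  assumes "u - 1 \<in> Fs \<C>" "\<And>I. I \<in> \<C> \<Longrightarrow> finite I \<and> I \<subseteq> V"
  shows "u \<in> SA V"
proof -
  have "u - 1 \<in> SA V" using Fs_subset_SA[of \<C> V] assms by blast
  from SA_add[OF this SA_one] show ?thesis by simp
qed

lemma one_plus_Fs_commutator:
  assumes "u - 1 \<in> Fs \<C>"
  shows "mx i * u - u * mx i \<in> Fs \<C>" "my i * u - u * my i \<in> Fs \<C>"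
  using Fs_commutator_mx[OF assms, of i] Fs_commutator_my[OF assms, of i] by (simp_all add: algebra_simps)

lemma conj_alg_hom:
  assumes "alg_hom S \<sigma>" "u * v = 1" "v * u = 1"
  shows "alg_hom S (\<lambda>a. v * \<sigma> a * u)"
proof -
  have "v * (x * y) * u = (v * x * u) * (v * y * u)" for x y
  proof -
    have "(v * x * u) * (v * y * u) = v * x * (u * v) * y * u" by (simp only: mult.assoc)
    then show ?thesis using assms(2) by (simp add: mult.assoc)
  qed
  then show ?thesis
    using assms unfolding alg_hom_def by (simp add: distrib_left distrib_right)
qed

lemma conj_surj:
  fixes \<sigma> :: "'a::comm_ring_1 nmat \<Rightarrow> 'a nmat"
  assumes "\<sigma> ` SA V = SA V" "u * v = 1" "v * u = 1" "u \<in> SA V" "v \<in> SA V"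
  shows "(\<lambda>a. v * \<sigma> a * u) ` SA V = SA V"
proof
  show "(\<lambda>a. v * \<sigma> a * u) ` SA V \<subseteq> SA V"
    using assms by (auto intro!: SA_mult)
  show "SA V \<subseteq> (\<lambda>a. v * \<sigma> a * u) ` SA V"
  proof
    fix b :: "'a nmat" assume "b \<in> SA V"
    then have "u * b * v \<in> SA V" using assms by (intro SA_mult)
    then obtain a where a: "a \<in> SA V" "\<sigma> a = u * b * v" using assms(1) by (metis imageE)
    have "v * (u * b * v) * u = (v * u) * b * (v * u)" by (simp only: mult.assoc)
    then have "b = v * \<sigma> a * u" using a assms(3) by simp
    then show "b \<in> (\<lambda>a. v * \<sigma> a * u) ` SA V" using a by blast
  qed
qed

lemma plim_one_plus_Fs:
  assumes "u - 1 \<in> Fs {J}" "finite J" "\<not> J \<subseteq> I"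
  shows "plim I u = 1"
proof -
  have "plim I (u - 1) \<in> Fs {K \<in> {J}. K \<subseteq> I}"
    using plim_Fs[OF assms(1)] assms(2) by blast
  moreover have "{K \<in> {J}. K \<subseteq> I} = {}" using assms(3) by blast
  ultimately have "plim I (u - 1) = 0" by (simp only: Fs_empty singleton_iff)
  moreover have "u \<in> SA UNIV" by (rule one_plus_Fs_SA[OF assms(1)]) (use assms in auto)
  ultimately show ?thesis by (simp add: plim_hom SA_one plim_self)
qed

text \<open>Modulo all later sets, \<sigma> is seen through \<open>plim I \<circ> \<sigma>\<close>
  on the variables in \<open>I\<close>, where \<open>inner\<close> provides the conjugating unit.
  After conjugation the perturbation has limit 0 and so has lost its F(I) component.\<close>

lemma peel_step:
  fixes \<sigma> :: "'a::field_char_0 nmat \<Rightarrow> 'a nmat"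
  assumes V: "finite V" and p: "peelable V (I # Is)"
    and hom: "alg_hom (SA V) \<sigma>" and surj: "\<sigma> ` SA V = SA V"
    and near: "\<And>i. i \<in> V \<Longrightarrow> \<sigma> (mx i) - mx i \<in> Fs (set (I # Is))"
      "\<And>i. i \<in> V \<Longrightarrow> \<sigma> (my i) - my i \<in> Fs (set (I # Is))"
  obtains u v where "u - 1 \<in> Fs ({I} - {{}})" "v - 1 \<in> Fs ({I} - {{}})" "u * v = 1" "v * u = 1"
    "\<And>i. i \<in> V \<Longrightarrow> v * \<sigma> (mx i) * u - mx i \<in> Fs (set Is)"
    "\<And>i. i \<in> V \<Longrightarrow> v * \<sigma> (my i) * u - my i \<in> Fs (set Is)"
proof -
  have IV: "I \<subseteq> V" and rest: "\<And>J. J \<in> set Is \<Longrightarrow> J \<subseteq> V \<and> \<not> J \<subseteq> I"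
    using peelable_Cons[OF p] by blast+
  have finI: "finite I" using finite_subset[OF IV V] .
  have finIs: "finite J" if "J \<in> set (I # Is)" for J
    using that rest finI finite_subset[OF _ V] by auto
  have only_I: "{J \<in> set (I # Is). J \<subseteq> I} = {I}" using rest by auto
  have sSA: "\<sigma> a \<in> SA UNIV" if "a \<in> SA V" for a
    using surj that SA_UNIV by blast
  have genV: "mx i \<in> (SA V :: 'a nmat set)" "my i \<in> (SA V :: 'a nmat set)" if "i \<in> V" for i
    using that by (auto intro: SA_mx SA_my)
  have gen: "mx i \<in> (SA UNIV :: 'a nmat set)" "my i \<in> (SA UNIV :: 'a nmat set)" for i
    by (auto intro: SA_mx SA_my)
  have plim1: "plim I 1 = (1 :: 'a nmat)" by (rule plim_self[OF SA_one])
  have outer: "plim I (\<sigma> (mx i)) = 1 \<and> plim I (\<sigma> (my i)) = 1" if i: "i \<in> V" "i \<notin> I" for i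
  proof -
    define f g where "f = \<sigma> (mx i) - mx i" and "g = \<sigma> (my i) - my i"
    have "\<sigma> (my i) * \<sigma> (mx i) = \<sigma> (my i * mx i)"
      by (rule alg_homD(3)[OF hom genV(2)[OF i(1)] genV(1)[OF i(1)], symmetric])
    then have "(my i + g) * (mx i + f) = 1"
      using alg_homD(1)[OF hom] by (simp add: f_def g_def)
    then have "plim I f = 0" "plim I g = 0"
      using plim_perturbation_zero[of f "set (I # Is)" g i I] near[OF i(1)] finIs i(2)
      unfolding f_def g_def by blast+
    then show ?thesis
      using gen sSA genV[OF i(1)] by (simp add: f_def g_def plim_hom plim_gen[OF i(2)])
  qed
  \<comment> \<open>For \<open>I = {}\<close> the span over \<open>{I} - {{}}\<close> is zero and
    \<open>u = v = 1\<close>; \<open>outer\<close> already shows that there are no constant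
    terms.\<close>
  have ex: "\<exists>u v. u - 1 \<in> Fs ({I} - {{}}) \<and> v - 1 \<in> Fs ({I} - {{}}) \<and> u * v = 1 \<and> v * u = 1 \<and>
      (\<forall>i\<in>I. u * mx i = plim I (\<sigma> (mx i)) * u \<and> u * my i = plim I (\<sigma> (my i)) * u)"
  proof (cases "I = {}")
    case True
    then show ?thesis by (intro exI[of _ 1]) (simp add: Fs_zero)
  next
    case False
    have SAI: "SA I \<subseteq> (SA V :: 'a nmat set)" by (rule SA_mono[OF IV])
    have homV: "alg_hom (SA V) (\<lambda>a. plim I (\<sigma> a))"
      using hom sSA plim1 unfolding alg_hom_def by (simp add: plim_hom plim_scale)
    then have homI: "alg_hom (SA I) (\<lambda>a. plim I (\<sigma> a))"
      using SAI unfolding alg_hom_def by blast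
    have pV: "plim I c \<in> SA I" "plim I c \<in> SA V" if "c \<in> SA V" for c :: "'a nmat"
      using plim_in_SA[OF that, of I] SA_mono[of "V \<inter> I"] by blast+
    interpret near_identity I "\<lambda>a. plim I (\<sigma> a)"
    proof
      show "(\<lambda>a. plim I (\<sigma> a)) ` SA I = SA I"
      proof
        show "(\<lambda>a. plim I (\<sigma> a)) ` SA I \<subseteq> SA I"
          using SAI pV surj by blast
        show "SA I \<subseteq> (\<lambda>a. plim I (\<sigma> a)) ` SA I"
        proof
          fix a :: "'a nmat" assume a: "a \<in> SA I"
          then have "a \<in> \<sigma> ` SA V" unfolding surj by (rule subsetD[OF SAI])
          then obtain c where c: "c \<in> SA V" "\<sigma> c = a" by (metis imageE)
          \<comment> \<open>Surjectivity descends to the variables in \<open>I\<close>: a preimage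
            \<open>c\<close> may involve other variables, but \<open>plim I \<circ> \<sigma>\<close>
            does not distinguish it from \<open>plim I c\<close>, as by \<open>outer\<close> the
            other generators go to 1.\<close>
          have "plim I (\<sigma> (plim I c)) = plim I (\<sigma> c)"
          proof (rule alg_hom_eqI[OF _ homV _ _ c(1)])
            show "alg_hom (SA V) (\<lambda>c. plim I (\<sigma> (plim I c)))"
              using homV pV plim1 unfolding alg_hom_def
              by (simp add: plim_hom[OF SA_UNIV[of _ V] SA_UNIV[of _ V]] plim_scale[OF SA_UNIV[of _ V]])
            show "plim I (\<sigma> (plim I (mx i))) = plim I (\<sigma> (mx i))"
              "plim I (\<sigma> (plim I (my i))) = plim I (\<sigma> (my i))" if "i \<in> V" for i
            proof -
              show "plim I (\<sigma> (plim I (mx i))) = plim I (\<sigma> (mx i))"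
                using outer[OF that] alg_homD(1)[OF hom] plim1
                by (cases "i \<in> I") (simp_all add: plim_gen plim_self[OF SA_mx])
              show "plim I (\<sigma> (plim I (my i))) = plim I (\<sigma> (my i))"
                using outer[OF that] alg_homD(1)[OF hom] plim1
                by (cases "i \<in> I") (simp_all add: plim_gen plim_self[OF SA_my])
            qed
          qed
          then have "a = plim I (\<sigma> (plim I c))" using c(2) plim_self[OF a] by simp
          then show "a \<in> (\<lambda>a. plim I (\<sigma> a)) ` SA I" using pV(1)[OF c(1)] by blast
        qed
      qed
      show "plim I (\<sigma> (mx i)) - mx i \<in> Fs {I}" "plim I (\<sigma> (my i)) - my i \<in> Fs {I}" if i: "i \<in> I" for i
      proof -
        have iV: "i \<in> V" using i IV by blast
        have "plim I (\<sigma> (mx i) - mx i) \<in> Fs {I}" "plim I (\<sigma> (my i) - my i) \<in> Fs {I}"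
          using plim_Fs[OF near(1)[OF iV], of I] plim_Fs[OF near(2)[OF iV], of I] finIs
          unfolding only_I by blast+
        then show "plim I (\<sigma> (mx i)) - mx i \<in> Fs {I}" "plim I (\<sigma> (my i)) - my i \<in> Fs {I}"
          using gen sSA genV[OF iV] by (simp_all add: plim_hom plim_self[OF SA_mx[OF i]] plim_self[OF SA_my[OF i]])
      qed
    qed (use finI False homI in auto)
    have "{I} - {{}} = {I}" using False by auto
    then show ?thesis using inner by metis
  qed
  obtain u v where uv: "u - 1 \<in> Fs ({I} - {{}})" "v - 1 \<in> Fs ({I} - {{}})" "u * v = 1" "v * u = 1"
    and com: "\<forall>i\<in>I. u * mx i = plim I (\<sigma> (mx i)) * u \<and> u * my i = plim I (\<sigma> (my i)) * u"
    using ex by blast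
  have sub: "Fs ({I} - {{}}) \<subseteq> (Fs (set (I # Is)) :: 'a nmat set)" by (rule Fs_mono) auto
  have uvSA: "u \<in> SA I" "v \<in> SA I"
    by (rule one_plus_Fs_SA[OF uv(1)] one_plus_Fs_SA[OF uv(2)]; use finI in auto)+
  have times: "a * b \<in> Fs (set (I # Is))" if "a \<in> Fs (set (I # Is))" "b \<in> Fs (set (I # Is))" for a b :: "'a nmat"
    by (rule Fs_times[OF that]) (use peelable_Un[OF p] in blast)
  have key: "v * \<sigma> x * u - x \<in> Fs (set Is)"
    if x: "x \<in> SA V" and fx: "\<sigma> x - x \<in> Fs (set (I # Is))" and cx: "x * u - u * x \<in> Fs ({I} - {{}})"
      and px: "plim I (\<sigma> x) * u = u * plim I x" for x
  proof (rule Fs_peel[of _ I])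
    have "v * \<sigma> x * u - x = v * \<sigma> x * u - (v * u) * x" using uv by simp
    also have "\<dots> = (\<sigma> x * u - u * x) + (v - 1) * (\<sigma> x * u - u * x)"
      by (simp add: left_diff_distrib right_diff_distrib mult.assoc)
    finally have eq: "v * \<sigma> x * u - x = (\<sigma> x * u - u * x) + (v - 1) * (\<sigma> x * u - u * x)" .
    \<comment> \<open>The span is closed under products but need not be closed under multiplication
      by a generator; the splitting confines bare \<open>x\<close> to its commutator with
      \<open>u\<close>.\<close>
    have e: "\<sigma> x * u - u * x = ((\<sigma> x - x) + (\<sigma> x - x) * (u - 1)) + (x * u - u * x)"
      by (simp add: algebra_simps)
    have w: "\<sigma> x * u - u * x \<in> Fs (set (I # Is))"
      unfolding e by (intro Fs_add times fx subsetD[OF sub] cx uv)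
    have "v * \<sigma> x * u - x \<in> Fs (set (I # Is))"
      unfolding eq by (intro Fs_add times w subsetD[OF sub] uv)
    then show "v * \<sigma> x * u - x \<in> Fs (insert I (set Is))" by simp
    have "plim I (v * \<sigma> x * u - x) = v * plim I (\<sigma> x) * u - plim I x"
      using uvSA uvSA[THEN SA_UNIV] SA_UNIV[OF x] sSA[OF x] by (simp add: plim_hom SA_mult plim_self)
    also have "\<dots> = v * (u * plim I x) - plim I x" by (simp only: mult.assoc px)
    also have "\<dots> = 0" by (simp add: mult.assoc[symmetric] uv)
    finally show "plim I (v * \<sigma> x * u - x) = 0" .
  qed (use finI finIs rest in auto)
  show ?thesis
  proof
    fix i assume i: "i \<in> V"
    have "plim I (\<sigma> (mx i)) * u = u * plim I (mx i)" "plim I (\<sigma> (my i)) * u = u * plim I (my i)"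
      using com outer[OF i] by (cases "i \<in> I"; simp add: plim_gen plim_self[OF SA_mx] plim_self[OF SA_my])+
    then show "v * \<sigma> (mx i) * u - mx i \<in> Fs (set Is)" "v * \<sigma> (my i) * u - my i \<in> Fs (set Is)"
      using key genV[OF i] near[OF i] one_plus_Fs_commutator[OF uv(1)] by blast+
  qed (use uv in auto)
qed

text \<open>The induction hypothesis is applied to the conjugated map, whose perturbation lies in
  the sum over the tail. Once the list is exhausted the map fixes all generators.\<close>

theorem near_identity_inner:
  fixes \<sigma> :: "'a::field_char_0 nmat \<Rightarrow> 'a nmat"
  assumes "finite V" "peelable V Is" "alg_hom (SA V) \<sigma>" "\<sigma> ` SA V = SA V"
    and "\<And>i. i \<in> V \<Longrightarrow> \<sigma> (mx i) - mx i \<in> Fs (set Is)"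
      "\<And>i. i \<in> V \<Longrightarrow> \<sigma> (my i) - my i \<in> Fs (set Is)"
  shows "\<exists>u v. u - 1 \<in> Fs (set Is - {{}}) \<and> v - 1 \<in> Fs (set Is - {{}}) \<and> u * v = 1 \<and> v * u = 1 \<and>
     (\<forall>a\<in>SA V. \<sigma> a = u * a * v)"
  using assms(2-)
proof (induction Is arbitrary: \<sigma>)
  case Nil
  have "alg_hom (SA V) (\<lambda>a :: 'a nmat. a)" by (simp add: alg_hom_def)
  then have "\<sigma> a = a" if "a \<in> SA V" for a
    using alg_hom_eqI[OF Nil(2) _ _ _ that] Nil(4,5) by (simp add: Fs_empty)
  then show ?case by (intro exI[of _ 1]) (auto simp: Fs_zero)
next
  case (Cons I Is)
  obtain u v where uv: "u - 1 \<in> Fs ({I} - {{}})" "v - 1 \<in> Fs ({I} - {{}})" "u * v = 1" "v * u = 1"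
    and near: "\<And>i. i \<in> V \<Longrightarrow> v * \<sigma> (mx i) * u - mx i \<in> Fs (set Is)"
      "\<And>i. i \<in> V \<Longrightarrow> v * \<sigma> (my i) * u - my i \<in> Fs (set Is)"
    using peel_step[OF assms(1) Cons.prems] by blast
  have "I \<subseteq> V" using peelable_Cons[OF Cons.prems(1)] by blast
  then have SA: "u \<in> SA V" "v \<in> SA V"
    using one_plus_Fs_SA[OF uv(1), of V] one_plus_Fs_SA[OF uv(2), of V] finite_subset[OF _ assms(1)] by auto
  obtain u' v' where u'v': "u' - 1 \<in> Fs (set Is - {{}})" "v' - 1 \<in> Fs (set Is - {{}})" "u' * v' = 1" "v' * u' = 1"
    and s: "\<forall>a\<in>SA V. v * \<sigma> a * u = u' * a * v'"
    using Cons.IH[OF peelable_Cons(1)[OF Cons.prems(1)] conj_alg_hom[OF Cons.prems(2) uv(3,4)]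
        conj_surj[OF Cons.prems(3) uv(3,4) SA] near] by blast
  let ?C = "set (I # Is) - {{}}"
  have un: "J \<union> K \<in> ?C" if "J \<in> ?C" "K \<in> ?C" for J K
    using that peelable_Un[OF Cons.prems(1)] by blast
  have "Fs ({I} - {{}}) \<subseteq> (Fs ?C :: 'a nmat set)" "Fs (set Is - {{}}) \<subseteq> (Fs ?C :: 'a nmat set)"
    by (rule Fs_mono; auto)+
  then have "u * u' - 1 \<in> Fs ?C" "v' * v - 1 \<in> Fs ?C"
    using one_plus_Fs_times[of u ?C u'] one_plus_Fs_times[of v' ?C v] un uv u'v' by blast+
  moreover have "(u * u') * (v' * v) = 1" "(v' * v) * (u * u') = 1"
    by (intro times_inverse uv u'v')+
  moreover have "\<sigma> a = (u * u') * a * (v' * v)" if "a \<in> SA V" for a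
  proof -
    have "\<sigma> a = (u * v) * \<sigma> a * (u * v)" using uv by simp
    also have "\<dots> = u * (v * \<sigma> a * u) * v" by (simp only: mult.assoc)
    also have "\<dots> = (u * u') * a * (v' * v)" using s that by (simp add: mult.assoc)
    finally show ?thesis .
  qed
  ultimately show ?case by blast
qed

section \<open>Factorisation of units and the kernel of conjugation\<close>

lemma my_power_mx_power: "my i ^ N * mx i ^ N = (1 :: 'a::comm_ring_1 nmat)"
proof (induction N)
  case (Suc N)
  have "my i ^ Suc N * mx i ^ Suc N = my i ^ N * (my i * mx i) * (mx i ^ N :: 'a nmat)"
    by (simp only: power_Suc2[of "my i"] power_Suc[of "mx i"] mult.assoc)
  then show ?case using Suc by simp
qed simp

lemma ent_times_mx_power: "ent (a * mx i ^ r) m k = ent a m (k(i := k i + r))"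
proof (induction r arbitrary: k)
  case (Suc r)
  have e: "(k(i := k i + 1))(i := (k(i := k i + 1)) i + r) = k(i := k i + Suc r)"
    by (auto simp: fun_eq_iff)
  have "ent (a * mx i ^ Suc r) m k = ent (a * mx i ^ r) m (k(i := k i + 1))"
    by (simp only: power_Suc2 mult.assoc[symmetric] ent_times_mx)
  then show ?case unfolding Suc e .
qed simp

text \<open>For large \<open>N\<close>, \<open>b * mx i ^ N\<close> reads columns of
  \<open>b\<close> outside its box and vanishes. Commutation turns this into
  \<open>mx i ^ N * b = 0\<close>, and \<open>my i ^ N\<close> cancels the power.\<close>

lemma commuting_finite_zero:
  assumes "b \<in> Fs {I}" "finite I" "i \<in> I" "b * mx i = mx i * b"
  shows "b = 0"
proof -
  obtain N where N: "\<And>m k. ent b m k \<noteq> 0 \<Longrightarrow> m \<in> box I N \<and> k \<in> box I N"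
    using assms(1) unfolding Fs_single_iff[OF assms(2)] by blast
  have "b * mx i ^ N = 0"
  proof (rule rcmat_eqI)
    fix m k
    have "k(i := k i + N) \<notin> box I N" using assms(3) by (auto simp: box_def)
    then show "ent (b * mx i ^ N) m k = ent 0 m k" unfolding ent_times_mx_power using N by auto
  qed
  moreover have "b * mx i ^ r = mx i ^ r * b" for r
    using assms(4) by (induction r) (simp_all add: mult.assoc, metis mult.assoc)
  ultimately have "my i ^ N * (mx i ^ N * b) = 0" by (metis mult_zero_right)
  then show ?thesis by (simp add: mult.assoc[symmetric] my_power_mx_power)
qed

text \<open>The limit of \<open>a\<close> at the head \<open>I\<close> is a finite matrix commuting
  with \<open>mx i\<close> for \<open>i \<in> I\<close>, hence 0. Such an \<open>i\<close> exists
  because \<open>{}\<close> is excluded.\<close>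

lemma commuting_zero:
  assumes "finite V" "peelable V Is" "{} \<notin> set Is" "a \<in> Fs (set Is)" "\<And>i. i \<in> V \<Longrightarrow> a * mx i = mx i * a"
  shows "a = 0"
  using assms(2-4)
proof (induction Is)
  case Nil
  then show ?case by (simp add: Fs_empty)
next
  case (Cons I Is)
  have IV: "I \<subseteq> V" and rest: "\<And>J. J \<in> set Is \<Longrightarrow> J \<subseteq> V \<and> \<not> J \<subseteq> I"
    using peelable_Cons[OF Cons.prems(1)] by blast+
  have finI: "finite I" using finite_subset[OF IV assms(1)] .
  have finIs: "finite J" if "J \<in> set (I # Is)" for J
    using that rest finI finite_subset[OF _ assms(1)] by auto
  have "{J \<in> set (I # Is). J \<subseteq> I} = {I}" using rest by auto
  then have b: "plim I a \<in> Fs {I}"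
    using plim_Fs[OF Cons.prems(3), of I] finIs by metis
  have aSA: "a \<in> SA UNIV"
    using Fs_subset_SA[of "set (I # Is)" UNIV] finIs Cons.prems(3) by blast
  obtain i where i: "i \<in> I" using Cons.prems(2) by fastforce
  have "plim I (a * mx i) = plim I (mx i * a)" using assms(5) i IV by auto
  then have "plim I a * mx i = mx i * plim I a"
    using aSA by (simp add: plim_hom SA_mx plim_self[OF SA_mx[OF i]])
  then have "plim I a = 0" by (rule commuting_finite_zero[OF b finI i])
  moreover have "finite J \<and> \<not> J \<subseteq> I" if "J \<in> set Is" for J
    using that finIs rest by simp
  moreover have "a \<in> Fs (insert I (set Is))" using Cons.prems(3) by simp
  ultimately have "a \<in> Fs (set Is)" using Fs_peel finI by metis
  then show ?case using Cons.IH peelable_Cons(1)[OF Cons.prems(1)] Cons.prems(2) by simp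
qed

lemma plim_prod_rest:
  assumes "\<And>J. J \<in> set Is \<Longrightarrow> finite J \<and> \<not> J \<subseteq> I \<and> h J \<in> munits {J}"
  shows "prod_list (map h Is) \<in> SA UNIV \<and> plim I (prod_list (map h Is)) = 1"
  using assms
proof (induction Is)
  case Nil
  show ?case by (simp add: SA_one plim_self)
next
  case (Cons J Is)
  have J: "h J - 1 \<in> Fs {J}" "finite J" "\<not> J \<subseteq> I" using Cons.prems by (auto simp: munits_def)
  have "h J \<in> SA UNIV" by (rule one_plus_Fs_SA[OF J(1)]) (use J in auto)
  then show ?case
    using Cons plim_one_plus_Fs[OF J] by (simp add: plim_hom SA_mult)
qed

text \<open>The first factor is \<open>u = plim I w\<close>, with inverse
  \<open>v = plim I w'\<close>. Then \<open>v * w\<close> and its inverse \<open>w' * u\<close> have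
  limit 1, so they have no F(I) component and form a unit for the tail.\<close>

lemma munits_factorisation:
  assumes "finite V" "peelable V Is" "w \<in> munits (set Is)"
  shows "\<exists>h. (\<forall>I\<in>set Is. h I \<in> munits {I}) \<and> w = prod_list (map h Is)"
  using assms(2,3)
proof (induction Is arbitrary: w)
  case Nil
  then show ?case by (simp add: munits_def Fs_empty)
next
  case (Cons I Is)
  have IV: "I \<subseteq> V" and rest: "\<And>J. J \<in> set Is \<Longrightarrow> J \<subseteq> V \<and> \<not> J \<subseteq> I" and I: "I \<notin> set Is"
    using peelable_Cons[OF Cons.prems(1)] by blast+
  have finI: "finite I" using finite_subset[OF IV assms(1)] .
  have finIs: "finite J" if "J \<in> set (I # Is)" for J
    using that rest finI finite_subset[OF _ assms(1)] by auto
  obtain w' where w': "w - 1 \<in> Fs (set (I # Is))" "w' - 1 \<in> Fs (set (I # Is))" "w * w' = 1" "w' * w = 1"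
    using munits_cases[OF Cons.prems(2)] by blast
  define u v where "u = plim I w" and "v = plim I w'"
  have SA: "w \<in> SA UNIV" "w' \<in> SA UNIV"
    by (rule one_plus_Fs_SA[OF w'(1)] one_plus_Fs_SA[OF w'(2)]; use finIs in auto)+
  have only: "{J \<in> set (I # Is). J \<subseteq> I} = {I}" using rest by auto
  have "plim I (w - 1) \<in> Fs {I}" "plim I (w' - 1) \<in> Fs {I}"
    using plim_Fs[OF w'(1), of I] plim_Fs[OF w'(2), of I] finIs unfolding only by blast+
  then have uv1: "u - 1 \<in> Fs {I}" "v - 1 \<in> Fs {I}"
    using SA by (simp_all add: u_def v_def plim_hom SA_one plim_self)
  have uv: "u * v = 1" "v * u = 1"
    using arg_cong[OF w'(3), of "plim I"] arg_cong[OF w'(4), of "plim I"] SA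
    by (simp_all add: u_def v_def plim_hom SA_one plim_self)
  have uvSA: "u \<in> SA I" "v \<in> SA I"
    by (rule one_plus_Fs_SA[OF uv1(1)] one_plus_Fs_SA[OF uv1(2)]; use finI in auto)+
  have sub: "Fs {I} \<subseteq> Fs (set (I # Is))" by (rule Fs_mono) auto
  have un: "J \<union> K \<in> set (I # Is)" if "J \<in> set (I # Is)" "K \<in> set (I # Is)" for J K
    using that peelable_Un[OF Cons.prems(1)] by blast
  have peel: "a - 1 \<in> Fs (set Is)" if "a - 1 \<in> Fs (set (I # Is))" "plim I a = 1" for a
  proof (rule Fs_peel[of _ I])
    have "a \<in> SA UNIV" by (rule one_plus_Fs_SA[OF that(1)]) (use finIs in auto)
    then show "plim I (a - 1) = 0" using that(2) by (simp add: plim_hom SA_one plim_self)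
  qed (use that finI finIs rest in auto)
  have vw: "v * w - 1 \<in> Fs (set Is)" "w' * u - 1 \<in> Fs (set Is)"
  proof -
    have "v * w - 1 \<in> Fs (set (I # Is))" "w' * u - 1 \<in> Fs (set (I # Is))"
      using one_plus_Fs_times[of v "set (I # Is)" w] one_plus_Fs_times[of w' "set (I # Is)" u] un uv1 w' sub
      by blast+
    moreover have "plim I (v * w) = 1" "plim I (w' * u) = 1"
      using SA uvSA[THEN SA_UNIV] uv plim_self[OF uvSA(1)] plim_self[OF uvSA(2)]
      by (simp_all only: plim_hom(2) u_def[symmetric] v_def[symmetric])
    ultimately show "v * w - 1 \<in> Fs (set Is)" "w' * u - 1 \<in> Fs (set Is)" using peel by blast+
  qed
  have "(v * w) * (w' * u) = 1" "(w' * u) * (v * w) = 1"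
    by (intro times_inverse uv w')+
  with vw have "v * w \<in> munits (set Is)" unfolding munits_def by blast
  then obtain h where h: "\<forall>J\<in>set Is. h J \<in> munits {J}" "v * w = prod_list (map h Is)"
    using Cons.IH[OF peelable_Cons(1)[OF Cons.prems(1)]] by blast
  have "w = u * (v * w)" using uv by (simp add: mult.assoc[symmetric])
  moreover have "map (h(I := u)) Is = map h Is" using I by (intro map_cong refl) auto
  then have "prod_list (map (h(I := u)) (I # Is)) = u * prod_list (map h Is)" by (simp del: map_eq_conv)
  moreover have "u \<in> munits {I}" unfolding munits_def using uv uv1 by blast
  then have "\<forall>J\<in>set (I # Is). (h(I := u)) J \<in> munits {J}" using h(1) by simp
  ultimately show ?case unfolding h(2) by metis
qed

text \<open>Later factors have index sets not contained in \<open>I\<close> and limit 1, so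
  \<open>plim I\<close> reads off the first factor, which is then cancelled.\<close>

lemma munits_factorisation_unique:
  assumes "finite V" "peelable V Is"
    and "\<And>I. I \<in> set Is \<Longrightarrow> h I \<in> munits {I}" "\<And>I. I \<in> set Is \<Longrightarrow> h' I \<in> munits {I}"
    and "prod_list (map h Is) = prod_list (map h' Is)" "J \<in> set Is"
  shows "h J = h' J"
  using assms(2-)
proof (induction Is)
  case (Cons I Is)
  have IV: "I \<subseteq> V" and rest: "\<And>J. J \<in> set Is \<Longrightarrow> J \<subseteq> V \<and> \<not> J \<subseteq> I"
    using peelable_Cons[OF Cons.prems(1)] by blast+
  have fin: "finite I" "\<And>J. J \<in> set Is \<Longrightarrow> finite J"
    using IV rest finite_subset[OF _ assms(1)] by blast+
  have head: "plim I (prod_list (map k (I # Is))) = k I"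
    if "\<And>J. J \<in> set (I # Is) \<Longrightarrow> k J \<in> munits {J}" for k
  proof -
    have r: "prod_list (map k Is) \<in> SA UNIV" "plim I (prod_list (map k Is)) = 1"
      using plim_prod_rest[of Is I k] that rest fin by auto
    have "k I - 1 \<in> Fs {I}" using that[of I] by (simp add: munits_def)
    then have "k I \<in> SA I" by (rule one_plus_Fs_SA) (use fin in auto)
    with r show ?thesis by (simp add: plim_hom SA_UNIV plim_self)
  qed
  have eqI: "h I = h' I"
    using head[of h] head[of h'] Cons.prems(2-4) by metis
  obtain v where "v * h I = 1" using munits_cases[OF Cons.prems(2)[of I]] by auto
  have "h I * prod_list (map h Is) = h I * prod_list (map h' Is)"
    using Cons.prems(4) eqI by simp
  then have "v * h I * prod_list (map h Is) = v * h I * prod_list (map h' Is)"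
    by (simp only: mult.assoc)
  then have "prod_list (map h Is) = prod_list (map h' Is)"
    by (simp only: \<open>v * h I = 1\<close> mult_1)
  then show ?case
    using Cons.IH[OF peelable_Cons(1)[OF Cons.prems(1)]] Cons.prems eqI by auto
qed simp

text \<open>Equal conjugations make \<open>w' * u - 1\<close> commute with every
  \<open>mx i\<close>, and \<open>commuting_zero\<close> applies.\<close>

lemma conj_injective:
  assumes "finite V" "peelable V Is" "{} \<notin> set Is" "u \<in> munits (set Is)" "w \<in> munits (set Is)"
    and "u * u' = 1" "u' * u = 1" "w * w' = 1" "w' * w = 1"
    and "\<And>a. a \<in> SA V \<Longrightarrow> u * a * u' = w * a * w'"
  shows "u = w"
proof -
  obtain x where x: "w * x = 1" "x \<in> munits (set Is)"
    using munits_cases[OF assms(5)] by blast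
  \<comment> \<open>\<open>w'\<close> is given merely as an inverse; by uniqueness it is the inverse
    congruent to 1.\<close>
  have "x = (w' * w) * x" using assms(9) by simp
  also have "\<dots> = w'" by (simp only: mult.assoc x(1) mult_1_right)
  finally have "x = w'" .
  then have "w' * u \<in> munits (set Is)"
    using munits_times[OF x(2) assms(4)] peelable_Un[OF assms(2)] by blast
  then have "w' * u - 1 \<in> Fs (set Is)" by (simp add: munits_def)
  moreover have "(w' * u - 1) * mx i = mx i * (w' * u - 1)" if "i \<in> V" for i
  proof -
    have "w' * (u * mx i * u') * u = w' * (w * mx i * w') * u"
      using assms(10)[OF SA_mx[OF that]] by simp
    then have "(w' * u) * mx i * (u' * u) = (w' * w) * mx i * (w' * u)" by (simp only: mult.assoc)
    then show ?thesis using assms(7,9) by (simp add: algebra_simps)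
  qed
  ultimately have "w' * u - 1 = 0" by (rule commuting_zero[OF assms(1-3)])
  then have "w * (w' * u) = w" by simp
  then show ?thesis using assms(8) by (simp add: mult.assoc[symmetric])
qed

section \<open>Translation to operators\<close>

lemma mop_ops:
  fixes a b :: "'a::field_char_0 nmat"
  shows "mop (a + b) = opadd (mop a) (mop b)" "mop (a - b) = opminus (mop a) (mop b)"
    "mop (scale c a) = opsmul c (mop a)" "mop (0 :: 'a nmat) = opzero" "mop (a * b) = mop a \<circ> mop b"
    "mop (1 :: 'a nmat) = id"
proof -
  have "mop (a + scale (- 1) b) = opminus (mop a) (mop b)"
    by (simp only: fun_eq_iff opminus_def mop_add mop_scale) simp
  then show "mop (a - b) = opminus (mop a) (mop b)" by simp
qed (simp_all only: fun_eq_iff opadd_def opsmul_def opzero_def comp_def id_def mop_add mop_scale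
    mop_zero mop_times mop_one simp_thms)

lemma mop_gen: "mop (mx i) = X i" "mop (my i) = Y i"
  by (simp_all only: fun_eq_iff X_def Y_def mop_mx mop_my simp_thms)

lemma mop_power: "mop (a ^ k) = mop a ^^ k" for a :: "'a::field_char_0 nmat"
  by (induction k) (simp_all add: mop_ops)

lemma E_eq: "E (\<alpha> i) (\<beta> i) i = mop (me {i} \<alpha> \<beta>)"
  by (simp only: E_def me_singleton mop_ops mop_power mop_gen)

lemma eprod_eq:
  assumes "finite I"
  shows "eprod I \<alpha> \<beta> = mop (me I \<alpha> \<beta>)"
proof -
  define F :: "nat \<Rightarrow> 'a op \<Rightarrow> 'a op" where "F = (\<lambda>i acc. E (\<alpha> i) (\<beta> i) i \<circ> acc)"
  have "foldr F xs id = mop (me (set xs) \<alpha> \<beta> :: 'a nmat)" if "distinct xs" for xs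
    using that
  proof (induction xs)
    case Nil
    show ?case by (simp add: mop_ops)
  next
    case (Cons x xs)
    have "foldr F (x # xs) id = F x (foldr F xs id)" by simp
    also have "foldr F xs id = mop (me (set xs) \<alpha> \<beta>)" by (rule Cons.IH) (use Cons.prems in simp)
    also have "F x (mop (me (set xs) \<alpha> \<beta>)) = mop (me {x} \<alpha> \<beta> * me (set xs) \<alpha> \<beta>)" by (simp only: F_def E_eq mop_ops)
    also have "\<dots> = mop (me (set (x # xs)) \<alpha> \<beta>)"
      using me_insert[of x "set xs" \<alpha> \<beta>, where 'a = 'a] Cons.prems by simp
    finally show ?case .
  qed
  then show ?thesis
    using assms unfolding eprod_def F_def[symmetric] by (simp only: distinct_sorted_list_of_set set_sorted_list_of_set)
qed

lemma Sn_eq: "Sn n = mop ` SA {0..<n}"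
proof
  show "Sn n \<subseteq> mop ` (SA {0..<n} :: 'a nmat set)"
  proof
    fix a :: "'a op" assume "a \<in> Sn n"
    then show "a \<in> mop ` SA {0..<n}"
    proof (induction rule: Sn.induct)
      case one
      show ?case by (rule image_eqI[where x = 1]) (simp_all only: mop_ops SA_one)
    next
      case (genx i)
      then show ?case by (intro image_eqI[where x = "mx i"]) (simp_all add: mop_gen SA_mx)
    next
      case (geny i)
      then show ?case by (intro image_eqI[where x = "my i"]) (simp_all add: mop_gen SA_my)
    next
      case (add a b)
      then show ?case by (auto simp flip: mop_ops intro: SA_add)
    next
      case (smul a c)
      then show ?case by (auto simp flip: mop_ops intro: SA_scale)
    next
      case (mult a b)
      then obtain x y where "x \<in> SA {0..<n}" "y \<in> SA {0..<n}" "a = mop x" "b = mop y" by auto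
      then show ?case by (intro image_eqI[where x = "x * y"]) (simp_all only: mop_ops SA_mult)
    qed
  qed
  show "mop ` SA {0..<n} \<subseteq> (Sn n :: 'a op set)"
  proof
    fix a :: "'a op" assume "a \<in> mop ` SA {0..<n}"
    then obtain b where "b \<in> SA {0..<n}" "a = mop b" by auto
    then show "a \<in> Sn n"
      by (induction arbitrary: a rule: SA.induct) (auto simp: mop_ops mop_gen intro: Sn.intros)
  qed
qed

lemma opspan_eq: "opspan (mop ` S) = mop ` rc.span S" for S :: "'a::field_char_0 nmat set"
proof
  show "opspan (mop ` S) \<subseteq> mop ` rc.span S"
  proof
    fix a assume "a \<in> opspan (mop ` S)"
    then show "a \<in> mop ` rc.span S"
    proof (induction rule: opspan.induct)
      case zero
      show ?case by (rule image_eqI[where x = 0]) (simp_all only: mop_ops rc.span_zero)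
    next
      case (base a)
      then show ?case by (auto intro: rc.span_base)
    next
      case (add a b)
      then show ?case by (auto simp flip: mop_ops intro: rc.span_add)
    next
      case (smul a c)
      then show ?case by (auto simp flip: mop_ops intro: rc.span_scale)
    qed
  qed
  show "mop ` rc.span S \<subseteq> opspan (mop ` S)"
  proof
    fix a assume "a \<in> mop ` rc.span S"
    then obtain b where "b \<in> rc.span S" "a = mop b" by auto
    then show "a \<in> opspan (mop ` S)"
    proof (induction arbitrary: a rule: rc.span_induct_alt)
      case base
      then show ?case by (simp add: mop_ops opspan.zero)
    next
      case (step c x y)
      then show ?case by (simp add: mop_ops opspan.intros)
    qed
  qed
qed

lemma opspan_eprod:
  assumes "\<And>I. I \<in> \<C> \<Longrightarrow> finite I"
  shows "opspan {eprod I \<alpha> \<beta> |I \<alpha> \<beta>. I \<in> \<C>} = mop ` (Fs \<C> :: 'a::field_char_0 nmat set)"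
proof -
  have "{eprod I \<alpha> \<beta> |I \<alpha> \<beta>. I \<in> \<C>} = mop ` ({me I \<alpha> \<beta> |I \<alpha> \<beta>. I \<in> \<C>} :: 'a nmat set)"
    using assms by (auto simp: eprod_eq image_iff) (metis eprod_eq)+
  then show ?thesis by (simp only: opspan_eq Fs_def)
qed

lemma FI_eq:
  assumes "finite I"
  shows "FI I = mop ` (Fs {I} :: 'a::field_char_0 nmat set)"
proof -
  have "{eprod I \<alpha> \<beta> |\<alpha> \<beta>. True} = ({eprod J \<alpha> \<beta> |J \<alpha> \<beta>. J \<in> {I}} :: 'a op set)" by blast
  moreover have "opspan {eprod J \<alpha> \<beta> |J \<alpha> \<beta>. J \<in> {I}} = mop ` (Fs {I} :: 'a nmat set)"
    by (rule opspan_eprod) (use assms in simp)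
  ultimately show ?thesis unfolding FI_def by (simp only:)
qed

text \<open>The summand K is the index set \<open>{}\<close>, whose empty product is
  \<open>id\<close>.\<close>

lemma Fn_eq: "Fn n = mop ` (Fs (Pow {0..<n}) :: 'a::field_char_0 nmat set)"
proof -
  have id: "id = (eprod {} (\<lambda>_. 0) (\<lambda>_. 0) :: 'a op)" by (simp add: eprod_def)
  have "eprod I \<alpha> \<beta> \<in> {id} \<union> {eprod I \<alpha> \<beta> | I \<alpha> \<beta>. I \<subseteq> {0..<n} \<and> I \<noteq> {}}" if "I \<subseteq> {0..<n}"
    for I and \<alpha> \<beta> :: "nat \<Rightarrow> nat"
  proof (cases "I = {}")
    case True
    then show ?thesis by (simp add: eprod_def)
  next
    case False
    with that show ?thesis by blast
  qed
  moreover have "id \<in> ({eprod I \<alpha> \<beta> | I \<alpha> \<beta>. I \<in> Pow {0..<n}} :: 'a op set)"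
    unfolding id by blast
  ultimately have "{id} \<union> {eprod I \<alpha> \<beta> | I \<alpha> \<beta>. I \<subseteq> {0..<n} \<and> I \<noteq> {}} =
      ({eprod I \<alpha> \<beta> | I \<alpha> \<beta>. I \<in> Pow {0..<n}} :: 'a op set)"
    by blast
  then show ?thesis
    unfolding Fn_def by (simp only:) (rule opspan_eprod, metis Pow_iff finite_atLeastLessThan finite_subset)
qed

lemma one_plus_image: "{opadd id a |a. a \<in> mop ` A} = mop ` {u. u - 1 \<in> A}"
  for A :: "'a::field_char_0 nmat set"
proof (intro equalityI subsetI)
  have op: "opadd id (mop a) = mop (1 + a)" for a :: "'a nmat" by (simp only: mop_ops)
  fix x
  show "x \<in> mop ` {u. u - 1 \<in> A}" if x: "x \<in> {opadd id a |a. a \<in> mop ` A}"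
  proof -
    obtain a where "a \<in> A" "x = mop (1 + a)" using x op by blast
    then show ?thesis by (intro image_eqI[where x = "1 + a"]) simp_all
  qed
  show "x \<in> {opadd id a |a. a \<in> mop ` A}" if x: "x \<in> mop ` {u. u - 1 \<in> A}"
  proof -
    obtain u where "u - 1 \<in> A" "x = mop u" using x by blast
    then have "x = opadd id (mop (u - 1))" "mop (u - 1) \<in> mop ` A" by (simp_all add: op)
    then show ?thesis by blast
  qed
qed

lemma units_image:
  "{u \<in> mop ` A. \<exists>v\<in>mop ` A. u \<circ> v = id \<and> v \<circ> u = id} = mop ` {u \<in> A. \<exists>v\<in>A. u * v = 1 \<and> v * u = 1}"
  for A :: "'a::field_char_0 nmat set"
  by (auto simp flip: mop_ops intro!: imageI)

lemma MI_units_eq: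
  assumes "finite I"
  shows "MI_units I = mop ` (munits {I} :: 'a::field_char_0 nmat set)"
proof -
  have "MI I = mop ` {u. u - 1 \<in> (Fs {I} :: 'a nmat set)}"
    unfolding MI_def FI_eq[OF assms] by (rule one_plus_image)
  then show ?thesis
    unfolding MI_units_def munits_def by (simp only: units_image) (intro arg_cong[of _ _ "image mop"], blast)
qed

lemma Mn_units_eq: "Mn_units n = mop ` (munits (Pow {0..<n} - {{}}) :: 'a::field_char_0 nmat set)"
proof -
  have "{eprod I \<alpha> \<beta> | I \<alpha> \<beta>. I \<subseteq> {0..<n} \<and> I \<noteq> {}} =
      ({eprod I \<alpha> \<beta> | I \<alpha> \<beta>. I \<in> Pow {0..<n} - {{}}} :: 'a op set)"
    by blast
  moreover have "opspan {eprod I \<alpha> \<beta> | I \<alpha> \<beta>. I \<in> Pow {0..<n} - {{}}} =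
      mop ` (Fs (Pow {0..<n} - {{}}) :: 'a nmat set)"
    by (rule opspan_eprod) (metis Diff_iff Pow_iff finite_atLeastLessThan finite_subset)
  ultimately have "Mn n = mop ` {u. u - 1 \<in> (Fs (Pow {0..<n} - {{}}) :: 'a nmat set)}"
    unfolding Mn_def by (simp only: one_plus_image)
  then show ?thesis
    unfolding Mn_units_def munits_def by (simp only: units_image) (intro arg_cong[of _ _ "image mop"], blast)
qed

text \<open>\<open>omega\<close> uses the set-theoretic inverse of the operator; a two-sided inverse
  matrix identifies it.\<close>

lemma omega_mop:
  fixes u v a :: "'a::field_char_0 nmat"
  assumes "u * v = 1" "v * u = 1" "a \<in> SA {0..<n}"
  shows "omega n (mop u) (mop a) = mop (u * a * v)"
proof -
  have "mop u \<circ> mop v = id" "mop v \<circ> mop u = id"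
    using assms(1,2) by (simp_all flip: mop_ops)
  then have "inv_into UNIV (mop u) = mop v" by (rule inv_unique_comp)
  moreover have "mop a \<in> Sn n" using assms(3) by (simp add: Sn_eq)
  ultimately show ?thesis by (simp add: omega_def mop_ops)
qed

lemma omega_undefined: "a \<notin> Sn n \<Longrightarrow> omega n u a = undefined"
  by (simp add: omega_def)

lemma omega_one: "omega n (mop 1) = (gone n :: 'a::field_char_0 op \<Rightarrow> 'a op)"
  by (auto simp: omega_def gone_def mop_ops restrict_def)

lemma omega_times:
  fixes u w :: "'a::field_char_0 nmat"
  assumes "u * u' = 1" "u' * u = 1" "w * w' = 1" "w' * w = 1" "w \<in> SA {0..<n}" "w' \<in> SA {0..<n}"
  shows "gmul n (omega n (mop u)) (omega n (mop w)) = omega n (mop (u * w))"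
proof
  fix x :: "'a op"
  show "gmul n (omega n (mop u)) (omega n (mop w)) x = omega n (mop (u * w)) x"
  proof (cases "x \<in> Sn n")
    case True
    then obtain a where a: "x = mop a" "a \<in> SA {0..<n}" by (auto simp: Sn_eq)
    have "w * a * w' \<in> SA {0..<n}" using a assms by (intro SA_mult)
    then have "gmul n (omega n (mop u)) (omega n (mop w)) x = mop (u * (w * a * w') * u')"
      using True a assms by (simp add: gmul_def omega_mop)
    also have "u * (w * a * w') * u' = (u * w) * a * (w' * u')" by (simp only: mult.assoc)
    also have "mop \<dots> = omega n (mop (u * w)) x"
      unfolding a(1) using a(2) by (intro omega_mop[symmetric] times_inverse assms)
    finally show ?thesis .
  next
    case False
    then show ?thesis by (simp add: gmul_def omega_undefined)
  qed
qed

text \<open>Invertibility inside the algebra is carried along because \<open>omega_times\<close>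
  needs it for the tail product.\<close>

lemma foldr_omega:
  fixes h :: "nat set \<Rightarrow> 'a::field_char_0 nmat"
  assumes "\<forall>I\<in>set Is. I \<subseteq> {0..<n} \<and> h I \<in> munits {I}"
  shows "foldr (\<lambda>I acc. gmul n (omega n (mop (h I))) acc) Is (gone n) = omega n (mop (prod_list (map h Is)))
    \<and> (\<exists>v\<in>SA {0..<n}. prod_list (map h Is) \<in> SA {0..<n} \<and>
        prod_list (map h Is) * v = 1 \<and> v * prod_list (map h Is) = 1)"
  using assms
proof (induction Is)
  case Nil
  then show ?case by (auto simp: omega_one intro: SA_one)
next
  case (Cons I Is)
  let ?w = "prod_list (map h Is)"
  obtain w' where IH: "foldr (\<lambda>I acc. gmul n (omega n (mop (h I))) acc) Is (gone n) = omega n (mop ?w)"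
    and w': "w' \<in> SA {0..<n}" "?w \<in> SA {0..<n}" "?w * w' = 1" "w' * ?w = 1"
    using Cons by auto
  have I: "I \<subseteq> {0..<n}" "h I \<in> munits {I}" using Cons.prems by auto
  obtain v where v: "h I - 1 \<in> Fs {I}" "v - 1 \<in> Fs {I}" "h I * v = 1" "v * h I = 1"
    using munits_cases[OF I(2)] by blast
  have SA: "h I \<in> SA {0..<n}" "v \<in> SA {0..<n}"
    by (rule one_plus_Fs_SA[OF v(1)] one_plus_Fs_SA[OF v(2)]; use I(1) finite_subset[OF I(1)] in auto)+
  have "foldr (\<lambda>I acc. gmul n (omega n (mop (h I))) acc) (I # Is) (gone n) = omega n (mop (h I * ?w))"
    using omega_times[OF v(3,4) w'(3,4,2,1)] IH by simp
  moreover have "h I * ?w * (w' * v) = 1" "(w' * v) * (h I * ?w) = 1"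
    by (intro times_inverse v w')+
  ultimately show ?case using SA w' by (auto intro!: SA_mult)
qed

text \<open>Cardinalities do not decrease along the list, so a later set contained in an earlier one
  would equal it, which distinctness excludes. The order within one cardinality is
  irrelevant.\<close>

lemma peelable_concat:
  assumes "\<forall>s\<in>{1..n}. distinct (L s) \<and> set (L s) = {I. I \<subseteq> {0..<n} \<and> card I = s}"
  shows "peelable {0..<n} (concat (map L [1..<Suc n]))" (is ?A)
    and "set (concat (map L [1..<Suc n])) = Pow {0..<n} - {{}}" (is ?B)
proof -
  have fin: "finite I" if "I \<subseteq> {0..<n}" for I :: "nat set"
    using that finite_subset by blast
  have not_sub: "\<not> J \<subseteq> I" if "I \<subseteq> {0..<n}" "card I \<le> card J" "I \<noteq> J" for I J :: "nat set"
    using that fin card_mono card_subset_eq by (metis le_antisym)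
  have "set (concat (map L [1..<Suc k])) = {I. I \<subseteq> {0..<n} \<and> 1 \<le> card I \<and> card I \<le> k} \<and>
      sorted_wrt (\<lambda>I J. \<not> J \<subseteq> I) (concat (map L [1..<Suc k]))" if "k \<le> n" for k
    using that
  proof (induction k)
    case 0
    then show ?case by auto
  next
    case (Suc k)
    have s: "distinct (L (Suc k))" "set (L (Suc k)) = {I. I \<subseteq> {0..<n} \<and> card I = Suc k}"
      using assms Suc.prems by auto
    have "sorted_wrt (\<lambda>I J. \<not> J \<subseteq> I) (L (Suc k))"
      unfolding sorted_wrt_iff_nth_less
    proof (intro allI impI)
      fix i j assume ij: "i < j" "j < length (L (Suc k))"
      then have "L (Suc k) ! i \<noteq> L (Suc k) ! j" using s(1) by (simp add: nth_eq_iff_index_eq)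
      moreover have "L (Suc k) ! i \<in> set (L (Suc k))" "L (Suc k) ! j \<in> set (L (Suc k))"
        using ij by auto
      ultimately show "\<not> L (Suc k) ! j \<subseteq> L (Suc k) ! i"
        unfolding s(2) by (intro not_sub) auto
    qed
    moreover have "\<not> J \<subseteq> I" if "I \<subseteq> {0..<n} \<and> 1 \<le> card I \<and> card I \<le> k" "J \<in> set (L (Suc k))" for I J
      using that unfolding s(2) by (intro not_sub) auto
    moreover have "concat (map L [1..<Suc (Suc k)]) = concat (map L [1..<Suc k]) @ L (Suc k)"
      by simp
    ultimately show ?case
      using Suc s(2) by (auto simp: sorted_wrt_append simp del: upt_Suc)
  qed
  from this[of n] have 1: "set (concat (map L [1..<Suc n])) = {I. I \<subseteq> {0..<n} \<and> 1 \<le> card I \<and> card I \<le> n}"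
    and 2: "sorted_wrt (\<lambda>I J. \<not> J \<subseteq> I) (concat (map L [1..<Suc n]))"
    by blast+
  have "1 \<le> card I \<and> card I \<le> n \<longleftrightarrow> I \<noteq> {}" if "I \<subseteq> {0..<n}" for I
    using that fin[OF that] card_mono[of "{0..<n}" I] by (auto simp: Suc_le_eq card_gt_0_iff)
  then show ?B unfolding 1 by blast
  then show ?A unfolding peelable_def using 2 by auto
qed

text \<open>Perturbations in F_n may have constant terms, while units in M_n have none besides 1:
  automorphisms are peeled along the list starting with \<open>{}\<close>, units along the list
  without it.\<close>

lemma peelable_empty_Cons:
  assumes "peelable V Is" "set Is = Pow V - {{}}"
  shows "peelable V ({} # Is)" "set ({} # Is) = Pow V"
  using assms unfolding peelable_def by auto

theorem theorem7p8:
  fixes n :: nat and L :: "nat \<Rightarrow> nat set list"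
  assumes "\<forall>s \<in> {1..n}. distinct (L s) \<and> set (L s) = {I. I \<subseteq> {0..<n} \<and> card I = s}"
  shows "(omega n ` (Mn_units n :: ('a::field_char_0) op set)
            = {\<sigma> \<in> Gn n. \<forall>i<n. opminus (\<sigma> (X i)) (X i) \<in> Fn n \<and> opminus (\<sigma> (Y i)) (Y i) \<in> Fn n})
       \<and> (\<forall>\<sigma> \<in> omega n ` (Mn_units n :: 'a op set).
            \<exists>!u. u \<in> (\<Pi>\<^sub>E I\<in>{I. I \<subseteq> {0..<n} \<and> I \<noteq> {}}. MI_units I) \<and> \<sigma> = decomp_prod n L u)"
proof (intro conjI ballI)
  define V where "V = {0..<n}"
  define Is where "Is = concat (map L [1..<Suc n])"
  define U where "U = (munits (set Is) :: 'a nmat set)"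
  have V: "finite V" by (simp add: V_def)
  have Is: "peelable V Is" "set Is = Pow V - {{}}"
    using peelable_concat[OF assms] by (simp_all add: V_def Is_def)
  have finIs: "finite I \<and> I \<subseteq> V" if "I \<in> Pow V" for I
    using that V finite_subset by blast
  have Mn: "Mn_units n = mop ` U" unfolding U_def Is(2) V_def by (rule Mn_units_eq)
  have Sn: "Sn n = mop ` (SA V :: 'a nmat set)" unfolding V_def by (rule Sn_eq)
  have Fn: "Fn n = mop ` (Fs (Pow V) :: 'a nmat set)" unfolding V_def by (rule Fn_eq)
  have om: "omega n (mop u) (mop a) = mop (u * a * v)" if "u * v = 1" "v * u = 1" "a \<in> SA V" for u v a :: "'a nmat"
    using omega_mop that unfolding V_def by blast
  have Fsub: "Fs (set Is) \<subseteq> (Fs (Pow V) :: 'a nmat set)" unfolding Is(2) by (rule Fs_mono) auto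
  have gen: "mx i \<in> (SA V :: 'a nmat set)" "my i \<in> (SA V :: 'a nmat set)" if "i < n" for i
    using that by (auto simp: V_def intro: SA_mx SA_my)
  have USA: "u \<in> SA V" if "u - 1 \<in> Fs (set Is)" for u :: "'a nmat"
    by (rule one_plus_Fs_SA[OF that]) (use finIs Is(2) in auto)
  show "omega n ` (Mn_units n :: 'a op set)
            = {\<sigma> \<in> Gn n. \<forall>i<n. opminus (\<sigma> (X i)) (X i) \<in> Fn n \<and> opminus (\<sigma> (Y i)) (Y i) \<in> Fn n}"
  proof (intro equalityI subsetI)
    fix \<sigma> :: "'a op \<Rightarrow> 'a op" assume "\<sigma> \<in> omega n ` Mn_units n"
    then obtain u where u: "u \<in> U" "\<sigma> = omega n (mop u)" by (auto simp: Mn)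
    obtain v where v: "u - 1 \<in> Fs (set Is)" "v - 1 \<in> Fs (set Is)" "u * v = 1" "v * u = 1"
      using munits_cases[OF u(1)[unfolded U_def]] by blast
    have SA: "u \<in> SA V" "v \<in> SA V" using USA v by blast+
    have s: "\<sigma> (mop a) = mop (u * a * v)" if "a \<in> SA V" for a
      unfolding u(2) by (rule om[OF v(3,4) that])
    have hom: "alg_hom (SA V) (\<lambda>a. u * a * v)"
      by (rule conj_alg_hom[OF _ v(4,3)]) (simp add: alg_hom_def)
    have surj: "(\<lambda>a. u * a * v) ` SA V = SA V"
      by (rule conj_surj[OF _ v(4,3) SA(2,1)]) simp
    have inj: "inj_on (\<lambda>a. u * a * v) (SA V)"
    proof (rule inj_onI)
      fix a b assume "u * a * v = u * b * v"
      then have "v * (u * a * v) * u = v * (u * b * v) * u" by simp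
      then have "(v * u) * a * (v * u) = (v * u) * b * (v * u)" by (simp only: mult.assoc)
      then show "a = b" by (simp add: v)
    qed
    have "bij_betw \<sigma> (Sn n) (Sn n)"
    proof (rule bij_betwI')
      fix x y :: "'a op" assume "x \<in> Sn n" "y \<in> Sn n"
      then show "\<sigma> x = \<sigma> y \<longleftrightarrow> x = y" using inj by (auto simp: Sn s inj_on_def)
    next
      fix x :: "'a op" assume "x \<in> Sn n"
      then show "\<sigma> x \<in> Sn n" using surj by (auto simp: Sn s intro!: imageI)
    next
      fix y :: "'a op" assume "y \<in> Sn n"
      then obtain b where b: "b \<in> SA V" "y = mop b" by (auto simp: Sn)
      then obtain a where a: "a \<in> SA V" "b = u * a * v" using surj by (metis (no_types, lifting) imageE)
      have "y = \<sigma> (mop a)" using b a s[OF a(1)] by simp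
      then show "\<exists>x\<in>Sn n. y = \<sigma> x" using a(1) unfolding Sn by blast
    qed
    moreover have "\<sigma> (opadd a b) = opadd (\<sigma> a) (\<sigma> b) \<and> \<sigma> (a \<circ> b) = \<sigma> a \<circ> \<sigma> b"
      if "a \<in> Sn n" "b \<in> Sn n" for a b
      using that unfolding Sn
      by (auto simp: s SA_add SA_mult alg_homD(2,3)[OF hom] simp flip: mop_ops)
    moreover have "\<sigma> (opsmul c a) = opsmul c (\<sigma> a)" if "a \<in> Sn n" for c a
      using that unfolding Sn by (auto simp: s SA_scale simp flip: mop_ops)
    moreover have "\<sigma> id = id"
      using s[OF SA_one] v by (simp add: mop_ops)
    moreover have "\<sigma> a = undefined" if "a \<notin> Sn n" for a
      unfolding u(2) by (rule omega_undefined[OF that])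
    ultimately have G: "\<sigma> \<in> Gn n" unfolding Gn_def by blast
    have near: "u * x * v - x \<in> Fs (Pow V)" if "x * u - u * x \<in> Fs (set Is)" for x
    proof -
      \<comment> \<open>Rewritten as minus the commutator of \<open>x\<close> and \<open>u\<close>,
        times \<open>v\<close>, so that only elements of \<open>Fs\<close> are multiplied.\<close>
      have "u * x * v - x = u * x * v - x * (u * v)" using v by simp
      also have "\<dots> = - ((x * u - u * x) + (x * u - u * x) * (v - 1))" by (simp add: algebra_simps)
      also have "\<dots> \<in> Fs (Pow V)"
        by (intro Fs_neg Fs_add Fs_times[of _ "Pow V" _ "Pow V"]) (use that v Fsub in auto)
      finally show ?thesis .
    qed
    have "opminus (\<sigma> (X i)) (X i) \<in> Fn n \<and> opminus (\<sigma> (Y i)) (Y i) \<in> Fn n" if "i < n" for i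
      using near[OF one_plus_Fs_commutator(1)[OF v(1)], of i] near[OF one_plus_Fs_commutator(2)[OF v(1)], of i]
        s[OF gen(1)[OF that]] s[OF gen(2)[OF that]]
      unfolding Fn by (simp flip: mop_ops mop_gen)
    with G show "\<sigma> \<in> {\<sigma> \<in> Gn n. \<forall>i<n. opminus (\<sigma> (X i)) (X i) \<in> Fn n \<and> opminus (\<sigma> (Y i)) (Y i) \<in> Fn n}"
      by blast
  next
    fix \<sigma> :: "'a op \<Rightarrow> 'a op"
    assume "\<sigma> \<in> {\<sigma> \<in> Gn n. \<forall>i<n. opminus (\<sigma> (X i)) (X i) \<in> Fn n \<and> opminus (\<sigma> (Y i)) (Y i) \<in> Fn n}"
    then have bij: "bij_betw \<sigma> (Sn n) (Sn n)"
      and add: "\<And>a b. a \<in> Sn n \<Longrightarrow> b \<in> Sn n \<Longrightarrow> \<sigma> (opadd a b) = opadd (\<sigma> a) (\<sigma> b)"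
      and mult: "\<And>a b. a \<in> Sn n \<Longrightarrow> b \<in> Sn n \<Longrightarrow> \<sigma> (a \<circ> b) = \<sigma> a \<circ> \<sigma> b"
      and smul: "\<And>c a. a \<in> Sn n \<Longrightarrow> \<sigma> (opsmul c a) = opsmul c (\<sigma> a)"
      and one: "\<sigma> id = id" and undef: "\<And>a. a \<notin> Sn n \<Longrightarrow> \<sigma> a = undefined"
      and near: "\<And>i. i < n \<Longrightarrow> opminus (\<sigma> (X i)) (X i) \<in> Fn n"
        "\<And>i. i < n \<Longrightarrow> opminus (\<sigma> (Y i)) (Y i) \<in> Fn n"
      unfolding Gn_def by blast+
    have "\<forall>a\<in>SA V. \<exists>b\<in>SA V. \<sigma> (mop a) = mop b"
      using bij unfolding Sn bij_betw_def by blast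
    \<comment> \<open>\<sigma> transported to matrices; its values off \<open>SA V\<close> are
      arbitrary.\<close>
    then obtain \<tau> where \<tau>: "\<And>a. a \<in> SA V \<Longrightarrow> \<tau> a \<in> SA V" "\<And>a. a \<in> SA V \<Longrightarrow> mop (\<tau> a) = \<sigma> (mop a)"
      by metis
    have mopS: "mop a \<in> Sn n" if "a \<in> SA V" for a :: "'a nmat" using that by (simp add: Sn)
    have hom: "alg_hom (SA V) \<tau>"
      unfolding alg_hom_def
    proof (intro conjI ballI allI)
      have "mop (\<tau> 1) = mop 1" using \<tau>(2)[OF SA_one] one by (simp add: mop_ops)
      then show "\<tau> 1 = 1" by simp
      fix a :: "'a nmat" assume a: "a \<in> SA V"
      {
        fix b :: "'a nmat" assume b: "b \<in> SA V"
        have "mop (\<tau> (a + b)) = mop (\<tau> a + \<tau> b)"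
          using \<tau>(2)[OF SA_add[OF a b]] add[OF mopS[OF a] mopS[OF b]] \<tau>(2)[OF a] \<tau>(2)[OF b]
          by (simp only: mop_ops)
        then show "\<tau> (a + b) = \<tau> a + \<tau> b" by simp
        have "mop (\<tau> (a * b)) = mop (\<tau> a * \<tau> b)"
          using \<tau>(2)[OF SA_mult[OF a b]] mult[OF mopS[OF a] mopS[OF b]] \<tau>(2)[OF a] \<tau>(2)[OF b]
          by (simp only: mop_ops)
        then show "\<tau> (a * b) = \<tau> a * \<tau> b" by simp
      }
      fix c
      have "mop (\<tau> (scale c a)) = mop (scale c (\<tau> a))"
        using \<tau>(2)[OF SA_scale[OF a]] smul[OF mopS[OF a]] \<tau>(2)[OF a] by (simp only: mop_ops)
      then show "\<tau> (scale c a) = scale c (\<tau> a)" by simp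
    qed
    have surj: "\<tau> ` SA V = SA V"
    proof
      show "\<tau> ` SA V \<subseteq> SA V" using \<tau>(1) by blast
      show "SA V \<subseteq> \<tau> ` SA V"
      proof
        fix b :: "'a nmat" assume "b \<in> SA V"
        then have "mop b \<in> \<sigma> ` Sn n" using mopS bij_betw_imp_surj_on[OF bij] by blast
        then obtain a where a: "a \<in> SA V" "mop b = \<sigma> (mop a)" by (auto simp: Sn)
        then have "b = \<tau> a" using \<tau>(2)[OF a(1)] by (metis mop_inject)
        with a(1) show "b \<in> \<tau> ` SA V" by blast
      qed
    qed
    have "\<tau> (mx i) - mx i \<in> Fs (Pow V)" "\<tau> (my i) - my i \<in> Fs (Pow V)" if "i \<in> V" for i
    proof -
      have i: "i < n" using that by (simp add: V_def)
      have "mop (\<tau> (mx i) - mx i) \<in> Fn n" "mop (\<tau> (my i) - my i) \<in> Fn n"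
        using near[OF i] \<tau>(2)[OF gen(1)[OF i]] \<tau>(2)[OF gen(2)[OF i]]
        by (simp_all only: mop_ops mop_gen)
      then show "\<tau> (mx i) - mx i \<in> Fs (Pow V)" "\<tau> (my i) - my i \<in> Fs (Pow V)"
        unfolding Fn by (auto simp: image_iff)
    qed
    then obtain u v where uv: "u - 1 \<in> Fs (set Is)" "v - 1 \<in> Fs (set Is)" "u * v = 1" "v * u = 1"
      and tau: "\<forall>a\<in>SA V. \<tau> a = u * a * v"
      using near_identity_inner[OF V peelable_empty_Cons(1)[OF Is] hom surj]
      unfolding peelable_empty_Cons(2)[OF Is] Is(2) by blast
    have "u \<in> U" unfolding U_def munits_def using uv by blast
    moreover have "\<sigma> x = omega n (mop u) x" for x
    proof (cases "x \<in> Sn n")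
      case True
      then obtain a where "a \<in> SA V" "x = mop a" by (auto simp: Sn)
      then show ?thesis using om[OF uv(3,4)] tau \<tau>(2) by metis
    next
      case False
      then show ?thesis by (simp add: undef omega_undefined)
    qed
    ultimately show "\<sigma> \<in> omega n ` Mn_units n" unfolding Mn by blast
  qed
next
  define V where "V = {0..<n}"
  define Is where "Is = concat (map L [1..<Suc n])"
  have V: "finite V" by (simp add: V_def)
  have Is: "peelable V Is" "set Is = Pow V - {{}}"
    using peelable_concat[OF assms] by (simp_all add: V_def Is_def)
  have idx: "{I. I \<subseteq> {0..<n} \<and> I \<noteq> {}} = set Is" unfolding Is(2) V_def by auto
  have MI: "MI_units I = mop ` (munits {I} :: 'a nmat set)" if "I \<in> set Is" for I
    by (rule MI_units_eq) (use that Is(2) V finite_subset in auto)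
  have decomp: "decomp_prod n L g = omega n (mop (prod_list (map h Is)))"
    if "\<And>I. I \<in> set Is \<Longrightarrow> h I \<in> munits {I} \<and> g I = mop (h I)" for g and h :: "nat set \<Rightarrow> 'a nmat"
  proof -
    have "decomp_prod n L g = foldr (\<lambda>I acc. gmul n (omega n (mop (h I))) acc) Is (gone n)"
      unfolding decomp_prod_def Is_def[symmetric] by (rule foldr_cong) (simp_all add: that)
    then show ?thesis using foldr_omega[of Is n h] that Is(2) unfolding V_def by auto
  qed
  have prod: "prod_list (map h Is) \<in> munits (set Is)"
    if "\<And>I. I \<in> set Is \<Longrightarrow> h I \<in> munits {I}" for h :: "nat set \<Rightarrow> 'a nmat"
  proof -
    have "prod_list (map h Js) \<in> munits (set Is)" if "set Js \<subseteq> set Is" for Js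
      using that
    proof (induction Js)
      case Nil
      show ?case by (simp add: munits_one)
    next
      case (Cons I Js)
      have "h I \<in> munits (set Is)"
        using \<open>\<And>I. I \<in> set Is \<Longrightarrow> h I \<in> munits {I}\<close>[of I] munits_mono[of "{I}" "set Is"] Cons.prems by auto
      then show ?case
        using Cons munits_times[of "h I" "set Is"] peelable_Un[OF Is(1)] by simp
    qed
    then show ?thesis by blast
  qed
  fix \<sigma> :: "'a op \<Rightarrow> 'a op" assume "\<sigma> \<in> omega n ` Mn_units n"
  then obtain w :: "'a nmat" where w: "w \<in> munits (set Is)" "\<sigma> = omega n (mop w)"
    unfolding Is(2) V_def Mn_units_eq by blast
  obtain h where h: "\<forall>I\<in>set Is. h I \<in> munits {I}" "w = prod_list (map h Is)"
    using munits_factorisation[OF V Is(1) w(1)] by blast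
  show "\<exists>!u. u \<in> (\<Pi>\<^sub>E I\<in>{I. I \<subseteq> {0..<n} \<and> I \<noteq> {}}. MI_units I) \<and> \<sigma> = decomp_prod n L u"
    unfolding idx
  proof (rule ex1I[of _ "restrict (\<lambda>I. mop (h I)) (set Is)"])
    show "restrict (\<lambda>I. mop (h I)) (set Is) \<in> (\<Pi>\<^sub>E I\<in>set Is. MI_units I) \<and>
        \<sigma> = decomp_prod n L (restrict (\<lambda>I. mop (h I)) (set Is))"
      using h MI decomp[of h "restrict (\<lambda>I. mop (h I)) (set Is)"] w(2) by auto
  next
    fix g assume g: "g \<in> (\<Pi>\<^sub>E I\<in>set Is. MI_units I) \<and> \<sigma> = decomp_prod n L g"
    then have "\<forall>I\<in>set Is. \<exists>x. x \<in> (munits {I} :: 'a nmat set) \<and> g I = mop x"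
      using MI by blast
    then obtain k where k: "\<And>I. I \<in> set Is \<Longrightarrow> k I \<in> (munits {I} :: 'a nmat set)"
      "\<And>I. I \<in> set Is \<Longrightarrow> g I = mop (k I)"
      by metis
    let ?w = "prod_list (map k Is)"
    have "omega n (mop w) = omega n (mop ?w)" using decomp[of k g] k g w(2) by simp
    moreover obtain w' where w': "w * w' = 1" "w' * w = 1" using munits_cases[OF w(1)] by blast
    moreover obtain x' where x': "?w * x' = 1" "x' * ?w = 1" using munits_cases[OF prod[OF k(1)]] by blast
    \<comment> \<open>Equal automorphisms give equal conjugations, hence equal units by
      \<open>conj_injective\<close>, and the factors agree by uniqueness of the
      factorisation.\<close>
    ultimately have "mop (w * a * w') = mop (?w * a * x')" if "a \<in> SA V" for a
      using omega_mop[OF w' that[unfolded V_def]] omega_mop[OF x' that[unfolded V_def]] by simp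
    then have "w * a * w' = ?w * a * x'" if "a \<in> SA V" for a using that by simp
    then have "w = ?w"
      using conj_injective[OF V Is(1) _ w(1) prod[OF k(1)] w' x'] Is(2) by blast
    then have "h I = k I" if "I \<in> set Is" for I
      using munits_factorisation_unique[OF V Is(1), of h k I] h k that by simp
    \<comment> \<open>Functions in the extensional product are fixed off \<open>set Is\<close>, so
      agreement on the list suffices.\<close>
    then show "g = restrict (\<lambda>I. mop (h I)) (set Is)"
      using g k(2) by (intro extensionalityI[of _ "set Is"]) (auto simp: PiE_def)
  qed
qed

end
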